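(* Let $\ell>3$ be prime. (1) For $1\le k\le\frac{\ell-3}{2}$ we have $C_{2k}\in P\mathcal{X}_{2k}$, whereas $C_{\ell-1}=2P\Phi_{\ell-2}+PG_C$ for some $G_C\in\mathcal{X}_{\ell-1}$. (2) For $2\le k\le\frac{\ell-3}{2}$ we have $\mathcal{R}_{2k}-P_k(\delta_q)\mathcal{R}_2\in P\mathcal{X}_{2k}$, whereas $$\mathcal{R}_{\ell-1}-P_{\frac{\ell-1}{2}}(\delta_q)\mathcal{R}_2=2P\Phi_{\ell-2}+PG_R$$ for some $G_R\in\mathcal{X}_{\ell-1}$.
   Context: $q=e^{2\pi iz}$, $\delta_q:=q\frac{d}{dq}$. $P:=\prod_{n\ge1}(1-q^n)^{-1}$; $\Phi_j:=\sum_{n\ge1}\sigma_j(n)q^n$, $\sigma_j(n)=\sum_{d\mid n}d^j$; $E_2:=1-24\Phi_1$. Rank: largest part minus number of parts; $N(m,n)$ = number of partitions of $n$ with rank $m$; $N_j(n):=\sum_mm^jN(m,n)$, $\mathcal{R}_j:=\sum_{n\ge1}N_j(n)q^n$. Crank: largest part if there are no ones, otherwise (number of parts larger than the number of ones) minus (number of ones); $M(m,n)$ = number of partitions of $n$ with crank $m$ for $n>1$, with $M(0,1):=-1$, $M(\pm1,1):=1$, $M(m,1):=0$ otherwise; $M_j(n):=\sum_mm^jM(m,n)$, $C_j:=\sum_{n\ge1}M_j(n)q^n$. $P_k(x)\in\mathbb{Q}[x]$: $P_0:=0$, $P_1:=1$, and for $k\ge2$, $P_k(x):=-\frac{1}{(2k-1)(k-1)}\sum_{i=1}^{k-1}\left(6x\binom{2k}{2i}(2^{2i-1}-1)+\binom{2k}{2i+2}(2^{2i+1}-1)-2^{2i}\binom{2k}{2i+1}+\binom{2k}{2i}\right)P_{k-i}(x)$.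 An $\ell$-integral quasimodular form of weight $w$ and level 1 is a sum of functions $E_2^aF_b$, $a,b\ge0$, $2a+b=w$, with $F_b\in M_b(SL_2(\mathbb{Z}))$ having rational, $\ell$-integral coefficients with bounded denominators; for even $k$, $\mathcal{X}_k$ is the set of sums of such forms of weight $\le k$, and $P\mathcal{X}_k:=\{GP:G\in\mathcal{X}_k\}$. *)

theory Defs
  imports Complex_Main "HOL-Library.Multiset" "HOL-Library.Groups_Big_Fun"
    "HOL-Computational_Algebra.Formal_Power_Series" "HOL-Computational_Algebra.Polynomial"
begin

(* q-series are represented by their q-expansions, i.e. formal power series over Q. *)

(* delta_q = q d/dq, and more generally p(delta_q) for a polynomial p *)
definition delta_q :: "rat fps \<Rightarrow> rat fps" where
  "delta_q F = Abs_fps (\<lambda>n. of_nat n * fps_nth F n)"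

definition poly_delta :: "rat poly \<Rightarrow> rat fps \<Rightarrow> rat fps" where
  "poly_delta p F = Abs_fps (\<lambda>n. poly p (of_nat n) * fps_nth F n)"

(* P = prod_{n>=1} (1-q^n)^{-1}: the m-th coefficient is that of the finite product up to n = m *)
definition Pser :: "rat fps" where
  "Pser = Abs_fps (\<lambda>m. fps_nth (\<Prod>n\<in>{1..m}. inverse (1 - fps_X ^ n)) m)"

definition sigma :: "nat \<Rightarrow> nat \<Rightarrow> nat" where
  "sigma j n = (\<Sum>d\<in>{d. d dvd n}. d ^ j)"

definition Phi :: "nat \<Rightarrow> rat fps" where
  "Phi j = Abs_fps (\<lambda>n. if n = 0 then 0 else of_nat (sigma j n))"

definition E2 :: "rat fps" where
  "E2 = 1 - 24 * Phi 1"

definition partitions :: "nat \<Rightarrow> nat multiset set" where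
  "partitions n = {p. (\<forall>x\<in>#p. 0 < x) \<and> sum_mset p = n}"

definition rank :: "nat multiset \<Rightarrow> int" where
  "rank p = int (Max (set_mset p)) - int (size p)"

definition crank :: "nat multiset \<Rightarrow> int" where
  "crank p = (let w = count p 1 in
     if w = 0 then int (Max (set_mset p))
     else int (size (filter_mset (\<lambda>x. x > w) p)) - int w)"

definition N_rank :: "int \<Rightarrow> nat \<Rightarrow> int" where
  "N_rank m n = int (card {p \<in> partitions n. rank p = m})"

definition M_crank :: "int \<Rightarrow> nat \<Rightarrow> int" where
  "M_crank m n = (if n = 1 then (if m = 0 then -1 else if m = 1 \<or> m = -1 then 1 else 0)
                  else int (card {p \<in> partitions n. crank p = m}))"

definition N_mom :: "nat \<Rightarrow> nat \<Rightarrow> int" where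
  "N_mom j n = Sum_any (\<lambda>m. m ^ j * N_rank m n)"

definition M_mom :: "nat \<Rightarrow> nat \<Rightarrow> int" where
  "M_mom j n = Sum_any (\<lambda>m. m ^ j * M_crank m n)"

definition Rser :: "nat \<Rightarrow> rat fps" where
  "Rser j = Abs_fps (\<lambda>n. if n = 0 then 0 else of_int (N_mom j n))"

definition Cser :: "nat \<Rightarrow> rat fps" where
  "Cser j = Abs_fps (\<lambda>n. if n = 0 then 0 else of_int (M_mom j n))"

function Ppoly :: "nat \<Rightarrow> rat poly" where
  "Ppoly k = (if k = 0 then 0 else if k = 1 then 1 else
     smult (- 1 / (of_nat (2*k - 1) * of_nat (k - 1)))
       (\<Sum>i\<in>{1..k-1}.
          [: of_nat ((2*k) choose (2*i+2)) * (2 ^ (2*i+1) - 1)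
             - 2 ^ (2*i) * of_nat ((2*k) choose (2*i+1)) + of_nat ((2*k) choose (2*i)),
             6 * of_nat ((2*k) choose (2*i)) * (2 ^ (2*i - 1) - 1) :] * Ppoly (k - i)))"
  by auto
termination
  by (relation "measure id") auto

definition qfun :: "rat fps \<Rightarrow> complex \<Rightarrow> complex" where
  "qfun F z = suminf (\<lambda>n. of_rat (fps_nth F n) * exp (2 * of_real pi * \<i> * of_nat n * z))"

definition modular_form :: "nat \<Rightarrow> rat fps \<Rightarrow> bool" where
  "modular_form k F \<longleftrightarrow>
     (\<forall>z. Im z > 0 \<longrightarrow> summable (\<lambda>n. of_rat (fps_nth F n) * exp (2 * of_real pi * \<i> * of_nat n * z))) \<and>
     (\<forall>z. Im z > 0 \<longrightarrow> qfun F (- 1 / z) = z ^ k * qfun F z)"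

definition l_integral_rat :: "nat \<Rightarrow> rat \<Rightarrow> bool" where
  "l_integral_rat l r \<longleftrightarrow> coprime (snd (quotient_of r)) (int l)"

definition bounded_denominators :: "rat fps \<Rightarrow> bool" where
  "bounded_denominators F \<longleftrightarrow> (\<exists>D::int. D > 0 \<and> (\<forall>n. of_int D * fps_nth F n \<in> \<int>))"

definition good_modform :: "nat \<Rightarrow> nat \<Rightarrow> rat fps \<Rightarrow> bool" where
  "good_modform l b F \<longleftrightarrow> modular_form b F \<and> (\<forall>n. l_integral_rat l (fps_nth F n)) \<and> bounded_denominators F"

definition Xset :: "nat \<Rightarrow> nat \<Rightarrow> rat fps set" where
  "Xset l k = {G. \<exists>xs :: (nat \<times> nat \<times> rat fps) list.
      (\<forall>(a, b, F) \<in> set xs. 2 * a + b \<le> k \<and> good_modform l b F) \<and>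
      G = (\<Sum>(a, b, F) \<leftarrow> xs. E2 ^ a * F)}"

definition PXset :: "nat \<Rightarrow> nat \<Rightarrow> rat fps set" where
  "PXset l k = {Pser * G | G. G \<in> Xset l k}"

end

theory Submission
  imports Defs "HOL-Complex_Analysis.Complex_Analysis"
begin

text \<open>
  Write \<open>P = 1 / (q; q)\<^sub>\<infinity>\<close>, let \<open>C(x)\<close> and \<open>R(x)\<close> be the generating functions of crank and rank, and
  put \<open>x = exp t\<close>, so that moments are Taylor coefficients in \<open>t\<close>.

  By the q-binomial theorem \<open>C(x) = (q; q)\<^sub>\<infinity> / ((x q; q)\<^sub>\<infinity> (q / x; q)\<^sub>\<infinity>)\<close>, whose logarithmic derivative in
  \<open>t\<close> is \<open>\<Sum> 2 \<Phi>\<^sub>j t ^ j / j!\<close> over odd \<open>j\<close>. Hence the crank moments are \<open>P\<close> times polynomials in the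
  \<open>\<Phi>\<^sub>j\<close>, which up to a constant are Eisenstein series of weight \<open>j + 1\<close>. The constants are
  \<open>\<zeta>(j + 1) j! / (2 pi i) ^ (j + 1)\<close>, and the recurrence for even zeta values that follows from the Riccati
  equation of the cotangent shows them to be \<open>l\<close>-integral for \<open>j + 1 < l - 1\<close>, and to become so after
  multiplication by \<open>l\<close> for \<open>j + 1 = l - 1\<close>.

  For the rank, let \<open>L\<^sub>m\<close> count partitions of rank at most \<open>m\<close>. Dyson's map (remove the first column of
  length \<open>s\<close>, add a row of length \<open>s + m - 1\<close>) gives \<open>q ^ m L\<^sub>m + q L\<^bsub>m-3\<^esub> = q P\<close> up to the empty
  partition. Applying the heat operator, \<open>B\<^sub>m = (3 \<delta>\<^sub>q + m (m + 1) / 2) L\<^sub>m\<close> satisfies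
  \<open>q ^ m B\<^sub>m + q B\<^bsub>m-3\<^esub> = q P ((m - 3) (m - 2) / 2 + 3 \<Phi>\<^sub>1)\<close>. The Laurent coefficients of \<open>x C(x) ^ 3 / (1 - x) ^ 3\<close>
  satisfy the same recurrence up to a power of \<open>P\<close>, because the expansions on both sides of the pole \<open>x = 1\<close> differ by the
  jet of the residual factor there, and the recurrence has a unique solution in power series. This is the
  rank-crank partial differential equation of Atkin and Garvan; multiplied by \<open>cosh t\<close>, its Taylor
  coefficients are the recurrence defining \<open>P\<^sub>k\<close>. It remains to use that quasimodular forms are closed under
  \<open>\<delta>\<^sub>q\<close>, which follows from the transformation law of \<open>E\<^sub>2\<close>.
\<close>

text \<open>The prime enters only through denominators. Every \<open>Phi j\<close> with odd
  \<open>j\<close> and \<open>j + 1 <= l - 3\<close> belongs to \<open>Xset\<close>, while for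
  \<open>Phi (l - 2)\<close> this is available only after multiplication by \<open>l\<close>. This
  is why both statements at index \<open>l - 1\<close> carry \<open>2 P Phi (l - 2)\<close>
  explicitly. For the crank, it is the single term of the recurrence that pairs the zeroth moment
  with \<open>Phi (l - 2)\<close>. For the rank, the cube of \<open>C(x)\<close> yields the
  coefficient 6, three factors with 2 each; the division by \<open>(2 k - 1) (k - 1)\<close>, which
  is 3 modulo \<open>l\<close> at \<open>k = (l - 1) / 2\<close>, brings back 2, and the error is a
  multiple of \<open>l\<close>. The obstacle on the rank side is the pole at \<open>x = 1\<close>,
  exactly where moments are taken. Everything singular is therefore treated as a family of Laurent
  coefficients indexed by \<open>m\<close>, and \<open>x = exp t\<close> is substituted only in
  families that are finitely supported in \<open>m\<close> for every power of
  \<open>q\<close>.\<close>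

unbundle no vec_syntax
unbundle fps_syntax
hide_const (open) Sigma_Algebra.sigma Cartesian_Space.rank
no_notation Infinite_Set_Sum.abs_summable_on (infix \<open>abs'_summable'_on\<close> 50)
notation Infinite_Sum.abs_summable_on (infixr \<open>abs'_summable'_on\<close> 46)

subsection \<open>q-expansions as functions on the upper half-plane\<close>

definition qexp :: "complex \<Rightarrow> complex" where
  "qexp z = exp (2 * of_real pi * \<i> * z)"

lemma qexp_power: "exp (2 * of_real pi * \<i> * of_nat n * z) = qexp z ^ n"
  unfolding qexp_def by (simp add: exp_of_nat_mult[symmetric] mult_ac)

lemma norm_qexp: "norm (qexp z) = exp (- 2 * pi * Im z)"
  unfolding qexp_def by (simp add: norm_exp_eq_Re)

lemma norm_qexp_less_1: "Im z > 0 \<Longrightarrow> norm (qexp z) < 1"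
  by (simp add: norm_qexp)

lemma qexp_nonzero [simp]: "qexp z \<noteq> 0"
  by (simp add: qexp_def)

lemma has_field_derivative_qexp:
  "(qexp has_field_derivative 2 * of_real pi * \<i> * qexp z) (at z)"
  unfolding qexp_def [abs_def] by (auto intro!: derivative_eq_intros)

text \<open>The analytic half of \<open>modular_form\<close>, split off because \<open>E2\<close>
  and the \<open>Phi j\<close> need it without being modular themselves.\<close>

definition qconvergent :: "rat fps \<Rightarrow> bool" where
  "qconvergent F \<longleftrightarrow>
     (\<forall>z. Im z > 0 \<longrightarrow> summable (\<lambda>n. of_rat (fps_nth F n) * exp (2 * of_real pi * \<i> * of_nat n * z)))"

lemma modular_form_iff:
  "modular_form k F \<longleftrightarrow> qconvergent F \<and> (\<forall>z. Im z > 0 \<longrightarrow> qfun F (- 1 / z) = z ^ k * qfun F z)"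
  unfolding modular_form_def qconvergent_def ..

text \<open>Convergence on the half-plane gives convergence at a point of every radius between 0 and
  1, and a power series converges absolutely strictly inside such a radius. The absolute form is
  what Cauchy products need.\<close>

lemma qconvergent_iff:
  "qconvergent F \<longleftrightarrow> (\<forall>w::complex. norm w < 1 \<longrightarrow> summable (\<lambda>n. norm (of_rat (fps_nth F n) * w ^ n)))"
proof
  assume F: "qconvergent F"
  show "\<forall>w::complex. norm w < 1 \<longrightarrow> summable (\<lambda>n. norm (of_rat (fps_nth F n) * w ^ n))"
  proof (intro allI impI)
    fix w :: complex assume w: "norm w < 1"
    obtain r where r: "norm w < r" "r < 1" using w dense by blast
    hence r0: "r > 0" using norm_ge_zero[of w] by linarith
    \<comment> \<open>The point of the imaginary axis with \<open>qexp z = r\<close>.\<close>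
    define z where "z = \<i> * of_real (- ln r / (2 * pi))"
    have "qexp z = exp (of_real (ln r))"
      unfolding qexp_def z_def by (simp add: field_simps)
    also have "\<dots> = of_real r" using r0 by (simp add: exp_of_real)
    finally have qz: "qexp z = of_real r" .
    have "Im z > 0" using r r0 by (simp add: z_def field_simps)
    hence "summable (\<lambda>n. of_rat (fps_nth F n) * of_real r ^ n :: complex)"
      using F[unfolded qconvergent_def qexp_power, rule_format, of z] by (simp add: qz)
    from powser_insidea[OF this, of w] show "summable (\<lambda>n. norm (of_rat (fps_nth F n) * w ^ n))"
      using r r0 by simp
  qed
next
  assume F: "\<forall>w::complex. norm w < 1 \<longrightarrow> summable (\<lambda>n. norm (of_rat (fps_nth F n) * w ^ n))"
  show "qconvergent F" unfolding qconvergent_def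
    using F norm_qexp_less_1 by (auto simp: qexp_power intro: summable_norm_cancel)
qed

lemma qfun_altdef: "qfun F z = suminf (\<lambda>n. of_rat (fps_nth F n) * qexp z ^ n)"
  by (simp add: qfun_def qexp_power)

lemma qconvergent_summable:
  "qconvergent F \<Longrightarrow> Im z > 0 \<Longrightarrow> summable (\<lambda>n. of_rat (fps_nth F n) * qexp z ^ n)"
  by (simp add: qconvergent_def qexp_power)

lemma qconvergent_add: "qconvergent F \<Longrightarrow> qconvergent G \<Longrightarrow> qconvergent (F + G)"
  unfolding qconvergent_def by (auto simp: of_rat_add ring_distribs intro!: summable_add)

lemma qfun_add: "qconvergent F \<Longrightarrow> qconvergent G \<Longrightarrow> Im z > 0 \<Longrightarrow> qfun (F + G) z = qfun F z + qfun G z"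
  unfolding qfun_altdef
  by (subst suminf_add) (auto simp: of_rat_add ring_distribs intro: qconvergent_summable)

lemma qconvergent_fps_const: "qconvergent (fps_const c)"
  unfolding qconvergent_def
proof (intro allI impI)
  fix z :: complex
  show "summable (\<lambda>n. of_rat (fps_const c $ n) * exp (2 * complex_of_real pi * \<i> * of_nat n * z))"
    by (rule summable_finite[of "{0}"]) auto
qed

lemma qfun_fps_const: "qfun (fps_const c) z = of_rat c"
proof -
  have "(\<lambda>n. of_rat (fps_nth (fps_const c) n) * qexp z ^ n) = (\<lambda>n. if n = 0 then of_rat c else 0)"
    by auto
  thus ?thesis unfolding qfun_altdef using suminf_finite[of "{0}" "\<lambda>n. if n = 0 then of_rat c else (0::complex)"]
    by simp
qed

lemma of_rat_fps_mult_nth: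
  "of_rat (fps_nth (F * G) n) * (w::complex) ^ n =
     (\<Sum>i\<le>n. (of_rat (fps_nth F i) * w ^ i) * (of_rat (fps_nth G (n - i)) * w ^ (n - i)))"
proof -
  have "of_rat (fps_nth (F * G) n) * w ^ n = (\<Sum>i\<le>n. of_rat (fps_nth F i) * of_rat (fps_nth G (n - i)) * w ^ n)"
    by (simp add: fps_mult_nth of_rat_sum of_rat_mult sum_distrib_right atLeast0AtMost)
  also have "\<dots> = (\<Sum>i\<le>n. (of_rat (fps_nth F i) * w ^ i) * (of_rat (fps_nth G (n - i)) * w ^ (n - i)))"
    by (intro sum.cong refl) (auto simp: mult_ac power_add[symmetric])
  finally show ?thesis .
qed

lemma qconvergent_mult: "qconvergent F \<Longrightarrow> qconvergent G \<Longrightarrow> qconvergent (F * G)"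
  unfolding qconvergent_def
proof (intro allI impI)
  fix z :: complex
  assume F: "\<forall>z. Im z > 0 \<longrightarrow> summable (\<lambda>n. of_rat (F $ n) * exp (2 * complex_of_real pi * \<i> * of_nat n * z))"
    and G: "\<forall>z. Im z > 0 \<longrightarrow> summable (\<lambda>n. of_rat (G $ n) * exp (2 * complex_of_real pi * \<i> * of_nat n * z))"
    and z: "Im z > 0"
  have "summable (\<lambda>n. norm (of_rat (fps_nth F n) * qexp z ^ n))"
       "summable (\<lambda>n. norm (of_rat (fps_nth G n) * qexp z ^ n))"
    using F G z norm_qexp_less_1[OF z] by (simp_all add: qconvergent_iff flip: qconvergent_def)
  from summable_Cauchy_product[OF this]
  show "summable (\<lambda>n. of_rat ((F * G) $ n) * exp (2 * complex_of_real pi * \<i> * of_nat n * z))"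
    by (simp add: qexp_power of_rat_fps_mult_nth)
qed

lemma qfun_mult:
  assumes "qconvergent F" "qconvergent G" "Im z > 0"
  shows "qfun (F * G) z = qfun F z * qfun G z"
proof -
  have "summable (\<lambda>n. norm (of_rat (fps_nth F n) * qexp z ^ n))"
       "summable (\<lambda>n. norm (of_rat (fps_nth G n) * qexp z ^ n))"
    using assms norm_qexp_less_1[of z] by (simp_all add: qconvergent_iff)
  from Cauchy_product[OF this] show ?thesis
    by (simp add: qfun_altdef of_rat_fps_mult_nth)
qed

lemma delta_q_altdef: "delta_q F = fps_X * fps_deriv F"
proof (rule fps_ext)
  fix n show "delta_q F $ n = (fps_X * fps_deriv F) $ n"
    by (cases n) (simp_all add: delta_q_def)
qed

lemma qfun_deriv_aux:
  assumes F: "qconvergent F" and w: "norm (w::complex) < 1"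
  shows "((\<lambda>w. suminf (\<lambda>n. of_rat (fps_nth F n) * w ^ n)) has_field_derivative
           (suminf (\<lambda>n. diffs (\<lambda>n. of_rat (fps_nth F n)) n * w ^ n))) (at w)"
    and "summable (\<lambda>n. diffs (\<lambda>n. of_rat (fps_nth F n)) n * w ^ n)"
proof -
  have S: "summable (\<lambda>n. of_rat (fps_nth F n) * x ^ n)" if "norm x < 1" for x :: complex
    using F that unfolding qconvergent_iff by (blast intro: summable_norm_cancel)
  show "((\<lambda>w. suminf (\<lambda>n. of_rat (fps_nth F n) * w ^ n)) has_field_derivative
           (suminf (\<lambda>n. diffs (\<lambda>n. of_rat (fps_nth F n)) n * w ^ n))) (at w)"
    by (rule termdiffs_strong'[of 1]) (use S w in auto)
  show "summable (\<lambda>n. diffs (\<lambda>n. of_rat (fps_nth F n)) n * w ^ n)"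
    by (rule termdiff_converges[of w 1]) (use S w in auto)
qed

lemma delta_q_sums:
  assumes F: "qconvergent F" and w: "norm (w::complex) < 1"
  shows "(\<lambda>n. of_rat (fps_nth (delta_q F) n) * w ^ n) sums (w * (suminf (\<lambda>n. diffs (\<lambda>n. of_rat (fps_nth F n)) n * w ^ n)))"
proof -
  have "(\<lambda>n. w * (diffs (\<lambda>n. of_rat (fps_nth F n)) n * w ^ n)) sums (w * (suminf (\<lambda>n. diffs (\<lambda>n. of_rat (fps_nth F n)) n * w ^ n)))"
    by (intro sums_mult summable_sums qfun_deriv_aux[OF F w])
  also have "(\<lambda>n. w * (diffs (\<lambda>n. of_rat (fps_nth F n)) n * w ^ n)) =
     (\<lambda>n. of_rat (fps_nth (delta_q F) (Suc n)) * w ^ Suc n)"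
    by (rule ext) (simp add: diffs_def delta_q_def of_rat_mult of_rat_add algebra_simps)
  finally show ?thesis by (subst (asm) sums_Suc_iff) (simp add: delta_q_def)
qed

lemma qconvergent_delta_q: "qconvergent F \<Longrightarrow> qconvergent (delta_q F)"
  unfolding qconvergent_def [of "delta_q F"]
  by (auto simp: qexp_power intro!: sums_summable[OF delta_q_sums] norm_qexp_less_1)

lemma has_field_derivative_qfun:
  assumes F: "qconvergent F" and z: "Im z > 0"
  shows "(qfun F has_field_derivative 2 * of_real pi * \<i> * qfun (delta_q F) z) (at z)"
proof -
  note w = norm_qexp_less_1[OF z]
  have "((\<lambda>z. suminf (\<lambda>n. of_rat (fps_nth F n) * qexp z ^ n)) has_field_derivative
          (suminf (\<lambda>n. diffs (\<lambda>n. of_rat (fps_nth F n)) n * qexp z ^ n)) * (2 * of_real pi * \<i> * qexp z)) (at z)"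
    by (rule DERIV_chain2[OF qfun_deriv_aux(1)[OF F w] has_field_derivative_qexp])
  also have "(\<lambda>z. suminf (\<lambda>n. of_rat (fps_nth F n) * qexp z ^ n)) = qfun F"
    by (rule ext) (simp add: qfun_altdef)
  also have "(suminf (\<lambda>n. diffs (\<lambda>n. of_rat (fps_nth F n)) n * qexp z ^ n)) * (2 * of_real pi * \<i> * qexp z) =
     2 * of_real pi * \<i> * qfun (delta_q F) z"
    unfolding qfun_altdef using sums_unique[OF delta_q_sums[OF F w]] by (simp add: mult_ac)
  finally show ?thesis .
qed

lemma Im_minus_inverse_pos: "Im z > 0 \<Longrightarrow> Im (- 1 / z) > 0"
  by (auto simp: Im_divide field_simps add_pos_nonneg)

lemma modular_form_fps_const: "modular_form 0 (fps_const c)"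
  by (simp add: modular_form_iff qconvergent_fps_const qfun_fps_const)

lemma modular_form_mult: "modular_form a F \<Longrightarrow> modular_form b G \<Longrightarrow> modular_form (a + b) (F * G)"
  unfolding modular_form_iff
  by (simp add: qconvergent_mult qfun_mult Im_minus_inverse_pos power_add del: divide_minus_left)

lemma has_field_derivative_qfun_inversion:
  assumes F: "qconvergent F" and z: "Im z > 0"
  shows "((\<lambda>z. qfun F (- 1 / z)) has_field_derivative 2 * of_real pi * \<i> * qfun (delta_q F) (- 1 / z) / z\<^sup>2) (at z)"
proof -
  have "z \<noteq> 0" using z by auto
  hence "((\<lambda>z. - 1 / z) has_field_derivative 1 / z\<^sup>2) (at z)"
    by (auto intro!: derivative_eq_intros simp: power2_eq_square)
  from DERIV_chain2[OF has_field_derivative_qfun[OF F Im_minus_inverse_pos[OF z]] this]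
  show ?thesis by simp
qed

lemma eventually_Im_pos: "Im z > 0 \<Longrightarrow> eventually (\<lambda>w. Im w > 0) (nhds z)"
  using eventually_nhds_in_open[OF open_halfspace_Im_gt[of 0], of z] by simp

subsection \<open>The Lipschitz formula\<close>

text \<open>The logarithmic derivative of the reflection formula for
  \<open>Gamma z * Gamma (1 - z)\<close>.\<close>

lemma Digamma_reflection_complex:
  fixes z :: complex
  assumes "z \<notin> \<int>"
  shows "Digamma (1 - z) - Digamma z = of_real pi * cot (of_real pi * z)"
proof -
  have z1: "z \<notin> \<int>\<^sub>\<le>\<^sub>0" using assms nonpos_Ints_Int by blast
  have z2: "1 - z \<notin> \<int>\<^sub>\<le>\<^sub>0"
    using assms nonpos_Ints_Int[of "1 - z"] Ints_diff[of 1 "1 - z"] by auto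
  have s: "sin (of_real pi * z) \<noteq> 0"
  proof
    assume "sin (of_real pi * z) = 0"
    then obtain n :: int where "of_real pi * z = of_real (of_int n * pi)"
      using Complex_Transcendental.sin_eq_0 by auto
    hence "z = of_int n" by (simp add: field_simps)
    thus False using assms by simp
  qed
  have 1: "((\<lambda>z. Gamma z * Gamma (1 - z)) has_field_derivative
       Gamma z * Gamma (1 - z) * (Digamma z - Digamma (1 - z))) (at z)"
    using z1 z2 by (auto intro!: derivative_eq_intros simp: algebra_simps)
  have 2: "((\<lambda>z. of_real pi / sin (of_real pi * z)) has_field_derivative
       - of_real pi * (of_real pi * cos (of_real pi * z)) / (sin (of_real pi * z))\<^sup>2) (at z)"
    using s by (auto intro!: derivative_eq_intros simp: power2_eq_square)
  have "Gamma z * Gamma (1 - z) * (Digamma z - Digamma (1 - z)) =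
      - of_real pi * (of_real pi * cos (of_real pi * z)) / (sin (of_real pi * z))\<^sup>2"
    by (rule DERIV_unique[OF 1]) (use 2 in \<open>simp add: Gamma_reflection_complex\<close>)
  hence eq: "of_real pi / sin (of_real pi * z) * (Digamma z - Digamma (1 - z)) =
      - of_real pi * (of_real pi * cos (of_real pi * z)) / (sin (of_real pi * z))\<^sup>2"
    by (simp add: Gamma_reflection_complex)
  have aux: "d = - p * (c / s)" if "p / s * d = - p * (p * c) / s\<^sup>2" "s \<noteq> 0" "p \<noteq> 0" for d p c s :: complex
  proof -
    have "d = (s / p) * (p / s * d)" using that(2,3) by simp
    also have "\<dots> = - p * (c / s)" unfolding that(1) using that(2,3) by (simp add: field_simps power2_eq_square)
    finally show ?thesis .
  qed
  have "Digamma z - Digamma (1 - z) = - of_real pi * (cos (of_real pi * z) / sin (of_real pi * z))"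
    by (rule aux[OF eq s]) simp
  thus ?thesis by (simp add: cot_def algebra_simps)
qed

text \<open>Lets a transformation law known only on the upper half-plane be differentiated: the
  half-plane is open, so both sides agree near \<open>z\<close>.\<close>

lemma DERIV_unique_halfplane:
  assumes "\<And>w. Im w > 0 \<Longrightarrow> f w = g w" "Im z > 0"
    and "(f has_field_derivative D) (at z)" "(g has_field_derivative E) (at z)"
  shows "D = E"
proof -
  have "eventually (\<lambda>w. f w = g w) (nhds z)"
    using eventually_Im_pos[OF assms(2)] by eventually_elim (rule assms(1))
  hence "(g has_field_derivative D) (at z)" using assms(3) DERIV_cong_ev by blast
  thus ?thesis using assms(4) DERIV_unique by blast
qed

text \<open>The convention \<open>0 ^ 0 = 1\<close> makes the constant term of \<open>pow_fps 0\<close> equal to 1.\<close>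

definition pow_fps :: "nat \<Rightarrow> rat fps" where
  "pow_fps j = Abs_fps (\<lambda>r. of_nat r ^ j)"

lemma delta_q_pow_fps: "delta_q (pow_fps j) = pow_fps (Suc j)"
  by (simp add: pow_fps_def delta_q_def fps_eq_iff)

lemma qconvergent_pow_fps: "qconvergent (pow_fps j)"
proof (induction j)
  case 0
  show ?case unfolding qconvergent_iff
    by (auto simp: pow_fps_def norm_power intro!: summable_geometric)
next
  case (Suc j)
  thus ?case using qconvergent_delta_q[of "pow_fps j"] by (simp add: delta_q_pow_fps)
qed

text \<open>In terms of \<open>e = exp (i pi z)\<close> the cotangent is rational in
  \<open>e\<^sup>2 = qexp z\<close>, and \<open>|q| < 1\<close> keeps the denominator away from 0.
  This prepares the expansion as a geometric series in \<open>q\<close>.\<close>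

lemma cot_eq_qexp:
  assumes "Im z > 0"
  shows "of_real pi * cot (of_real pi * z) = of_real pi * \<i> - 2 * of_real pi * \<i> / (1 - qexp z)"
proof -
  define e where "e = exp (\<i> * (of_real pi * z))"
  have e0: "e \<noteq> 0" by (simp add: e_def)
  have em: "exp (- (\<i> * (of_real pi * z))) = 1 / e" by (simp add: e_def exp_minus field_simps)
  have e2: "e\<^sup>2 = qexp z" unfolding e_def qexp_def
    by (simp add: power2_eq_square exp_add[symmetric] algebra_simps)
  have ne: "e\<^sup>2 \<noteq> 1" using norm_qexp_less_1[OF assms] e2 by auto
  have "cot (of_real pi * z) = \<i> * (e + 1 / e) / (e - 1 / e)"
    unfolding cot_def cos_exp_eq sin_exp_eq em e_def[symmetric] using ne e0
    by (simp add: field_simps power2_eq_square)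
  also have "\<dots> = \<i> - 2 * \<i> / (1 - e\<^sup>2)"
    using ne e0 by (simp add: divide_simps power2_eq_square) (simp add: algebra_simps)
  finally have "cot (of_real pi * z) = \<i> - 2 * \<i> / (1 - qexp z)" by (simp only: e2)
  thus ?thesis by (simp add: right_diff_distrib mult_ac)
qed

lemma qfun_pow_fps_0:
  assumes "Im z > 0"
  shows "qfun (pow_fps 0) z = 1 / (1 - qexp z)"
  using suminf_geometric[OF norm_qexp_less_1[OF assms]]
  by (simp add: qfun_altdef pow_fps_def)

text \<open>For \<open>n = 0\<close> this is the reflection formula with the cotangent expanded as a
  geometric series. Each further derivative in \<open>z\<close> turns \<open>pow_fps n\<close> into
  \<open>pow_fps (Suc n)\<close> at the price of a factor \<open>2 pi i\<close>, and the first one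
  removes the constant \<open>pi i\<close>.\<close>

lemma Polygamma_reflection_qexp:
  assumes "Im z > 0"
  shows "(-1) ^ n * Polygamma n (1 - z) - Polygamma n z =
     (if n = 0 then of_real pi * \<i> else 0) - (2 * of_real pi * \<i>) ^ Suc n * qfun (pow_fps n) z"
  using assms
proof (induction n arbitrary: z)
  case 0
  have "z \<notin> \<int>" using 0 by (auto elim!: Ints_cases)
  from Digamma_reflection_complex[OF this] show ?case
    using 0 by (simp add: cot_eq_qexp qfun_pow_fps_0)
next
  case (Suc n)
  have z: "z \<notin> \<int>\<^sub>\<le>\<^sub>0" "1 - z \<notin> \<int>\<^sub>\<le>\<^sub>0"
    using Suc.prems by (auto elim!: nonpos_Ints_cases simp: complex_eq_iff)
  have 1: "((\<lambda>z. (-1) ^ n * Polygamma n (1 - z) - Polygamma n z) has_field_derivative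
     ((-1) ^ Suc n * Polygamma (Suc n) (1 - z) - Polygamma (Suc n) z)) (at z)"
    using z by (auto intro!: derivative_eq_intros)
  have 2: "((\<lambda>z. (if n = 0 then of_real pi * \<i> else 0) - (2 * of_real pi * \<i>) ^ Suc n * qfun (pow_fps n) z)
     has_field_derivative (- ((2 * of_real pi * \<i>) ^ Suc n * (2 * of_real pi * \<i> * qfun (delta_q (pow_fps n)) z)))) (at z)"
    by (rule derivative_eq_intros has_field_derivative_qfun qconvergent_pow_fps Suc.prems refl | simp)+
  have "(-1) ^ Suc n * Polygamma (Suc n) (1 - z) - Polygamma (Suc n) z =
     - ((2 * of_real pi * \<i>) ^ Suc n * (2 * of_real pi * \<i> * qfun (delta_q (pow_fps n)) z))"
    by (rule DERIV_unique_halfplane[OF _ Suc.prems 1 2]) (rule Suc.IH)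
  thus ?case by (simp add: delta_q_pow_fps mult_ac)
qed

section \<open>Unordered sums over the integers and lower bounds on the lattice\<close>

lemma has_sum_int:
  fixes f :: "int \<Rightarrow> 'a :: topological_comm_monoid_add"
  assumes "((\<lambda>n. f (int n)) has_sum a) UNIV" "((\<lambda>n. f (- int n - 1)) has_sum b) UNIV"
  shows "(f has_sum (a + b)) (UNIV :: int set)"
proof -
  have 1: "(f has_sum a) (range int)"
    by (subst has_sum_reindex) (use assms(1) in \<open>auto simp: o_def\<close>)
  have 2: "(f has_sum b) (range (\<lambda>n. - int n - 1))"
    by (subst has_sum_reindex) (use assms(2) in \<open>auto simp: o_def inj_on_def\<close>)
  have "range int \<union> range (\<lambda>n. - int n - 1) = UNIV"
  proof (intro equalityI subset_UNIV subsetI)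
    fix x :: int
    show "x \<in> range int \<union> range (\<lambda>n. - int n - 1)"
    proof (cases "x \<ge> 0")
      case True
      hence "x = int (nat x)" by simp
      thus ?thesis by blast
    next
      case False
      hence "x = - int (nat (- x - 1)) - 1" by simp
      thus ?thesis by blast
    qed
  qed
  moreover have "range int \<inter> range (\<lambda>n. - int n - 1) = {}" by auto
  ultimately show ?thesis using has_sum_Un_disjoint[OF 1 2] by simp
qed

lemma summable_on_int:
  fixes f :: "int \<Rightarrow> 'a :: topological_comm_monoid_add"
  assumes "(\<lambda>n. f (int n)) summable_on UNIV" "(\<lambda>n. f (- int n - 1)) summable_on UNIV"
  shows "f summable_on UNIV"
  using assms has_sum_int unfolding summable_on_def by blast

lemma summable_on_int_powr:
  assumes "s < -1"
  shows "(\<lambda>n::int. (1 + \<bar>real_of_int n\<bar>) powr s) summable_on UNIV"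
proof -
  have S: "summable (\<lambda>n. real n powr s)" using assms by (simp add: summable_real_powr_iff)
  have 1: "summable (\<lambda>n. real (Suc n) powr s)" using S by (subst summable_Suc_iff)
  have 2: "summable (\<lambda>n. real (Suc (Suc n)) powr s)" using 1 by (subst summable_Suc_iff)
  show ?thesis
  proof (rule summable_on_int)
    show "(\<lambda>n. (1 + \<bar>real_of_int (int n)\<bar>) powr s) summable_on UNIV"
      using 1 by (subst summable_on_UNIV_nonneg_real_iff) auto
    have "\<bar>real_of_int (- int n - 1)\<bar> = real (Suc n)" for n by simp
    thus "(\<lambda>n. (1 + \<bar>real_of_int (- int n - 1)\<bar>) powr s) summable_on UNIV"
      using 2 by (subst summable_on_UNIV_nonneg_real_iff) (auto simp: add_ac)
  qed
qed

text \<open>The imaginary part bounds the norm below by \<open>|m| Im z\<close>, the triangle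
  inequality by \<open>|n| - |m| |z|\<close>; the weights \<open>|z| + 1\<close> and
  \<open>Im z\<close> combine the two so that the negative term cancels.\<close>

lemma lattice_lower_bound:
  assumes "Im z > 0"
  obtains c where "c > 0" "\<And>m n :: int. norm (of_int m * z + of_int n) \<ge> c * (\<bar>of_int m\<bar> + \<bar>of_int n\<bar>)"
proof -
  define y a where "y = Im z" and "a = norm z"
  define t where "t = y + a + 1"
  have pos: "y > 0" "a \<ge> 0" "t > 0" using assms norm_ge_zero[of z] by (auto simp: y_def a_def t_def intro: add_pos_nonneg simp del: norm_ge_zero)
  show ?thesis
  proof
    show "y / t > 0" using pos by simp
    fix m n :: int
    have 1: "norm (of_int m * z + of_int n) \<ge> \<bar>of_int m\<bar> * y"
    proof -
      have "\<bar>Im (of_int m * z + of_int n)\<bar> = \<bar>of_int m\<bar> * y" using pos by (simp add: y_def abs_mult)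
      thus ?thesis using abs_Im_le_cmod[of "of_int m * z + of_int n"] by simp
    qed
    have 2: "norm (of_int m * z + of_int n) \<ge> \<bar>of_int n\<bar> - \<bar>of_int m\<bar> * a"
    proof -
      have "norm (of_int n :: complex) \<le> norm (of_int m * z + of_int n) + norm (of_int m * z)"
        by (metis add.commute add_diff_cancel_left' norm_triangle_ineq4)
      thus ?thesis by (simp add: norm_mult a_def)
    qed
    have "t * norm (of_int m * z + of_int n) =
        (a + 1) * norm (of_int m * z + of_int n) + y * norm (of_int m * z + of_int n)"
      by (simp add: t_def algebra_simps)
    also have "\<dots> \<ge> (a + 1) * (\<bar>of_int m\<bar> * y) + y * (\<bar>of_int n\<bar> - \<bar>of_int m\<bar> * a)"
      using 1 2 pos by (intro add_mono mult_left_mono) auto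
    also have "(a + 1) * (\<bar>of_int m\<bar> * y) + y * (\<bar>of_int n\<bar> - \<bar>of_int m\<bar> * a) = y * (\<bar>of_int m\<bar> + \<bar>of_int n\<bar>)"
      by (simp add: algebra_simps)
    finally show "y / t * (\<bar>of_int m\<bar> + \<bar>of_int n\<bar>) \<le> norm (of_int m * z + of_int n)"
      using pos by (simp add: field_simps)
  qed
qed

lemma row_abs_summable:
  assumes "Im z > 0" "k \<ge> 2"
  shows "(\<lambda>n::int. 1 / (z + of_int n) ^ k) abs_summable_on UNIV"
proof -
  obtain c where c: "c > 0" "\<And>m n :: int. norm (of_int m * z + of_int n) \<ge> c * (\<bar>of_int m\<bar> + \<bar>of_int n\<bar>)"
    using lattice_lower_bound[OF assms(1)] by blast
  have "(\<lambda>n::int. inverse (c ^ k) * (1 + \<bar>real_of_int n\<bar>) powr (-2)) summable_on UNIV"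
    by (intro summable_on_cmult_right summable_on_int_powr) auto
  thus ?thesis
  proof (rule summable_on_comparison_test)
    fix n :: int
    have "(1 + \<bar>real_of_int n\<bar>) ^ 2 \<le> (1 + \<bar>real_of_int n\<bar>) ^ k"
      using assms by (intro power_increasing) auto
    hence "c ^ k * (1 + \<bar>real_of_int n\<bar>) ^ 2 \<le> (c * (1 + \<bar>real_of_int n\<bar>)) ^ k"
      using c by (simp add: power_mult_distrib)
    also have "\<dots> \<le> norm (z + of_int n) ^ k"
      using c(2)[of 1 n] c(1) by (intro power_mono) auto
    finally have "c ^ k * (1 + \<bar>real_of_int n\<bar>) ^ 2 \<le> norm (z + of_int n) ^ k" .
    hence "inverse (norm (z + of_int n) ^ k) \<le> inverse (c ^ k * (1 + \<bar>real_of_int n\<bar>) ^ 2)"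
      using c(1) by (intro le_imp_inverse_le mult_pos_pos zero_less_power) auto
    also have "\<dots> = inverse (c ^ k) * (1 + \<bar>real_of_int n\<bar>) powr (-2)"
      by (simp add: powr_minus powr_numeral)
    finally show "norm (1 / (z + of_int n) ^ k) \<le> inverse (c ^ k) * (1 + \<bar>real_of_int n\<bar>) powr (-2)"
      by (simp add: norm_divide norm_power inverse_eq_divide)
  qed auto
qed

text \<open>The terms with \<open>n >= 0\<close> form the series of \<open>Polygamma\<close> at
  \<open>z\<close>, those with \<open>n < 0\<close> the one at \<open>1 - z\<close>; the reflection
  formula adds them up.\<close>

theorem lipschitz_formula:
  assumes z: "Im z > 0" and k: "k \<ge> 2"
  shows "((\<lambda>n::int. 1 / (z + of_int n) ^ k) has_sum
     ((- 2 * of_real pi * \<i>) ^ k / fact (k - 1) * qfun (pow_fps (k - 1)) z)) UNIV"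
proof -
  define n where "n = k - 1"
  have n: "n > 0" "k = Suc n" using k by (auto simp: n_def)
  have z0: "z \<noteq> 0" "1 - z \<noteq> 0" using z by auto
  let ?f = "\<lambda>n::int. 1 / (z + of_int n) ^ k"
  have "?f summable_on UNIV" by (rule abs_summable_summable[OF row_abs_summable[OF z k]])
  have sub: "?f summable_on range int" "?f summable_on range (\<lambda>n. - int n - 1)"
    using \<open>?f summable_on UNIV\<close> summable_on_subset_banach by blast+
  have s1: "(\<lambda>n. ?f (int n)) summable_on UNIV"
    using sub(1) by (subst (asm) summable_on_reindex) (auto simp: o_def)
  have s2: "(\<lambda>n. ?f (- int n - 1)) summable_on UNIV"
    using sub(2) by (subst (asm) summable_on_reindex) (auto simp: o_def inj_on_def)
  have u1: "(\<lambda>i. ?f (int i)) sums ((-1) ^ Suc n * Polygamma n z / fact n)"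
    using Polygamma_LIMSEQ[OF z0(1) n(1)] by (simp add: n inverse_eq_divide)
  have "?f (- int i - 1) = (-1) ^ Suc n * inverse ((1 - z + of_nat i) ^ Suc n)" for i
  proof -
    have "z + of_int (- int i - 1) = - (1 - z + of_nat i)" by simp
    hence "(z + of_int (- int i - 1)) ^ k = (-1) ^ Suc n * (1 - z + of_nat i) ^ Suc n"
      using n(2) by (simp only: power_minus[of "1 - z + of_nat i"])
    thus ?thesis by (simp add: inverse_eq_divide uminus_power_if)
  qed
  hence u2: "(\<lambda>i. ?f (- int i - 1)) sums ((-1) ^ Suc n * ((-1) ^ Suc n * Polygamma n (1 - z) / fact n))"
    using sums_mult[OF Polygamma_LIMSEQ[OF z0(2) n(1)], of "(-1) ^ Suc n"] by simp
  \<comment> \<open>Unconditional summability is known already, so the ordered series only supplies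
    the value.\<close>
  have h1: "((\<lambda>i. ?f (int i)) has_sum ((-1) ^ Suc n * Polygamma n z / fact n)) UNIV"
    using has_sum_imp_sums[OF has_sum_infsum[OF s1]] u1 sums_unique2 has_sum_infsum[OF s1] by metis
  have h2: "((\<lambda>i. ?f (- int i - 1)) has_sum ((-1) ^ Suc n * ((-1) ^ Suc n * Polygamma n (1 - z) / fact n))) UNIV"
    using has_sum_imp_sums[OF has_sum_infsum[OF s2]] u2 sums_unique2 has_sum_infsum[OF s2] by metis
  have "(-1) ^ Suc n * Polygamma n z / fact n + (-1) ^ Suc n * ((-1) ^ Suc n * Polygamma n (1 - z) / fact n) =
     (-1) ^ n * ((-1) ^ n * Polygamma n (1 - z) - Polygamma n z) / fact n"
    by (simp add: field_simps)
  also have "\<dots> = (- 2 * of_real pi * \<i>) ^ k / fact n * qfun (pow_fps n) z"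
  proof -
    have "(- 2 * of_real pi * \<i>) ^ k = - ((-1) ^ n * (2 * of_real pi * \<i>) ^ Suc n)"
      unfolding n(2) using power_minus[of "2 * of_real pi * \<i>" "Suc n"] by simp
    thus ?thesis using n(1) by (simp only: Polygamma_reflection_qexp[OF z]) simp
  qed
  finally show ?thesis using has_sum_int[OF h1 h2] by (simp add: n_def)
qed

subsection \<open>Eisenstein series of weight at least 4\<close>

lemma summable_on_Times_mult:
  fixes f :: "'a \<Rightarrow> real" and g :: "'b \<Rightarrow> real"
  assumes "f summable_on A" "g summable_on B" "\<And>x. x \<in> A \<Longrightarrow> f x \<ge> 0" "\<And>y. y \<in> B \<Longrightarrow> g y \<ge> 0"
  shows "(\<lambda>(x, y). f x * g y) summable_on A \<times> B"
proof (rule summable_on_SigmaI)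
  fix x assume "x \<in> A"
  show "((\<lambda>y. case (x, y) of (x, y) \<Rightarrow> f x * g y) has_sum f x * infsum g B) B"
    using has_sum_cmult_right[OF has_sum_infsum[OF assms(2)]] by simp
next
  show "(\<lambda>x. f x * infsum g B) summable_on A" by (rule summable_on_cmult_left[OF assms(1)])
qed (use assms in auto)

text \<open>Comparison with \<open>((1 + |m|) (1 + |n|)) powr (-3/2)\<close>, a product of two
  convergent sums; the constant 8 is \<open>2 ^ 3\<close> from
  \<open>1 + a + b <= 2 (a + b)\<close>. The origin does no harm, since
  \<open>1 / 0 = 0\<close>.\<close>

lemma lattice_cubic_summable:
  "(\<lambda>(m::int, n::int). 1 / (\<bar>real_of_int m\<bar> + \<bar>real_of_int n\<bar>) ^ 3) summable_on UNIV"
proof -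
  let ?g = "\<lambda>n::int. (1 + \<bar>real_of_int n\<bar>) powr (-(3/2))"
  have "(\<lambda>(m, n). ?g m * ?g n) summable_on UNIV \<times> UNIV"
    by (intro summable_on_Times_mult summable_on_int_powr) auto
  hence "(\<lambda>mn. 8 * (case mn of (m, n) \<Rightarrow> ?g m * ?g n)) summable_on UNIV"
    by (intro summable_on_cmult_right) simp
  thus ?thesis
  proof (rule summable_on_comparison_test)
    fix mn :: "int \<times> int"
    obtain m n where mn: "mn = (m, n)" by (cases mn)
    define a b where "a = \<bar>real_of_int m\<bar>" and "b = \<bar>real_of_int n\<bar>"
    have ab: "a \<ge> 0" "b \<ge> 0" by (auto simp: a_def b_def)
    show "(case mn of (m, n) \<Rightarrow> 1 / (\<bar>real_of_int m\<bar> + \<bar>real_of_int n\<bar>) ^ 3) \<le> 8 * (case mn of (m, n) \<Rightarrow> ?g m * ?g n)"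
    proof (cases "m = 0 \<and> n = 0")
      case False
      have ge1: "a + b \<ge> 1"
      proof (cases "m = 0")
        case True
        hence "\<bar>real_of_int n\<bar> \<ge> 1" using False by linarith
        thus ?thesis using ab by (simp add: b_def)
      next
        case False
        hence "\<bar>real_of_int m\<bar> \<ge> 1" by linarith
        thus ?thesis using ab by (simp add: a_def b_def)
      qed
      have "(1 + a) * (1 + b) \<le> (1 + a + b)\<^sup>2" using ab by (simp add: power2_eq_square algebra_simps)
      also have "\<dots> \<le> (2 * (a + b))\<^sup>2" using ge1 ab by (intro power_mono) auto
      finally have "((1 + a) * (1 + b)) powr (3/2) \<le> ((2 * (a + b))\<^sup>2) powr (3/2)"
        using ab by (intro powr_mono2) auto
      also have "((2 * (a + b))\<^sup>2) powr (3/2) = (2 * (a + b)) powr 3"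
        using ge1 by (simp add: powr_powr flip: powr_numeral)
      also have "\<dots> = 8 * (a + b) ^ 3"
        using ge1 power_mult_distrib[of 2 "a + b" 3] by (simp add: powr_numeral)
      finally have *: "((1 + a) * (1 + b)) powr (3/2) \<le> 8 * (a + b) ^ 3" .
      have "1 / (a + b) ^ 3 = 8 / (8 * (a + b) ^ 3)" by simp
      also have "\<dots> \<le> 8 / ((1 + a) * (1 + b)) powr (3/2)"
        using * ab ge1 by (intro divide_left_mono mult_pos_pos) auto
      also have "\<dots> = 8 * ((1 + a) powr (-(3/2)) * (1 + b) powr (-(3/2)))"
        using ab by (simp add: powr_minus_divide powr_mult)
      finally show ?thesis by (simp add: mn a_def b_def)
    qed (simp add: mn)
  qed auto
qed

lemma lattice_abs_summable:
  assumes z: "Im z > 0" and k: "k \<ge> 3"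
  shows "(\<lambda>(m::int, n::int). 1 / (of_int m * z + of_int n) ^ k) abs_summable_on UNIV"
proof -
  obtain c where c: "c > 0" "\<And>m n :: int. norm (of_int m * z + of_int n) \<ge> c * (\<bar>of_int m\<bar> + \<bar>of_int n\<bar>)"
    using lattice_lower_bound[OF z] by blast
  let ?h = "\<lambda>(m::int, n::int). 1 / (\<bar>real_of_int m\<bar> + \<bar>real_of_int n\<bar>) ^ 3"
  have "(\<lambda>mn. (1 / c ^ k) * ?h mn) summable_on UNIV"
    by (intro summable_on_cmult_right lattice_cubic_summable)
  thus ?thesis
  proof (rule summable_on_comparison_test)
    fix mn :: "int \<times> int"
    obtain m n where mn: "mn = (m, n)" by (cases mn)
    define a where "a = \<bar>real_of_int m\<bar> + \<bar>real_of_int n\<bar>"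
    show "norm (case mn of (m, n) \<Rightarrow> 1 / (of_int m * z + of_int n) ^ k) \<le> (1 / c ^ k) * ?h mn"
    proof (cases "m = 0 \<and> n = 0")
      case True
      thus ?thesis using k by (simp add: mn power_0_left)
    next
      case False
      have a1: "a \<ge> 1" using False unfolding a_def by linarith
      have "c ^ k * a ^ 3 \<le> c ^ k * a ^ k" using a1 c k by (intro mult_left_mono power_increasing) auto
      also have "\<dots> = (c * a) ^ k" by (simp add: power_mult_distrib)
      also have "\<dots> \<le> norm (of_int m * z + of_int n) ^ k"
        using c(2)[of m n] c(1) a1 by (intro power_mono) (auto simp: a_def)
      finally have "1 / norm (of_int m * z + of_int n) ^ k \<le> 1 / (c ^ k * a ^ 3)"
        using a1 c by (intro divide_left_mono mult_pos_pos) (auto intro: less_le_trans[of 0 "c ^ k * a ^ 3"])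
      thus ?thesis by (simp add: mn norm_divide norm_power a_def)
    qed
  qed auto
qed

lemma has_sum_qfun:
  assumes "qconvergent F" "Im z > 0"
  shows "((\<lambda>n. of_rat (fps_nth F n) * qexp z ^ n) has_sum qfun F z) UNIV"
  using assms norm_qexp_less_1[OF assms(2)] unfolding qfun_altdef qconvergent_iff
  by (intro norm_summable_imp_has_sum summable_sums) (auto intro: summable_norm_cancel)

lemma sigma_le: "n > 0 \<Longrightarrow> sigma j n \<le> n ^ Suc j"
proof -
  assume n: "n > 0"
  have "sigma j n \<le> (\<Sum>d\<in>{1..n}. d ^ j)" unfolding Defs.sigma_def
    by (rule sum_mono2) (use n in \<open>auto dest: dvd_imp_le intro!: Nat.gr0I\<close>)
  also have "\<dots> \<le> (\<Sum>d\<in>{1..n}. n ^ j)" by (intro sum_mono power_mono) auto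
  also have "\<dots> = n ^ Suc j" by simp
  finally show ?thesis .
qed

lemma qconvergent_Phi: "qconvergent (Phi j)"
  unfolding qconvergent_iff
proof (intro allI impI)
  fix w :: complex assume w: "norm w < 1"
  have "summable (\<lambda>n. norm (of_rat (fps_nth (pow_fps (Suc j)) n) * w ^ n))"
    using qconvergent_pow_fps w unfolding qconvergent_iff by blast
  thus "summable (\<lambda>n. norm (of_rat (Phi j $ n) * w ^ n))"
  proof (rule summable_comparison_test')
    fix n :: nat
    have "real (sigma j n) \<le> real n ^ Suc j" if "n > 0"
      using sigma_le[OF that, of j] by (metis of_nat_le_iff of_nat_power)
    thus "norm (norm (of_rat (Phi j $ n) * w ^ n)) \<le> norm (of_rat (fps_nth (pow_fps (Suc j)) n) * w ^ n)"
      by (auto simp: Phi_def pow_fps_def norm_mult norm_power of_rat_power intro!: mult_right_mono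
               simp del: power_Suc)
  qed
qed

text \<open>Both sides are the double sum of \<open>r ^ j Q ^ (m r)\<close>: grouped by
  \<open>m\<close> it gives the left side, grouped by \<open>n = m r\<close> the divisor sums.
  Positivity of \<open>j\<close> makes the term \<open>r = 0\<close> of \<open>pow_fps j\<close>
  vanish.\<close>

lemma Phi_has_sum:
  assumes z: "Im z > 0" and j: "j > 0"
  shows "((\<lambda>m. qfun (pow_fps j) (of_nat m * z)) has_sum qfun (Phi j) z) {1..}"
proof -
  define Q where "Q = qexp z"
  define \<rho> where "\<rho> = sqrt (norm Q)"
  have Q: "norm Q < 1" "norm Q > 0" using norm_qexp_less_1[OF z] by (auto simp: Q_def)
  have \<rho>: "\<rho> > 0" "\<rho> < 1" "\<rho>\<^sup>2 = norm Q" using Q by (auto simp: \<rho>_def)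
  define f :: "nat \<times> nat \<Rightarrow> complex" where "f = (\<lambda>(m, r). of_nat r ^ j * Q ^ (m * r))"
  have 1: "(\<lambda>m::nat. \<rho> ^ m) summable_on {1..}"
    using \<rho> by (intro summable_on_subset_banach[of _ UNIV "{1..}"])
      (auto simp: summable_on_UNIV_nonneg_real_iff intro!: summable_geometric)
  have "summable (\<lambda>n. norm (of_rat (fps_nth (pow_fps j) n) * complex_of_real \<rho> ^ n))"
    using qconvergent_pow_fps \<rho> unfolding qconvergent_iff by simp
  hence "summable (\<lambda>r. real r ^ j * \<rho> ^ r)"
    using \<rho> by (simp add: pow_fps_def norm_mult norm_power of_rat_power)
  hence 2: "(\<lambda>r. real r ^ j * \<rho> ^ r) summable_on {1..}"
    using \<rho> by (intro summable_on_subset_banach[of _ UNIV "{1..}"])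
      (auto simp: summable_on_UNIV_nonneg_real_iff)
  have "(\<lambda>(m, r). \<rho> ^ m * (real r ^ j * \<rho> ^ r)) summable_on {1..} \<times> {1..}"
    by (rule summable_on_Times_mult[OF 1 2]) (use \<rho> in auto)
  hence "f abs_summable_on {1..} \<times> {1..}"
  proof (rule summable_on_comparison_test)
    fix mr :: "nat \<times> nat" assume "mr \<in> {1..} \<times> {1..}"
    then obtain m r where mr: "mr = (m, r)" "m \<ge> 1" "r \<ge> 1" by auto
    \<comment> \<open>With \<open>\<rho>\<^sup>2 = |Q|\<close> this bounds
      \<open>|Q| ^ (m r)\<close> by \<open>\<rho> ^ m \<rho> ^ r\<close>, which splits the majorant
      into a product.\<close>
    have "m + r \<le> 2 * (m * r)"
    proof -
      have "m \<le> m * r" "r \<le> m * r" using mr by auto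
      thus ?thesis by linarith
    qed
    hence "\<rho> ^ (2 * (m * r)) \<le> \<rho> ^ (m + r)" using \<rho> by (intro power_decreasing) auto
    hence "norm Q ^ (m * r) \<le> \<rho> ^ m * \<rho> ^ r"
      using \<rho>(3) by (simp add: power_mult power_add)
    hence "real r ^ j * norm Q ^ (m * r) \<le> real r ^ j * (\<rho> ^ m * \<rho> ^ r)"
      by (intro mult_left_mono) auto
    thus "norm (f mr) \<le> (case mr of (m, r) \<Rightarrow> \<rho> ^ m * (real r ^ j * \<rho> ^ r))"
      by (simp add: mr f_def norm_mult norm_power mult_ac)
  qed auto
  hence fs: "f summable_on {1..} \<times> {1..}" by (rule abs_summable_summable)
  then obtain S where S: "(f has_sum S) ({1..} \<times> {1..})" by (auto simp: summable_on_def)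
  have row: "((\<lambda>r. f (m, r)) has_sum qfun (pow_fps j) (of_nat m * z)) {1..}" if "m \<in> {1..}" for m
  proof -
    have mz: "Im (of_nat m * z) > 0" using z that by simp
    have q: "qexp (of_nat m * z) = Q ^ m" unfolding Q_def qexp_def
      by (simp add: exp_of_nat_mult[symmetric] mult_ac)
    have "((\<lambda>r. of_rat (fps_nth (pow_fps j) r) * qexp (of_nat m * z) ^ r) has_sum qfun (pow_fps j) (of_nat m * z)) UNIV"
      by (rule has_sum_qfun[OF qconvergent_pow_fps mz])
    also have "?this \<longleftrightarrow> ?thesis"
      by (rule has_sum_cong_neutral)
        (use j in \<open>auto simp: f_def pow_fps_def q power_mult of_rat_power not_le power_0_left\<close>)
    finally show ?thesis .
  qed
  have A: "((\<lambda>m. qfun (pow_fps j) (of_nat m * z)) has_sum S) {1..}"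
    by (rule has_sum_SigmaD[OF S]) (rule row)
  have "(f has_sum S) ({1..} \<times> {1..}) \<longleftrightarrow>
      ((\<lambda>(n, r). of_nat r ^ j * Q ^ n) has_sum S) (Sigma {1..} (\<lambda>n. {r. r dvd n}))"
    by (rule has_sum_reindex_bij_witness[where i = "\<lambda>(n, r). (n div r, r)" and j = "\<lambda>(m, r). (m * r, r)"])
       (auto simp: f_def dvd_div_eq_0_iff Suc_le_eq intro!: Nat.gr0I)
  with S have S': "((\<lambda>(n, r). of_nat r ^ j * Q ^ n) has_sum S) (Sigma {1..} (\<lambda>n. {r. r dvd n}))" by simp
  have "((\<lambda>n. of_rat (fps_nth (Phi j) n) * Q ^ n) has_sum S) {1..}"
  proof (rule has_sum_SigmaD[OF S'])
    fix n :: nat assume n: "n \<in> {1..}"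
    show "((\<lambda>r. case (n, r) of (n, r) \<Rightarrow> of_nat r ^ j * Q ^ n) has_sum of_rat (Phi j $ n) * Q ^ n) {r. r dvd n}"
      using n by (intro has_sum_finiteI) (auto simp: Phi_def Defs.sigma_def sum_distrib_right of_rat_sum of_rat_power)
  qed
  also have "?this \<longleftrightarrow> ((\<lambda>n. of_rat (fps_nth (Phi j) n) * Q ^ n) has_sum S) UNIV"
    by (rule has_sum_cong_neutral) (auto simp: Phi_def not_le)
  finally have "S = qfun (Phi j) z"
    using has_sum_qfun[OF qconvergent_Phi z, of j] has_sum_unique unfolding Q_def by blast
  with A show ?thesis by simp
qed

text \<open>For even \<open>k >= 2\<close> this is twice the zeta value: the sum is two-sided and
  the term \<open>n = 0\<close> is \<open>1 / 0 = 0\<close>. In the same way the origin contributes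
  0 to \<open>eisenstein_G\<close>.\<close>

definition zeta_int :: "nat \<Rightarrow> complex" where
  "zeta_int k = infsum (\<lambda>n::int. 1 / of_int n ^ k) UNIV"

definition eisenstein_G :: "nat \<Rightarrow> complex \<Rightarrow> complex" where
  "eisenstein_G k z = infsum (\<lambda>(m::int, n::int). 1 / (of_int m * z + of_int n) ^ k) UNIV"

text \<open>The bijection \<open>(m, n)\<close> to \<open>(n, -m)\<close> of the lattice absorbs the
  inversion.\<close>

lemma eisenstein_G_inversion:
  assumes "Im z > 0"
  shows "eisenstein_G k (- 1 / z) = z ^ k * eisenstein_G k z"
proof -
  have z0: "z \<noteq> 0" using assms by auto
  have "eisenstein_G k (- 1 / z) = infsum (\<lambda>(m::int, n::int). z ^ k * (1 / (of_int m * z + of_int n) ^ k)) UNIV"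
    unfolding eisenstein_G_def
  proof (rule infsum_reindex_bij_witness[where i = "\<lambda>(m, n). (- n, m)" and j = "\<lambda>(m, n). (n, - m)"])
    fix mn :: "int \<times> int" 
    obtain m n where mn: "mn = (m, n)" by (cases mn)
    have "of_int n * z + of_int (- m) = z * (of_int m * (- 1 / z) + of_int n)" using z0 by (simp add: field_simps)
    hence "z ^ k * (1 / (of_int n * z + of_int (- m)) ^ k) = 1 / (of_int m * (- 1 / z) + of_int n) ^ k"
      using z0 by (simp add: power_mult_distrib)
    thus "(case (case mn of (m, n) \<Rightarrow> (n, - m)) of (m, n) \<Rightarrow> z ^ k * (1 / (of_int m * z + of_int n) ^ k)) =
       (case mn of (m, n) \<Rightarrow> 1 / (of_int m * (- 1 / z) + of_int n) ^ k)" by (simp add: mn)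
  qed auto
  also have "\<dots> = z ^ k * eisenstein_G k z"
    unfolding eisenstein_G_def by (subst infsum_cmult_right' [symmetric]) (auto simp: case_prod_unfold)
  finally show ?thesis .
qed

lemma row_has_sum:
  assumes z: "Im z > 0" and k: "k \<ge> 2" "even k" and m: "m > 0"
  shows "((\<lambda>n::int. 1 / (of_nat m * z + of_int n) ^ k) has_sum
     ((2 * of_real pi * \<i>) ^ k / fact (k - 1) * qfun (pow_fps (k - 1)) (of_nat m * z))) UNIV"
    and "((\<lambda>n::int. 1 / (- of_nat m * z + of_int n) ^ k) has_sum
     ((2 * of_real pi * \<i>) ^ k / fact (k - 1) * qfun (pow_fps (k - 1)) (of_nat m * z))) UNIV"
proof -
  have mz: "Im (of_nat m * z) > 0" using z m by simp
  show 1: "((\<lambda>n::int. 1 / (of_nat m * z + of_int n) ^ k) has_sum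
     ((2 * of_real pi * \<i>) ^ k / fact (k - 1) * qfun (pow_fps (k - 1)) (of_nat m * z))) UNIV"
    using lipschitz_formula[OF mz k(1)] k(2) by (simp add: power_mult_distrib)
  have "(- of_nat m * z + of_int (- n)) ^ k = (of_nat m * z + of_int n) ^ k" for n :: int
  proof -
    have "- of_nat m * z + of_int (- n) = - (of_nat m * z + of_int n)" by simp
    thus ?thesis using k(2) by (simp only: power_minus_even)
  qed
  hence "((\<lambda>n::int. 1 / (of_nat m * z + of_int n) ^ k) has_sum
     ((2 * of_real pi * \<i>) ^ k / fact (k - 1) * qfun (pow_fps (k - 1)) (of_nat m * z))) UNIV =
     ((\<lambda>n::int. 1 / (- of_nat m * z + of_int n) ^ k) has_sum
     ((2 * of_real pi * \<i>) ^ k / fact (k - 1) * qfun (pow_fps (k - 1)) (of_nat m * z))) UNIV"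
    by (intro has_sum_reindex_bij_witness[where i = uminus and j = uminus]) auto
  with 1 show "((\<lambda>n::int. 1 / (- of_nat m * z + of_int n) ^ k) has_sum
     ((2 * of_real pi * \<i>) ^ k / fact (k - 1) * qfun (pow_fps (k - 1)) (of_nat m * z))) UNIV" by blast
qed

text \<open>Row 0 is \<open>zeta_int k\<close>, and the rows \<open>m\<close> and \<open>-m\<close>
  agree for even \<open>k\<close>. The sum is iterated rather than double so that weight 2 is
  covered, where the double series does not converge absolutely.\<close>

lemma rows_has_sum:
  assumes z: "Im z > 0" and k: "k \<ge> 2" "even k"
  defines "g \<equiv> \<lambda>m::int. infsum (\<lambda>n::int. 1 / (of_int m * z + of_int n) ^ k) UNIV"
  shows "(g has_sum zeta_int k + 2 * ((2 * of_real pi * \<i>) ^ k / fact (k - 1) * qfun (Phi (k - 1)) z)) UNIV"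
proof -
  define S where "S = (2 * of_real pi * \<i>) ^ k / fact (k - 1) * qfun (Phi (k - 1)) z"
  have g1: "g (int m) = (2 * of_real pi * \<i>) ^ k / fact (k - 1) * qfun (pow_fps (k - 1)) (of_nat m * z)" if "m > 0" for m
    using infsumI[OF row_has_sum(1)[OF z k that]] by (simp add: g_def)
  have g2: "g (- int m) = (2 * of_real pi * \<i>) ^ k / fact (k - 1) * qfun (pow_fps (k - 1)) (of_nat m * z)" if "m > 0" for m
    using infsumI[OF row_has_sum(2)[OF z k that]] by (simp add: g_def)
  have P: "((\<lambda>m. (2 * of_real pi * \<i>) ^ k / fact (k - 1) * qfun (pow_fps (k - 1)) (of_nat m * z)) has_sum S) {1..}"
    unfolding S_def using k by (intro has_sum_cmult_right Phi_has_sum[OF z]) auto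
  have "((\<lambda>m. g (int m)) has_sum S) {1..}"
    using P by (rule has_sum_cong[THEN iffD1, rotated]) (simp add: g1)
  from has_sum_insert[OF _ this, of 0] have "((\<lambda>m. g (int m)) has_sum (g (int 0) + S)) (insert 0 {1..})" by simp
  moreover have "insert 0 {1..} = (UNIV :: nat set)" by auto
  ultimately have A: "((\<lambda>m. g (int m)) has_sum (zeta_int k + S)) UNIV"
    by (simp add: g_def zeta_int_def)
  have "((\<lambda>m. g (- int m)) has_sum S) {1..}"
    using P by (rule has_sum_cong[THEN iffD1, rotated]) (simp add: g2)
  also have "{1..} = range Suc" by (auto simp: image_iff Suc_le_eq gr0_conv_Suc)
  finally have B: "((\<lambda>m. g (- int m - 1)) has_sum S) UNIV"
    by (subst (asm) has_sum_reindex) (auto simp: o_def minus_diff_commute)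
  show ?thesis using has_sum_int[OF A B] by (simp add: S_def algebra_simps)
qed

lemma eisenstein_G_qexpansion:
  assumes z: "Im z > 0" and k: "k \<ge> 4" "even k"
  shows "eisenstein_G k z = zeta_int k + 2 * ((2 * of_real pi * \<i>) ^ k / fact (k - 1) * qfun (Phi (k - 1)) z)"
proof -
  let ?f = "\<lambda>(m::int, n::int). 1 / (of_int m * z + of_int n) ^ k"
  have "?f summable_on UNIV \<times> UNIV"
    using lattice_abs_summable[OF z, of k] k by (auto intro: abs_summable_summable)
  from infsum_Sigma_banach[OF this]
  have "eisenstein_G k z = infsum (\<lambda>m::int. infsum (\<lambda>n::int. 1 / (of_int m * z + of_int n) ^ k) UNIV) UNIV"
    by (simp add: eisenstein_G_def)
  also have "\<dots> = zeta_int k + 2 * ((2 * of_real pi * \<i>) ^ k / fact (k - 1) * qfun (Phi (k - 1)) z)"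
    using k by (intro infsumI rows_has_sum[OF z]) auto
  finally show ?thesis .
qed

text \<open>Dividing \<open>eisenstein_G\<close> by the factor in front of its \<open>Phi\<close>
  series leaves the constant term \<open>c\<close>. That \<open>c\<close> can be taken rational is
  supplied by \<open>zeta_int_rational\<close> for the weights that occur.\<close>

lemma modular_form_eisenstein:
  assumes k: "k \<ge> 4" "even k"
    and c: "zeta_int k = 2 * ((2 * of_real pi * \<i>) ^ k / fact (k - 1)) * of_rat c"
  shows "modular_form k (fps_const c + Phi (k - 1))"
  unfolding modular_form_iff
proof (intro conjI allI impI)
  show "qconvergent (fps_const c + Phi (k - 1))"
    by (intro qconvergent_add qconvergent_fps_const qconvergent_Phi)
  define K where "K = 2 * ((2 * of_real pi * \<i>) ^ k / fact (k - 1) :: complex)"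
  have K0: "K \<noteq> 0" by (simp add: K_def)
  have c': "zeta_int k = K * of_rat c" unfolding c K_def ..
  have G: "eisenstein_G k z = K * qfun (fps_const c + Phi (k - 1)) z" if "Im z > 0" for z
  proof -
    have "eisenstein_G k z = K * of_rat c + K * qfun (Phi (k - 1)) z"
      using eisenstein_G_qexpansion[OF that k] unfolding c' by (simp only: K_def mult.assoc)
    thus ?thesis
      using that by (simp add: qfun_add qconvergent_fps_const qconvergent_Phi qfun_fps_const ring_distribs)
  qed
  fix z :: complex assume z: "Im z > 0"
  have "K * qfun (fps_const c + Phi (k - 1)) (- 1 / z) = z ^ k * (K * qfun (fps_const c + Phi (k - 1)) z)"
    using eisenstein_G_inversion[OF z, of k] unfolding G[OF z] G[OF Im_minus_inverse_pos[OF z]] .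
  thus "qfun (fps_const c + Phi (k - 1)) (- 1 / z) = z ^ k * qfun (fps_const c + Phi (k - 1)) z"
    using K0 by (simp only: mult.left_commute[of _ K] mult_cancel_left) simp
qed

subsection \<open>Zeta values at even integers\<close>

lemma zeta_int_sums:
  assumes k: "k \<ge> 2" "even k" and S: "(\<lambda>i. 1 / of_nat (Suc i) ^ k) sums (S :: complex)"
  shows "zeta_int k = 2 * S"
proof -
  have "summable (\<lambda>i. inverse (real i ^ k))" using k by (intro inverse_power_summable) auto
  hence "summable (\<lambda>i. inverse (real (Suc i) ^ k))" by (subst summable_Suc_iff)
  hence "summable (\<lambda>i. norm (1 / of_nat (Suc i) ^ k :: complex))"
    by (simp only: norm_divide norm_power norm_of_nat norm_one inverse_eq_divide)
  from norm_summable_imp_has_sum[OF this S]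
  have H: "((\<lambda>i. 1 / of_nat (Suc i) ^ k) has_sum S) UNIV" .
  have B: "((\<lambda>i. 1 / of_int (- int i - 1) ^ k) has_sum S) UNIV"
  proof -
    have "(of_int (- int i - 1) :: complex) = - of_nat (Suc i)" for i by simp
    hence "(of_int (- int i - 1) :: complex) ^ k = of_nat (Suc i) ^ k" for i
      using k by (simp only: power_minus_even)
    thus ?thesis using H by simp
  qed
  have "((\<lambda>i. 1 / of_int (int i) ^ k) has_sum S) (range Suc)"
    by (subst has_sum_reindex) (use H in \<open>auto simp: o_def\<close>)
  also have "?this \<longleftrightarrow> ((\<lambda>i. 1 / of_int (int i) ^ k) has_sum S) UNIV"
  proof (rule has_sum_cong_neutral)
    fix x :: nat assume "x \<in> UNIV - range Suc"
    hence "x = 0" by (metis DiffD2 not0_implies_Suc rangeI)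
    thus "1 / of_int (int x) ^ k = (0 :: complex)" using k by (simp add: power_0_left)
  qed auto
  finally have "((\<lambda>n::int. 1 / of_int n ^ k) has_sum (S + S)) UNIV" using B by (rule has_sum_int)
  thus ?thesis unfolding zeta_int_def by (simp add: infsumI)
qed

text \<open>Up to the polar term \<open>1 / w\<close>, this is \<open>- pi * cot (pi * w)\<close>; its Taylor coefficients are
  zeta values, and the Riccati equation of the cotangent becomes a recurrence for them.\<close>

definition cot_regular :: "complex \<Rightarrow> complex" where
  "cot_regular w = Digamma (1 + w) - Digamma (1 - w)"

lemma one_pm_not_nonpos_Int:
  fixes w :: complex
  assumes "norm w < 1"
  shows "1 + w \<notin> \<int>\<^sub>\<le>\<^sub>0" "1 - w \<notin> \<int>\<^sub>\<le>\<^sub>0"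
proof -
  have "Re (1 + w) > 0" "Re (1 - w) > 0"
    using assms abs_Re_le_cmod[of w] by auto
  moreover have "Re x \<le> 0" if "x \<in> \<int>\<^sub>\<le>\<^sub>0" for x :: complex
    using that by (auto elim!: nonpos_Ints_cases)
  ultimately show "1 + w \<notin> \<int>\<^sub>\<le>\<^sub>0" "1 - w \<notin> \<int>\<^sub>\<le>\<^sub>0" by force+
qed

lemma cot_regular_deriv:
  fixes w :: complex
  assumes "norm w < 1"
  shows "((\<lambda>w. Polygamma n (1 + w) - (-1) ^ n * Polygamma n (1 - w)) has_field_derivative
     (Polygamma (Suc n) (1 + w) - (-1) ^ Suc n * Polygamma (Suc n) (1 - w))) (at w)"
  using one_pm_not_nonpos_Int[OF assms] by (auto intro!: derivative_eq_intros)

lemma higher_deriv_cot_regular: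
  assumes "norm w < 1"
  shows "(deriv ^^ n) cot_regular w = Polygamma n (1 + w) - (-1) ^ n * Polygamma n (1 - w)"
  using assms
proof (induction n arbitrary: w)
  case 0
  show ?case by (simp add: cot_regular_def)
next
  case (Suc n)
  have "eventually (\<lambda>x. x \<in> ball 0 1) (nhds w)"
    using Suc.prems by (intro eventually_nhds_in_open) auto
  hence "eventually (\<lambda>x. (deriv ^^ n) cot_regular x = Polygamma n (1 + x) - (-1) ^ n * Polygamma n (1 - x)) (nhds w)"
    by eventually_elim (use Suc.IH in auto)
  hence "deriv ((deriv ^^ n) cot_regular) w = deriv (\<lambda>x. Polygamma n (1 + x) - (-1) ^ n * Polygamma n (1 - x)) w"
    by (intro deriv_cong_ev) auto
  also have "\<dots> = Polygamma (Suc n) (1 + w) - (-1) ^ Suc n * Polygamma (Suc n) (1 - w)"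
    by (intro DERIV_imp_deriv cot_regular_deriv Suc.prems)
  finally show ?case by simp
qed

lemma cot_regular_holomorphic: "cot_regular holomorphic_on ball 0 1"
proof -
  have "cot_regular field_differentiable at w within ball 0 1" if "norm w < 1" for w
    using cot_regular_deriv[OF that, of 0] unfolding cot_regular_def [abs_def] field_differentiable_def
    by (auto intro: has_field_derivative_at_within)
  thus ?thesis by (auto simp: holomorphic_on_def)
qed

lemma cot_regular_eq:
  assumes "norm w < 1" "w \<noteq> 0"
  shows "cot_regular w = 1 / w - of_real pi * cot (of_real pi * w)" "sin (of_real pi * w) \<noteq> 0"
proof -
  have nI: "w \<notin> \<int>"
  proof
    assume "w \<in> \<int>"
    then obtain n :: int where n: "w = of_int n" by (elim Ints_cases)
    hence "\<bar>real_of_int n\<bar> < 1" "n \<noteq> 0" using assms by (auto simp: norm_of_int)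
    thus False by linarith
  qed
  show "cot_regular w = 1 / w - of_real pi * cot (of_real pi * w)"
    using Digamma_plus1[OF assms(2)] Digamma_reflection_complex[OF nI]
    by (simp add: cot_regular_def add.commute algebra_simps)
  show "sin (of_real pi * w) \<noteq> 0"
  proof
    assume "sin (of_real pi * w) = 0"
    then obtain n :: int where "of_real pi * w = of_real (of_int n * pi)"
      using Complex_Transcendental.sin_eq_0 by auto
    hence "w = of_int n" by (simp add: field_simps)
    thus False using nI by simp
  qed
qed

text \<open>Substitute \<open>y = 1 / w - h\<close>, with \<open>h\<close> the regular part, into
  \<open>y' = - (pi\<^sup>2 + y\<^sup>2)\<close>, the equation of \<open>y = pi cot (pi w)\<close>,
  and multiply by \<open>w\<close>. At \<open>w = 0\<close> both sides vanish.\<close>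

lemma cot_regular_riccati:
  assumes "norm w < 1"
  shows "w * deriv cot_regular w + 2 * cot_regular w = of_real pi ^ 2 * w + w * cot_regular w ^ 2"
proof (cases "w = 0")
  case True
  thus ?thesis by (simp add: cot_regular_def)
next
  case False
  define p s c where "p = complex_of_real pi" and "s = sin (p * w)" and "c = cos (p * w)"
  note eq = cot_regular_eq[OF assms False]
  have s0: "s \<noteq> 0" using eq(2) by (simp add: s_def p_def)
  have "eventually (\<lambda>x. x \<in> ball 0 1 - {0}) (nhds w)"
    using assms False by (intro eventually_nhds_in_open) auto
  hence "eventually (\<lambda>x. cot_regular x = 1 / x - p * cot (p * x)) (nhds w)"
    by eventually_elim (auto simp: cot_regular_eq p_def)
  hence "deriv cot_regular w = deriv (\<lambda>x. 1 / x - p * cot (p * x)) w"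
    by (intro deriv_cong_ev) auto
  also have "\<dots> = - 1 / w ^ 2 + p ^ 2 / s ^ 2"
  proof (rule DERIV_imp_deriv)
    have sc1: "s * s + c * c = 1" by (simp add: s_def c_def flip: power2_eq_square)
    have "((\<lambda>x. 1 / x - p * (cos (p * x) / sin (p * x))) has_field_derivative
       - 1 / w ^ 2 - p * (((- s * p) * s - c * (c * p)) / (s * s))) (at w)"
      using False s0 by (auto intro!: derivative_eq_intros simp: s_def c_def power2_eq_square algebra_simps)
    also have "(- s * p) * s - c * (c * p) = - p * (s * s + c * c)" by (simp add: algebra_simps)
    finally show "((\<lambda>x. 1 / x - p * cot (p * x)) has_field_derivative - 1 / w ^ 2 + p ^ 2 / s ^ 2) (at w)"
      unfolding cot_def sc1 by (simp add: power2_eq_square)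
  qed
  finally have d: "deriv cot_regular w = - 1 / w ^ 2 + p ^ 2 / s ^ 2" .
  have h: "cot_regular w = 1 / w - p * (c / s)" using eq(1) by (simp add: cot_def c_def s_def p_def)
  have sc: "c ^ 2 = 1 - s ^ 2" by (simp add: c_def s_def cos_squared_eq)
  have e: "(1 / w - p * (c / s)) ^ 2 = 1 / w ^ 2 - 2 * p * c / (w * s) + p ^ 2 * ((1 - s ^ 2) / s ^ 2)"
    unfolding sc[symmetric] using False s0 by (simp add: field_simps power2_eq_square)
  show ?thesis unfolding d h e p_def[symmetric] using False s0
    by (simp add: divide_simps) (simp add: algebra_simps power2_eq_square)
qed

text \<open>The Taylor coefficient of \<open>cot_regular\<close> at odd \<open>n\<close> is
  \<open>zeta_int (n + 1)\<close>, at even \<open>n\<close> it is 0. Comparing coefficients of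
  \<open>w ^ (k - 1)\<close> in the Riccati equation gives the factor \<open>(k - 1) + 2\<close> on
  the left and the convolution on the right.\<close>

lemma zeta_int_recurrence:
  shows "3 * zeta_int 2 = of_real pi ^ 2"
    and "k \<ge> 4 \<Longrightarrow> even k \<Longrightarrow> of_nat (k + 1) * zeta_int k =
      (\<Sum>a\<in>{a\<in>{2..k-2}. even a}. zeta_int a * zeta_int (k - a))"
proof -
  define C where "C = fps_expansion cot_regular 0"
  have C: "cot_regular has_fps_expansion C" unfolding C_def
    by (rule has_fps_expansion_fps_expansion[OF _ _ cot_regular_holomorphic]) auto
  have "(\<lambda>w. w * deriv cot_regular w + 2 * cot_regular w) has_fps_expansion fps_X * fps_deriv C + 2 * C"
    by (intro fps_expansion_intros C)
  note 1 = this
  have 2: "(\<lambda>w. of_real pi ^ 2 * w + w * cot_regular w ^ 2) has_fps_expansion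
      fps_const (of_real pi ^ 2) * fps_X + fps_X * C ^ 2"
    by (intro fps_expansion_intros C)
  have 3: "eventually (\<lambda>w. w * deriv cot_regular w + 2 * cot_regular w =
      of_real pi ^ 2 * w + w * cot_regular w ^ 2) (nhds 0)"
  proof -
    have "eventually (\<lambda>x. x \<in> ball 0 1) (nhds (0::complex))"
      by (intro eventually_nhds_in_open) auto
    thus ?thesis by eventually_elim (use cot_regular_riccati in auto)
  qed
  have eq: "fps_X * fps_deriv C + 2 * C = fps_const (of_real pi ^ 2) * fps_X + fps_X * C ^ 2"
    by (rule fps_expansion_unique_complex[OF _ 2]) (use 1 has_fps_expansion_cong[OF 3 refl] in blast)
  have Cn: "C $ n = (1 - (-1) ^ n) * Polygamma n 1 / fact n" for n
    using fps_nth_fps_expansion[OF C, of n] higher_deriv_cot_regular[of 0 n] by (simp add: algebra_simps)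
  have Ceven: "C $ n = 0" if "even n" for n using Cn that by simp
  have Codd: "C $ n = zeta_int (n + 1)" if "odd n" for n
  proof -
    have n: "n > 0" using that by (auto intro!: Nat.gr0I)
    have "(\<lambda>i. 1 / of_nat (Suc i) ^ (n + 1)) sums (Polygamma n 1 / fact n :: complex)"
      using Polygamma_LIMSEQ[of 1 n] n that by (simp add: inverse_eq_divide add.commute)
    from zeta_int_sums[OF _ _ this] show ?thesis using that n Cn by simp
  qed
  have rec: "of_nat (n + 2) * C $ n = (if n = 1 then of_real pi ^ 2 else 0) + (\<Sum>i\<le>n-1. C $ i * C $ (n - 1 - i))"
    if "n \<ge> 1" for n
  proof -
    have 1: "(fps_X * fps_deriv C + 2 * C) $ n = of_nat (n + 2) * C $ n"
      using that by (cases n) (auto simp: algebra_simps numeral_fps_const)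
    have 2: "(fps_X * C ^ 2) $ n = (\<Sum>i\<le>n-1. C $ i * C $ (n - 1 - i))"
    proof -
      have "(fps_X * C ^ 2) $ n = (C * C) $ (n - 1)" using that by (simp add: power2_eq_square)
      thus ?thesis by (simp add: fps_mult_nth atLeast0AtMost)
    qed
    have "(fps_const (of_real pi ^ 2) * fps_X + fps_X * C ^ 2) $ n =
      (if n = 1 then of_real pi ^ 2 else 0) + (\<Sum>i\<le>n-1. C $ i * C $ (n - 1 - i))"
      by (simp only: fps_add_nth 2) (simp add: fps_X_nth)
    thus ?thesis using 1 eq by simp
  qed
  show "3 * zeta_int 2 = of_real pi ^ 2"
    using rec[of 1] Codd[of 1] Ceven[of 0] by (simp add: numeral_2_eq_2)
  assume k: "k \<ge> 4" "even k"
  have "of_nat (k + 1) * zeta_int k = of_nat (k - 1 + 2) * C $ (k - 1)"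
  proof -
    have "odd (k - 1)" "k - 1 + 1 = k" "k - 1 + 2 = k + 1" using k by auto
    thus ?thesis using Codd[of "k - 1"] by metis
  qed
  also have "\<dots> = (\<Sum>i\<le>k-2. C $ i * C $ (k - 2 - i))"
    using k by (subst rec) (auto simp: numeral_2_eq_2)
  also have "\<dots> = (\<Sum>i\<in>{i\<in>{..k-2}. odd i}. C $ i * C $ (k - 2 - i))"
    by (rule sum.mono_neutral_right) (auto simp: Ceven)
  also have "\<dots> = (\<Sum>a\<in>{a\<in>{2..k-2}. even a}. zeta_int a * zeta_int (k - a))"
  proof (rule sum.reindex_bij_witness[of _ "\<lambda>a. a - 1" "\<lambda>i. i + 1"])
    fix i assume i: "i \<in> {i \<in> {..k - 2}. odd i}"
    hence ne: "i \<noteq> k - 2" using k by auto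
    have "odd (k - 2 - i)" using i k by auto
    moreover have "k - 2 - i + 1 = k - (i + 1)" using i ne by auto
    ultimately show "zeta_int (i + 1) * zeta_int (k - (i + 1)) = C $ i * C $ (k - 2 - i)"
      using i by (simp add: Codd)
    show "i + 1 \<in> {a \<in> {2..k - 2}. even a}" using i ne by (auto simp: odd_pos Suc_le_eq)
  qed (auto simp: k)
  finally show "of_nat (k + 1) * zeta_int k = (\<Sum>a\<in>{a\<in>{2..k-2}. even a}. zeta_int a * zeta_int (k - a))" .
qed

subsection \<open>The transformation law of the Eisenstein series of weight 2\<close>

text \<open>The half-open windows fit the telescoping below: a sum of \<open>f (n - 1) - f n\<close>
  over such a window leaves only the boundary values at \<open>-N\<close> and
  \<open>N\<close>.\<close>

lemma tendsto_symmetric_sum_int: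
  fixes f :: "int \<Rightarrow> complex"
  assumes "f summable_on UNIV"
  shows "(\<lambda>N. \<Sum>n\<in>{- int N<..int N}. f n) \<longlonglongrightarrow> infsum f UNIV"
proof -
  have "filterlim (\<lambda>N. {- int N<..int N}) (finite_subsets_at_top UNIV) sequentially"
    unfolding filterlim_finite_subsets_at_top
  proof (intro allI impI)
    fix X :: "int set" assume X: "finite X \<and> X \<subseteq> UNIV"
    show "eventually (\<lambda>N. finite {- int N<..int N} \<and> X \<subseteq> {- int N<..int N} \<and> {- int N<..int N} \<subseteq> UNIV) sequentially"
      using eventually_ge_at_top[of "nat (\<Sum>x\<in>X. \<bar>x\<bar>) + 1"]
    proof eventually_elim
      case (elim N)
      have "\<bar>x\<bar> \<le> (\<Sum>x\<in>X. \<bar>x\<bar>)" if "x \<in> X" for x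
        using that X by (intro member_le_sum) auto
      moreover have "int N \<ge> (\<Sum>x\<in>X. \<bar>x\<bar>) + 1"
        using elim by linarith
      ultimately show ?case by force
    qed
  qed
  thus ?thesis by (rule filterlim_compose[OF infsum_tendsto[OF assms]])
qed

lemma has_sum_diff:
  fixes f g :: "'a \<Rightarrow> complex"
  assumes "(f has_sum a) A" "(g has_sum b) A"
  shows "((\<lambda>x. f x - g x) has_sum (a - b)) A"
  using has_sum_add[OF assms(1) has_sum_uminusI[OF assms(2)]] by simp

lemma summable_on_diff:
  fixes f g :: "'a \<Rightarrow> complex"
  shows "f summable_on A \<Longrightarrow> g summable_on A \<Longrightarrow> (\<lambda>x. f x - g x) summable_on A"
  unfolding summable_on_def using has_sum_diff by blast

lemma infsum_diff:
  fixes f g :: "'a \<Rightarrow> complex"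
  shows "f summable_on A \<Longrightarrow> g summable_on A \<Longrightarrow> infsum (\<lambda>x. f x - g x) A = infsum f A - infsum g A"
  by (intro infsumI has_sum_diff has_sum_infsum)

lemma has_sum_sum:
  fixes f :: "'a \<Rightarrow> 'b \<Rightarrow> complex"
  assumes "finite I" "\<And>i. i \<in> I \<Longrightarrow> (f i has_sum s i) A"
  shows "((\<lambda>x. \<Sum>i\<in>I. f i x) has_sum (\<Sum>i\<in>I. s i)) A"
  using assms by (induction I rule: finite_induct) (auto intro: has_sum_add)

lemma sum_telescope_symmetric_int:
  fixes f :: "int \<Rightarrow> complex"
  shows "(\<Sum>n\<in>{- int N<..int N}. f (n - 1) - f n) = f (- int N) - f (int N)"
proof (induction N)
  case (Suc N)
  have "{- int (Suc N)<..int (Suc N)} = insert (- int N) (insert (int N + 1) {- int N<..int N})"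
    by auto
  moreover have "- int (Suc N) = - int N - 1" "int (Suc N) = int N + 1" by auto
  ultimately show ?case using Suc by (simp only:) (simp add: algebra_simps)
qed simp


lemma inverse_nat_plus_tendsto_0:
  fixes w :: complex
  shows "(\<lambda>N. 1 / (w + of_nat N)) \<longlonglongrightarrow> 0" "(\<lambda>N. 1 / (w - of_nat N)) \<longlonglongrightarrow> 0"
proof -
  have *: "(\<lambda>N. 1 / (w + of_nat N)) \<longlonglongrightarrow> 0" for w :: complex
  proof -
    have "filterlim (\<lambda>N. w + of_nat N) at_infinity sequentially"
      by (intro tendsto_add_filterlim_at_infinity[OF tendsto_const] tendsto_of_nat)
    from filterlim_compose[OF tendsto_inverse_0 this] show ?thesis by (simp add: inverse_eq_divide)
  qed
  show "(\<lambda>N. 1 / (w + of_nat N)) \<longlonglongrightarrow> 0" by (rule *)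
  have "1 / (w - of_nat N) = - (1 / (- w + of_nat N))" for N
    by (metis (no_types) divide_minus_right minus_diff_eq uminus_add_conv_diff)
  thus "(\<lambda>N. 1 / (w - of_nat N)) \<longlonglongrightarrow> 0"
    using tendsto_minus[OF *[of "- w"]] by simp
qed

lemma lattice_nonzero:
  assumes "Im z > 0" "m \<noteq> (0::int)"
  shows "of_int m * z + of_int n \<noteq> 0"
proof
  assume "of_int m * z + of_int n = 0"
  hence "Im (of_int m * z + of_int n) = 0" by simp
  thus False using assms by simp
qed

text \<open>Eisenstein's argument: the terms are split as \<open>sq = tele + err\<close> with
  \<open>err\<close> summable over the lattice, so that rows first and columns first agree for
  \<open>err\<close>. For \<open>tele\<close> they do not: rows give 0, columns tend to
  \<open>- 2 pi i / z\<close>, and this discrepancy is the anomaly of \<open>E2\<close>.\<close>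

locale eisenstein_weight_2 =
  fixes z :: complex
  assumes z: "Im z > 0"
begin

text \<open>Row 0 is left out, since the telescoping term has poles there; its contribution
  \<open>zeta_int 2\<close> is accounted for in \<open>sum_sq_rows\<close> and
  \<open>sum_sq_cols\<close>.\<close>

definition sq :: "int \<Rightarrow> int \<Rightarrow> complex" where
  "sq m n = (if m = 0 then 0 else 1 / (of_int m * z + of_int n) ^ 2)"

text \<open>Subtracting the telescoping term makes the double series of weight 2 absolutely convergent.\<close>

definition tele :: "int \<Rightarrow> int \<Rightarrow> complex" where
  "tele m n = (if m = 0 then 0 else 1 / (of_int m * z + of_int (n - 1)) - 1 / (of_int m * z + of_int n))"

definition err :: "int \<Rightarrow> int \<Rightarrow> complex" where
  "err m n = sq m n - tele m n"

lemma err_eq: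
  assumes "m \<noteq> 0"
  shows "err m n = - 1 / ((of_int m * z + of_int n) ^ 2 * (of_int m * z + of_int (n - 1)))"
proof -
  define x where "x = of_int m * z + of_int n"
  have x: "x \<noteq> 0" "x - 1 \<noteq> 0" "of_int m * z + of_int (n - 1) = x - 1"
    using lattice_nonzero[OF z assms, of n] lattice_nonzero[OF z assms, of "n - 1"]
    by (auto simp: x_def algebra_simps)
  show ?thesis unfolding err_def sq_def tele_def x(3) x_def[symmetric] using assms x(1,2)
    by (simp add: divide_simps) (simp add: algebra_simps power2_eq_square)
qed

lemma err_summable: "(\<lambda>(m, n). err m n) summable_on UNIV \<times> UNIV"
proof -
  obtain c where c: "c > 0" "\<And>m n :: int. norm (of_int m * z + of_int n) \<ge> c * (\<bar>of_int m\<bar> + \<bar>of_int n\<bar>)"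
    using lattice_lower_bound[OF z] by blast
  let ?h = "\<lambda>(m::int, n::int). 1 / (\<bar>real_of_int m\<bar> + \<bar>real_of_int n\<bar>) ^ 3"
  have "(\<lambda>mn. (2 / c ^ 3) * ?h mn) summable_on UNIV"
    by (intro summable_on_cmult_right lattice_cubic_summable)
  hence "(\<lambda>(m, n). err m n) abs_summable_on UNIV"
  proof (rule summable_on_comparison_test)
    fix mn :: "int \<times> int"
    obtain m n where mn: "mn = (m, n)" by (cases mn)
    define a where "a = \<bar>real_of_int m\<bar> + \<bar>real_of_int n\<bar>"
    show "norm (case mn of (m, n) \<Rightarrow> err m n) \<le> (2 / c ^ 3) * ?h mn"
    proof (cases "m = 0")
      case True
      thus ?thesis using c by (simp add: mn err_def sq_def tele_def)
    next
      case False
      have a1: "a \<ge> 1" using False unfolding a_def by linarith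
      \<comment> \<open>As \<open>m\<close> is nonzero, replacing \<open>n\<close> by
        \<open>n - 1\<close> at most halves \<open>|m| + |n|\<close>, so the three factors in the
        denominator of \<open>err\<close> give a cubic bound.\<close>
      have "2 * (\<bar>m\<bar> + \<bar>n - 1\<bar>) \<ge> \<bar>m\<bar> + \<bar>n\<bar>" using False by (smt (verit))
      hence "real_of_int (2 * (\<bar>m\<bar> + \<bar>n - 1\<bar>)) \<ge> real_of_int (\<bar>m\<bar> + \<bar>n\<bar>)" by (rule of_int_le_iff[THEN iffD2])
      hence a2: "\<bar>real_of_int m\<bar> + \<bar>real_of_int (n - 1)\<bar> \<ge> a / 2" by (simp add: a_def)
      have n1: "norm (of_int m * z + of_int n) \<ge> c * a" using c(2)[of m n] by (simp add: a_def)
      have "c * (a / 2) \<le> c * (\<bar>real_of_int m\<bar> + \<bar>real_of_int (n - 1)\<bar>)" using c a2 by (intro mult_left_mono) auto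
      hence n2: "norm (of_int m * z + of_int (n - 1)) \<ge> c * (a / 2)" using c(2)[of m "n - 1"] by linarith
      have "c ^ 3 * a ^ 3 / 2 = (c * a) ^ 2 * (c * (a / 2))" by (simp add: power2_eq_square power3_eq_cube)
      also have "\<dots> \<le> norm (of_int m * z + of_int n) ^ 2 * norm (of_int m * z + of_int (n - 1))"
        using c a1 n1 n2 by (intro mult_mono power_mono) auto
      finally have "1 / (norm (of_int m * z + of_int n) ^ 2 * norm (of_int m * z + of_int (n - 1))) \<le> 1 / (c ^ 3 * a ^ 3 / 2)"
        using a1 c by (intro frac_le) auto
      thus ?thesis by (simp add: mn err_eq[OF False] norm_divide norm_mult norm_power a_def)
    qed
  qed auto
  thus ?thesis using abs_summable_summable by simp
qed

lemma sq_row_summable: "sq m summable_on UNIV"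
proof (cases "m = 0")
  case False
  have *: "(\<lambda>n::int. 1 / (of_nat k * z + of_int n) ^ 2) summable_on UNIV"
          "(\<lambda>n::int. 1 / (- of_nat k * z + of_int n) ^ 2) summable_on UNIV" if "k > 0" for k
    using row_has_sum[OF z _ _ that, of 2] by (auto simp: summable_on_def)
  show ?thesis
  proof (cases "m > 0")
    case True
    thus ?thesis using *(1)[of "nat m"] by (simp add: sq_def [abs_def])
  next
    case False
    with \<open>m \<noteq> 0\<close> show ?thesis using *(2)[of "nat (- m)"] by (simp add: sq_def [abs_def])
  qed
qed (simp add: sq_def [abs_def])

lemma sq_col_summable: "(\<lambda>m. sq m n) summable_on UNIV"
proof -
  obtain c where c: "c > 0" "\<And>m n :: int. norm (of_int m * z + of_int n) \<ge> c * (\<bar>of_int m\<bar> + \<bar>of_int n\<bar>)"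
    using lattice_lower_bound[OF z] by blast
  have "(\<lambda>m::int. (4 / c ^ 2) * (1 + \<bar>real_of_int m\<bar>) powr (-2)) summable_on UNIV"
    by (intro summable_on_cmult_right summable_on_int_powr) auto
  hence "(\<lambda>m. sq m n) abs_summable_on UNIV"
  proof (rule summable_on_comparison_test)
    fix m :: int
    show "norm (sq m n) \<le> (4 / c ^ 2) * (1 + \<bar>real_of_int m\<bar>) powr (-2)"
    proof (cases "m = 0")
      case False
      define a where "a = 1 + \<bar>real_of_int m\<bar>"
      have a: "a > 0" by (simp add: a_def)
      have "c * (a / 2) \<le> c * (\<bar>of_int m\<bar> + \<bar>of_int n\<bar>)" using c False by (intro mult_left_mono) (auto simp: a_def)
      also have "\<dots> \<le> norm (of_int m * z + of_int n)" by (rule c(2))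
      finally have "(c * (a / 2)) ^ 2 \<le> norm (of_int m * z + of_int n) ^ 2" using a c by (intro power_mono) auto
      hence "1 / norm (of_int m * z + of_int n) ^ 2 \<le> 1 / (c * (a / 2)) ^ 2"
        using a c by (intro frac_le) auto
      also have "\<dots> = (4 / c ^ 2) * a powr (-2)"
        using a by (simp add: powr_minus_divide powr_numeral power_mult_distrib power_divide)
      finally show ?thesis using False by (simp add: sq_def norm_divide norm_power a_def)
    qed (use c in \<open>simp add: sq_def\<close>)
  qed auto
  thus ?thesis by (rule abs_summable_summable)
qed

lemma err_row_summable: "err m summable_on UNIV"
  by (rule summable_on_SigmaD1[OF err_summable]) simp

lemma err_col_summable: "(\<lambda>m. err m n) summable_on UNIV"
proof -
  have "(\<lambda>(n, m). err m n) summable_on UNIV \<times> UNIV"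
    using err_summable by (subst summable_on_swap) (simp add: case_prod_unfold)
  from summable_on_SigmaD1[OF this, of n] show ?thesis by simp
qed

text \<open>Each row telescopes to \<open>1 / (m z - N) - 1 / (m z + N)\<close>, which tends to
  0.\<close>

lemma tele_row: "infsum (tele m) UNIV = 0"
proof (cases "m = 0")
  case False
  have s: "tele m summable_on UNIV"
  proof -
    have "(\<lambda>n. sq m n - err m n) summable_on UNIV"
      by (intro summable_on_diff sq_row_summable err_row_summable)
    thus ?thesis by (simp add: err_def)
  qed
  let ?f = "\<lambda>n::int. 1 / (of_int m * z + of_int n)"
  have "(\<Sum>n\<in>{- int N<..int N}. tele m n) = 1 / (of_int m * z - of_nat N) - 1 / (of_int m * z + of_nat N)" for N
    using sum_telescope_symmetric_int[of ?f N] False by (simp add: tele_def)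
  moreover have "(\<lambda>N. 1 / (of_int m * z - of_nat N) - 1 / (of_int m * z + of_nat N)) \<longlonglongrightarrow> 0 - 0"
    by (intro tendsto_diff inverse_nat_plus_tendsto_0)
  ultimately have "(\<lambda>N. \<Sum>n\<in>{- int N<..int N}. tele m n) \<longlonglongrightarrow> 0" by simp
  with tendsto_symmetric_sum_int[OF s] show ?thesis using LIMSEQ_unique by blast
qed (simp add: tele_def [abs_def])

lemma tele_col_summable: "(\<lambda>m. tele m n) summable_on UNIV"
proof -
  have "(\<lambda>m. sq m n - err m n) summable_on UNIV"
    by (intro summable_on_diff sq_col_summable err_col_summable)
  thus ?thesis by (simp add: err_def)
qed

text \<open>The points \<open>N (-1 / z)\<close> climb in the upper half-plane, where the cotangent
  differs from \<open>- i\<close> by a quantity that vanishes with \<open>Q ^ N\<close>; oddness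
  turns this into the limit at \<open>N / z\<close>.\<close>

lemma cot_N_tendsto: "(\<lambda>N. of_real pi * cot (of_real pi * (of_nat N / z))) \<longlonglongrightarrow> of_real pi * \<i>"
proof -
  define Q where "Q = qexp (- 1 / z)"
  have Q: "norm Q < 1" unfolding Q_def by (rule norm_qexp_less_1[OF Im_minus_inverse_pos[OF z]])
  have "of_real pi * cot (of_real pi * (of_nat N / z)) = - (of_real pi * \<i> - 2 * of_real pi * \<i> / (1 - Q ^ N))" if "N > 0" for N
  proof -
    have "of_nat N * (- 1 / z) = - (of_nat N / z)" by simp
    moreover have "Im (of_nat N * (- 1 / z)) = real N * Im (- 1 / z)"
      unfolding times_complex.simps by simp
    hence "Im (of_nat N * (- 1 / z)) > 0"
      using Im_minus_inverse_pos[OF z] that by (simp only: mult_pos_pos of_nat_0_less_iff)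
    ultimately have "of_real pi * cot (of_real pi * (- (of_nat N / z))) =
        of_real pi * \<i> - 2 * of_real pi * \<i> / (1 - qexp (of_nat N * (- 1 / z)))"
      using cot_eq_qexp by metis
    also have "qexp (of_nat N * (- 1 / z)) = Q ^ N"
      unfolding Q_def qexp_def by (simp add: exp_of_nat_mult[symmetric] mult_ac)
    also have "cot (of_real pi * (- (of_nat N / z))) = - cot (of_real pi * (of_nat N / z))"
      by (simp add: cot_def)
    finally show ?thesis by (metis minus_minus mult_minus_right)
  qed
  hence "eventually (\<lambda>N. - (of_real pi * \<i> - 2 * of_real pi * \<i> / (1 - Q ^ N)) = of_real pi * cot (of_real pi * (of_nat N / z))) sequentially"
    by (intro eventually_mono[OF eventually_gt_at_top[of 0]]) simp
  moreover have "(\<lambda>N. - (of_real pi * \<i> - 2 * of_real pi * \<i> / (1 - Q ^ N))) \<longlonglongrightarrow>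
       - (of_real pi * \<i> - 2 * of_real pi * \<i> / (1 - 0))"
    using Q by (intro tendsto_intros LIMSEQ_power_zero) auto
  ultimately have "(\<lambda>N. of_real pi * cot (of_real pi * (of_nat N / z))) \<longlonglongrightarrow>
       - (of_real pi * \<i> - 2 * of_real pi * \<i> / (1 - 0))"
    by (rule Lim_transform_eventually[rotated])
  moreover have "- (of_real pi * \<i> - 2 * of_real pi * \<i> / (1 - 0)) = complex_of_real pi * \<i>" by simp
  ultimately show ?thesis by metis
qed

text \<open>After telescoping in \<open>n\<close>, the sum over nonzero \<open>m\<close> of
  \<open>1 / (m z - N) - 1 / (m z + N)\<close> is the partial fraction series of the cotangent at
  \<open>w = N / z\<close>, with the polar term \<open>1 / w\<close> missing because row 0 is
  absent.\<close>

lemma tele_block_infsum: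
  assumes N: "N > 0"
  shows "infsum (\<lambda>m. \<Sum>n\<in>{- int N<..int N}. tele m n) UNIV =
     - 2 / z * (of_real pi * cot (of_real pi * (of_nat N / z)) - z / of_nat N)"
proof -
  have z0: "z \<noteq> 0" using z by auto
  define w where "w = of_nat N / z"
  define t where "t = (\<lambda>m. \<Sum>n\<in>{- int N<..int N}. tele m n)"
  have ts: "t summable_on UNIV" unfolding t_def
    by (rule has_sum_imp_summable, rule has_sum_sum, simp, rule has_sum_infsum, rule tele_col_summable)
  have t: "t m = 1 / (of_int m * z - of_nat N) - 1 / (of_int m * z + of_nat N)" if "m \<noteq> 0" for m
    using sum_telescope_symmetric_int[of "\<lambda>n::int. 1 / (of_int m * z + of_int n)" N] that
    by (simp add: tele_def t_def)
  have t0: "t 0 = 0" by (simp add: t_def tele_def)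
  have tneg: "t (- m) = t m" for m
  proof (cases "m = 0")
    case False
    have "of_int (- m) * z - of_nat N = - (of_int m * z + of_nat N)"
         "of_int (- m) * z + of_nat N = - (of_int m * z - of_nat N)" by auto
    thus ?thesis using False by (simp only: t neg_equal_0_iff_equal not_False_eq_True divide_minus_right) simp
  qed simp
  have s1: "(\<lambda>i. t (int (Suc i))) summable_on UNIV"
  proof -
    have "t summable_on range (\<lambda>i. int (Suc i))" using ts summable_on_subset_banach by blast
    thus ?thesis by (subst (asm) summable_on_reindex) (auto simp: o_def inj_on_def)
  qed
  have wI: "w \<notin> \<int>"
  proof
    assume "w \<in> \<int>"
    then obtain k :: int where k: "w = of_int k" by (elim Ints_cases)
    have "of_nat N = of_int k * z" using k z0 unfolding w_def by (simp add: field_simps)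
    hence "Im (of_nat N :: complex) = Im (of_int k * z)" by (rule arg_cong)
    hence "k = 0" using z by simp
    thus False using k N z0 by (simp add: w_def)
  qed
  have w0: "w \<noteq> 0" "1 + w \<noteq> 0" "1 - w \<noteq> 0"
    using wI Ints_0 Ints_1 Ints_minus[of 1] by (auto simp: add_eq_0_iff)
  have tw: "inverse (1 + w + of_nat i) - inverse (1 - w + of_nat i) = - z * t (int (Suc i))" for i
  proof -
    define x where "x = (of_nat (Suc i) :: complex)"
    have nz: "x * z + of_nat N \<noteq> 0" "x * z - of_nat N \<noteq> 0"
      using lattice_nonzero[OF z, of "int (Suc i)" "int N"] lattice_nonzero[OF z, of "int (Suc i)" "- int N"]
      by (auto simp: x_def)
    have "1 + w + of_nat i = (x * z + of_nat N) / z" "1 - w + of_nat i = (x * z - of_nat N) / z"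
      using z0 by (auto simp: w_def x_def field_simps)
    hence "inverse (1 + w + of_nat i) - inverse (1 - w + of_nat i) = z / (x * z + of_nat N) - z / (x * z - of_nat N)"
      by (simp add: inverse_divide)
    also have "\<dots> = - z * t (int (Suc i))"
      by (subst t) (simp_all add: x_def right_diff_distrib)
    finally show ?thesis .
  qed
  \<comment> \<open>The Digamma limits at \<open>1 - w\<close> and \<open>1 + w\<close> contain the
    same logarithm, which cancels in the difference.\<close>
  have "(\<lambda>M. (of_real (ln (real M)) - (\<Sum>n<M. inverse (1 - w + of_nat n))) -
             (of_real (ln (real M)) - (\<Sum>n<M. inverse (1 + w + of_nat n)))) \<longlonglongrightarrow> Digamma (1 - w) - Digamma (1 + w)"
    by (intro tendsto_diff Digamma_LIMSEQ w0)
  hence "(\<lambda>M. \<Sum>n<M. inverse (1 + w + of_nat n) - inverse (1 - w + of_nat n)) \<longlonglongrightarrow> Digamma (1 - w) - Digamma (1 + w)"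
    by (simp add: sum_subtractf)
  hence "(\<lambda>i. - z * t (int (Suc i))) sums (Digamma (1 - w) - Digamma (1 + w))"
    by (simp only: sums_def tw)
  from sums_mult[OF this, of "- 1 / z"]
  have "(\<lambda>i. t (int (Suc i))) sums (- 1 / z * (Digamma (1 - w) - Digamma (1 + w)))"
    using z0 by simp
  moreover have "Digamma (1 - w) - Digamma (1 + w) = of_real pi * cot (of_real pi * w) - 1 / w"
    using Digamma_reflection_complex[OF wI] Digamma_plus1[OF w0(1)] by (simp add: add.commute algebra_simps)
  ultimately have "(\<lambda>i. t (int (Suc i))) sums (- 1 / z * (of_real pi * cot (of_real pi * w) - 1 / w))" by simp
  hence val: "((\<lambda>i. t (int (Suc i))) has_sum (- 1 / z * (of_real pi * cot (of_real pi * w) - 1 / w))) UNIV"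
    using has_sum_imp_sums[OF has_sum_infsum[OF s1]] sums_unique2 has_sum_infsum[OF s1] by metis
  define V where "V = - 1 / z * (of_real pi * cot (of_real pi * w) - 1 / w)"
  have B: "((\<lambda>i. t (- int i - 1)) has_sum V) UNIV"
  proof -
    have "t (- int i - 1) = t (int (Suc i))" for i using tneg[of "int (Suc i)"] by (simp add: minus_diff_commute)
    thus ?thesis using val by (simp add: V_def)
  qed
  have "((\<lambda>i. t (int i)) has_sum V) (range Suc)"
    by (subst has_sum_reindex) (use val in \<open>auto simp: o_def V_def\<close>)
  also have "?this \<longleftrightarrow> ((\<lambda>i. t (int i)) has_sum V) UNIV"
  proof (rule has_sum_cong_neutral)
    fix x :: nat assume "x \<in> UNIV - range Suc"
    hence "x = 0" by (metis DiffD2 not0_implies_Suc rangeI)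
    thus "t (int x) = 0" using t0 by simp
  qed auto
  finally have "(t has_sum (V + V)) UNIV" using B by (rule has_sum_int)
  hence "infsum t UNIV = 2 * V" by (simp add: infsumI)
  thus ?thesis by (simp add: t_def V_def w_def)
qed

lemma sum_sq_rows: "infsum (\<lambda>m. infsum (sq m) UNIV) UNIV =
    2 * ((2 * of_real pi * \<i>) ^ 2 * qfun (Phi 1) z)"
proof -
  define g where "g = (\<lambda>m::int. infsum (\<lambda>n::int. 1 / (of_int m * z + of_int n) ^ 2) UNIV)"
  have "(g has_sum zeta_int 2 + 2 * ((2 * of_real pi * \<i>) ^ 2 * qfun (Phi 1) z)) UNIV"
    unfolding g_def using rows_has_sum[OF z, of 2] by simp
  moreover have "((\<lambda>m. if m = 0 then - zeta_int 2 else 0) has_sum (- zeta_int 2)) (UNIV :: int set)"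
    by (rule has_sum_finite_neutralI[of "{0}"]) auto
  ultimately have "((\<lambda>m. g m + (if m = 0 then - zeta_int 2 else 0)) has_sum
      (zeta_int 2 + 2 * ((2 * of_real pi * \<i>) ^ 2 * qfun (Phi 1) z) + - zeta_int 2)) UNIV"
    by (rule has_sum_add)
  moreover have "g m + (if m = 0 then - zeta_int 2 else 0) = infsum (sq m) UNIV" for m
    by (auto simp: g_def zeta_int_def sq_def [abs_def])
  ultimately show ?thesis by (simp add: infsumI)
qed

text \<open>Column \<open>n\<close> of the lattice of \<open>z\<close> is, up to the factor
  \<open>z\<^sup>2\<close>, row \<open>-n\<close> of the lattice of \<open>-1 / z\<close>. The
  entries with \<open>m = 0\<close> add up to \<open>zeta_int 2\<close>, which is
  subtracted.\<close>

lemma sum_sq_cols: "((\<lambda>n. infsum (\<lambda>m. sq m n) UNIV) has_sum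
    ((zeta_int 2 + 2 * ((2 * of_real pi * \<i>) ^ 2 * qfun (Phi 1) (- 1 / z))) / z ^ 2 - zeta_int 2)) UNIV"
proof -
  have z0: "z \<noteq> 0" using z by auto
  define g where "g = (\<lambda>m::int. infsum (\<lambda>n::int. 1 / (of_int m * (- 1 / z) + of_int n) ^ 2) UNIV)"
  define G where "G = zeta_int 2 + 2 * ((2 * of_real pi * \<i>) ^ 2 * qfun (Phi 1) (- 1 / z))"
  have "(g has_sum G) UNIV"
    unfolding g_def G_def using rows_has_sum[OF Im_minus_inverse_pos[OF z], of 2] by simp
  hence 1: "((\<lambda>m. g m * (1 / z ^ 2)) has_sum G * (1 / z ^ 2)) UNIV" by (rule has_sum_cmult_left)
  have col: "((\<lambda>m. 1 / (of_int m * z + of_int n) ^ 2) has_sum g (- n) * (1 / z ^ 2)) UNIV" for n :: int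
  proof -
    have "(\<lambda>m. sq m n + (if m = 0 then 1 / of_int n ^ 2 else 0)) summable_on UNIV"
      by (intro summable_on_add sq_col_summable finite_nonzero_values_imp_summable_on) auto
    moreover have "(\<lambda>m. sq m n + (if m = 0 then 1 / of_int n ^ 2 else 0)) = (\<lambda>m. 1 / (of_int m * z + of_int n) ^ 2)"
      by (auto simp: sq_def)
    ultimately have s: "(\<lambda>m. 1 / (of_int m * z + of_int n) ^ 2) summable_on UNIV" by simp
    have "1 / (of_int m * z + of_int n) ^ 2 = 1 / (of_int (- n) * (- 1 / z) + of_int m) ^ 2 * (1 / z ^ 2)" for m :: int
    proof -
      have "of_int m * z + of_int n = z * (of_int (- n) * (- 1 / z) + of_int m)" using z0 by (simp add: field_simps)
      thus ?thesis by (simp add: power_mult_distrib)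
    qed
    hence "infsum (\<lambda>m. 1 / (of_int m * z + of_int n) ^ 2) UNIV = g (- n) * (1 / z ^ 2)"
      unfolding g_def by (simp only: infsum_cmult_left')
    thus ?thesis using has_sum_infsum[OF s] by simp
  qed
  have 2: "((\<lambda>n. g (- n) * (1 / z ^ 2)) has_sum G / z ^ 2) UNIV"
  proof -
    have "((\<lambda>m. g m * (1 / z ^ 2)) has_sum G / z ^ 2) UNIV = ((\<lambda>n. g (- n) * (1 / z ^ 2)) has_sum G / z ^ 2) UNIV"
      by (rule has_sum_reindex_bij_witness[where i = uminus and j = uminus]) auto
    thus ?thesis using 1 by simp
  qed
  have "(\<lambda>n::int. 1 / of_int n ^ 2 :: complex) summable_on UNIV"
  proof -
    \<comment> \<open>\<open>infsum\<close> of a family that is not summable is 0, so the nonzero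
      value \<open>pi\<^sup>2 / 3\<close> proves summability.\<close>
    have "zeta_int 2 \<noteq> 0" using zeta_int_recurrence(1) by auto
    thus ?thesis unfolding zeta_int_def using infsum_not_exists by blast
  qed
  hence 3: "((\<lambda>n::int. 1 / of_int n ^ 2) has_sum zeta_int 2) UNIV" unfolding zeta_int_def by (rule has_sum_infsum)
  have "((\<lambda>n. g (- n) * (1 / z ^ 2) - 1 / of_int n ^ 2) has_sum (G / z ^ 2 - zeta_int 2)) UNIV"
    by (rule has_sum_diff[OF 2 3])
  moreover have "infsum (\<lambda>m. sq m n) UNIV = g (- n) * (1 / z ^ 2) - 1 / of_int n ^ 2" for n
  proof (rule infsumI)
    have "((\<lambda>m. if m = 0 then 1 / of_int n ^ 2 else 0) has_sum (1 / of_int n ^ 2)) (UNIV :: int set)"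
      by (rule has_sum_finite_neutralI[of "{0}"]) auto
    from has_sum_diff[OF col[of n] this]
    have "((\<lambda>m::int. 1 / (of_int m * z + of_int n) ^ 2 - (if m = 0 then 1 / of_int n ^ 2 else 0)) has_sum
       (g (- n) * (1 / z ^ 2) - 1 / of_int n ^ 2)) UNIV" .
    moreover have "(\<lambda>m::int. 1 / (of_int m * z + of_int n) ^ 2 - (if m = 0 then 1 / of_int n ^ 2 else 0)) = (\<lambda>m. sq m n)"
      by (auto simp: sq_def)
    ultimately show "((\<lambda>m. sq m n) has_sum (g (- n) * (1 / z ^ 2) - 1 / of_int n ^ 2)) UNIV" by simp
  qed
  ultimately show ?thesis by (simp add: G_def)
qed

lemma weight_2_transformation:
  "(zeta_int 2 + 2 * ((2 * of_real pi * \<i>) ^ 2 * qfun (Phi 1) (- 1 / z))) / z ^ 2 =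
    zeta_int 2 + 2 * ((2 * of_real pi * \<i>) ^ 2 * qfun (Phi 1) z) - 2 * of_real pi * \<i> / z"
proof -
  define G' where "G' = (zeta_int 2 + 2 * ((2 * of_real pi * \<i>) ^ 2 * qfun (Phi 1) (- 1 / z))) / z ^ 2 - zeta_int 2"
  define E where "E = infsum (\<lambda>(m, n). err m n) (UNIV \<times> UNIV)"
  have E0: "E = infsum (\<lambda>m. infsum (err m) UNIV) UNIV"
    unfolding E_def using infsum_Sigma'_banach[OF err_summable] by simp
  have rows: "infsum (err m) UNIV = infsum (sq m) UNIV" for m
  proof -
    have "err m = (\<lambda>n. sq m n - tele m n)" by (auto simp: err_def)
    moreover have "tele m summable_on UNIV"
    proof -
      have "(\<lambda>n. sq m n - err m n) summable_on UNIV"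
        by (intro summable_on_diff sq_row_summable err_row_summable)
      thus ?thesis by (simp add: err_def)
    qed
    ultimately show ?thesis using infsum_diff[OF sq_row_summable[of m]] tele_row[of m] by simp
  qed
  have E1: "E = 2 * ((2 * of_real pi * \<i>) ^ 2 * qfun (Phi 1) z)" unfolding E0 rows by (rule sum_sq_rows)
  have E2: "E = infsum (\<lambda>n. infsum (\<lambda>m. err m n) UNIV) UNIV"
    unfolding E_def using infsum_Sigma'_banach[OF err_summable] infsum_swap_banach[OF err_summable] by simp
  have colsum: "(\<lambda>n. infsum (\<lambda>m. err m n) UNIV) summable_on UNIV"
  proof -
    have "(\<lambda>(n, m). err m n) summable_on UNIV \<times> UNIV"
      using err_summable by (subst summable_on_swap) (simp add: case_prod_unfold)
    from summable_on_Sigma_banach[OF this] show ?thesis by simp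
  qed
  have lim1: "(\<lambda>N. \<Sum>n\<in>{- int N<..int N}. infsum (\<lambda>m. err m n) UNIV) \<longlonglongrightarrow> E"
    unfolding E2 by (rule tendsto_symmetric_sum_int[OF colsum])
  have lim2: "(\<lambda>N. \<Sum>n\<in>{- int N<..int N}. infsum (\<lambda>m. sq m n) UNIV) \<longlonglongrightarrow> G'"
    using tendsto_symmetric_sum_int[OF has_sum_imp_summable[OF sum_sq_cols]] infsumI[OF sum_sq_cols]
    by (simp add: G'_def)
  have split: "infsum (\<lambda>m. sq m n) UNIV - infsum (\<lambda>m. err m n) UNIV = infsum (\<lambda>m. tele m n) UNIV" for n
    by (subst infsum_diff[OF sq_col_summable err_col_summable, symmetric]) (simp add: err_def)
  have "(\<lambda>N. \<Sum>n\<in>{- int N<..int N}. infsum (\<lambda>m. tele m n) UNIV) \<longlonglongrightarrow> G' - E"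
    using tendsto_diff[OF lim2 lim1] by (simp add: sum_subtractf[symmetric] split)
  \<comment> \<open>Over finitely many columns the telescoping part may be summed in
    \<open>n\<close> first; the limit of these blocks is the anomaly.\<close>
  moreover have "(\<Sum>n\<in>{- int N<..int N}. infsum (\<lambda>m. tele m n) UNIV) =
      infsum (\<lambda>m. \<Sum>n\<in>{- int N<..int N}. tele m n) UNIV" for N
    by (intro infsumI[symmetric] has_sum_sum has_sum_infsum tele_col_summable) auto
  ultimately have lim3: "(\<lambda>N. infsum (\<lambda>m. \<Sum>n\<in>{- int N<..int N}. tele m n) UNIV) \<longlonglongrightarrow> G' - E" by simp
  have "(\<lambda>N. - 2 / z * (of_real pi * cot (of_real pi * (of_nat N / z)) - z * (1 / of_nat N))) \<longlonglongrightarrow>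
      - 2 / z * (of_real pi * \<i> - z * 0)"
    by (intro tendsto_intros cot_N_tendsto lim_1_over_n)
  moreover have "eventually (\<lambda>N. - 2 / z * (of_real pi * cot (of_real pi * (of_nat N / z)) - z * (1 / of_nat N)) =
     infsum (\<lambda>m. \<Sum>n\<in>{- int N<..int N}. tele m n) UNIV) sequentially"
    using eventually_gt_at_top[of 0] by eventually_elim (simp only: tele_block_infsum, simp)
  ultimately have "(\<lambda>N. infsum (\<lambda>m. \<Sum>n\<in>{- int N<..int N}. tele m n) UNIV) \<longlonglongrightarrow> - 2 / z * (of_real pi * \<i> - z * 0)"
    by (rule Lim_transform_eventually)
  with lim3 have "G' - E = - 2 / z * (of_real pi * \<i> - z * 0)" using LIMSEQ_unique by blast
  thus ?thesis unfolding E1 G'_def by (simp add: algebra_simps)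
qed

end

lemma qconvergent_E2: "qconvergent E2"
proof -
  have "E2 = fps_const 1 + fps_const (-24) * Phi 1" 
    by (simp add: E2_def numeral_fps_const flip: fps_const_neg)
  thus ?thesis
    using qconvergent_add qconvergent_mult qconvergent_fps_const qconvergent_Phi by metis
qed

lemma qfun_E2:
  assumes "Im z > 0"
  shows "qfun E2 z = 1 - 24 * qfun (Phi 1) z"
proof -
  have "E2 = fps_const 1 + fps_const (-24) * Phi 1" 
    by (simp add: E2_def numeral_fps_const flip: fps_const_neg)
  hence "qfun E2 z = qfun (fps_const 1) z + qfun (fps_const (-24)) z * qfun (Phi 1) z"
    using assms by (metis qfun_add qfun_mult qconvergent_mult qconvergent_fps_const qconvergent_Phi)
  thus ?thesis by (simp only: qfun_fps_const) simp
qed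

text \<open>\<open>2 (2 pi i)\<^sup>2\<close> is \<open>-24\<close> times
  \<open>zeta_int 2 = pi\<^sup>2 / 3\<close>, so dividing \<open>weight_2_transformation\<close> by
  \<open>zeta_int 2\<close> produces \<open>1 - 24 Phi 1\<close> and turns \<open>- 2 pi i z\<close>
  into \<open>6 z / (pi i)\<close>.\<close>

theorem E2_transformation:
  assumes z: "Im z > 0"
  shows "qfun E2 (- 1 / z) = z ^ 2 * qfun E2 z + 6 * z / (of_real pi * \<i>)"
proof -
  interpret eisenstein_weight_2 z by unfold_locales (rule z)
  have z0: "z \<noteq> 0" using z by auto
  define p where "p = complex_of_real pi"
  have p0: "p \<noteq> 0" by (simp add: p_def)
  have Z: "zeta_int 2 = p ^ 2 / 3" using zeta_int_recurrence(1) by (simp add: p_def field_simps)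
  define a b where "a = qfun (Phi 1) (- 1 / z)" and "b = qfun (Phi 1) z"
  have "(p ^ 2 / 3 + 2 * ((2 * p * \<i>) ^ 2 * a)) / z ^ 2 = p ^ 2 / 3 + 2 * ((2 * p * \<i>) ^ 2 * b) - 2 * p * \<i> / z"
    using weight_2_transformation unfolding Z p_def[symmetric] a_def[symmetric] b_def[symmetric] .
  moreover have "(2 * p * \<i>) ^ 2 = - 4 * p ^ 2" by (simp add: power_mult_distrib)
  ultimately have "(p ^ 2 / 3 * (1 - 24 * a)) / z ^ 2 = p ^ 2 / 3 * (1 - 24 * b) - 2 * p * \<i> / z"
    by (simp add: algebra_simps)
  hence "z ^ 2 * ((p ^ 2 / 3 * (1 - 24 * a)) / z ^ 2) = z ^ 2 * (p ^ 2 / 3 * (1 - 24 * b) - 2 * p * \<i> / z)"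
    by (rule arg_cong)
  moreover have "z ^ 2 * (x / z ^ 2) = x" for x using z0 by simp
  moreover have "z ^ 2 * (p ^ 2 / 3 * (1 - 24 * b) - 2 * p * \<i> / z) =
      p ^ 2 / 3 * (z ^ 2 * (1 - 24 * b)) - 2 * p * \<i> * z"
    using z0 by (simp add: right_diff_distrib power2_eq_square mult_ac)
  ultimately have "p ^ 2 / 3 * (1 - 24 * a) = p ^ 2 / 3 * (z ^ 2 * (1 - 24 * b)) - 2 * p * \<i> * z"
    by simp
  moreover have "p ^ 2 / 3 * (6 * z / (p * \<i>)) = - (2 * p * \<i> * z)"
    using p0 by (simp add: field_simps power2_eq_square)
  ultimately have "p ^ 2 / 3 * (1 - 24 * a) = p ^ 2 / 3 * (z ^ 2 * (1 - 24 * b) + 6 * z / (p * \<i>))"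
    by (simp only: distrib_left diff_conv_add_uminus)
  hence "1 - 24 * a = z ^ 2 * (1 - 24 * b) + 6 * z / (p * \<i>)"
    using p0 by simp
  thus ?thesis using qfun_E2[OF z] qfun_E2[OF Im_minus_inverse_pos[OF z]] by (simp add: a_def b_def p_def)
qed

subsection \<open>Integrality\<close>

text \<open>The reduced denominator divides every other denominator. In this form the closure
  properties amount to multiplying denominators.\<close>

lemma l_integral_rat_iff:
  assumes "prime l"
  shows "l_integral_rat l r \<longleftrightarrow> (\<exists>a b::int. coprime b (int l) \<and> r = of_int a / of_int b)"
proof
  assume "l_integral_rat l r"
  thus "\<exists>a b::int. coprime b (int l) \<and> r = of_int a / of_int b"
    unfolding l_integral_rat_def by (metis prod.collapse quotient_of_div)
next
  assume "\<exists>a b::int. coprime b (int l) \<and> r = of_int a / of_int b"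
  then obtain a b :: int where ab: "coprime b (int l)" "r = of_int a / of_int b" by blast
  have b0: "b \<noteq> 0"
  proof
    assume "b = 0"
    hence "is_unit (int l)" using ab(1) by simp
    thus False using prime_gt_1_nat[OF assms] by simp
  qed
  obtain p q where pq: "quotient_of r = (p, q)" by (cases "quotient_of r")
  note pq' = quotient_of_denom_pos[OF pq] quotient_of_coprime[OF pq] quotient_of_div[OF pq]
  have "of_int (p * b) = (of_int (a * q) :: rat)"
    using ab(2) pq'(1,3) b0 by (simp add: field_simps)
  hence "p * b = a * q" by (simp only: of_int_eq_iff)
  hence "q dvd p * b" by simp
  hence "q dvd b" using pq'(2) by (metis coprime_commute coprime_dvd_mult_right_iff)
  thus "l_integral_rat l r" using ab(1) pq coprime_divisors[of q b "int l" "int l"]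
    by (auto simp: l_integral_rat_def)
qed

lemma l_integral_rat_of_int: "prime l \<Longrightarrow> l_integral_rat l (of_int a)"
  unfolding l_integral_rat_iff by (intro exI[of _ a] exI[of _ 1]) simp

lemma l_integral_rat_of_nat: "prime l \<Longrightarrow> l_integral_rat l (of_nat a)"
  using l_integral_rat_of_int[of l "int a"] by simp

lemma l_integral_rat_mult:
  assumes "prime l" "l_integral_rat l r" "l_integral_rat l s"
  shows "l_integral_rat l (r * s)"
proof -
  obtain a b c d :: int where "coprime b (int l)" "r = of_int a / of_int b"
     "coprime d (int l)" "s = of_int c / of_int d"
    using assms by (auto simp: l_integral_rat_iff)
  thus ?thesis unfolding l_integral_rat_iff[OF assms(1)]
    by (intro exI[of _ "a * c"] exI[of _ "b * d"]) simp
qed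

lemma l_integral_rat_add:
  assumes "prime l" "l_integral_rat l r" "l_integral_rat l s"
  shows "l_integral_rat l (r + s)"
proof -
  obtain a b c d :: int where *: "coprime b (int l)" "r = of_int a / of_int b"
     "coprime d (int l)" "s = of_int c / of_int d"
    using assms by (auto simp: l_integral_rat_iff)
  have "\<not> is_unit (int l)" using prime_gt_1_nat[OF assms(1)] by simp
  hence "b \<noteq> 0" "d \<noteq> 0" using * by auto
  thus ?thesis unfolding l_integral_rat_iff[OF assms(1)] using *
    by (intro exI[of _ "a * d + c * b"] exI[of _ "b * d"]) (simp add: field_simps)
qed

lemma l_integral_rat_sum:
  assumes "prime l" "\<And>i. i \<in> I \<Longrightarrow> l_integral_rat l (f i)"
  shows "l_integral_rat l (sum f I)"
proof -
  have "l_integral_rat l 0" using l_integral_rat_of_int[OF assms(1), of 0] by simp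
  thus ?thesis using assms
    by (induction I rule: infinite_finite_induct) (auto intro: l_integral_rat_add)
qed

lemma l_integral_rat_inverse:
  assumes "prime l" "\<not> l dvd n"
  shows "l_integral_rat l (1 / of_nat n)"
proof -
  have "coprime (int n) (int l)"
    using prime_imp_coprime_nat[OF assms] by (simp add: coprime_commute)
  thus ?thesis unfolding l_integral_rat_iff[OF assms(1)]
    by (intro exI[of _ 1] exI[of _ "int n"]) simp
qed

definition nice_fps :: "nat \<Rightarrow> rat fps \<Rightarrow> bool" where
  "nice_fps l F \<longleftrightarrow> (\<forall>n. l_integral_rat l (fps_nth F n)) \<and> bounded_denominators F"

lemma good_modform_iff: "good_modform l b F \<longleftrightarrow> modular_form b F \<and> nice_fps l F"
  by (auto simp: good_modform_def nice_fps_def)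

lemma nice_fps_const:
  assumes "prime l" "l_integral_rat l c"
  shows "nice_fps l (fps_const c)"
proof -
  have "l_integral_rat l 0" using l_integral_rat_of_int[OF assms(1), of 0] by simp
  moreover have "bounded_denominators (fps_const c)"
  proof -
    obtain p q where pq: "quotient_of c = (p, q)" by (cases "quotient_of c")
    have "of_int q * c = of_int p"
      using quotient_of_div[OF pq] quotient_of_denom_pos[OF pq] by simp
    thus ?thesis unfolding bounded_denominators_def
      using quotient_of_denom_pos[OF pq] by (intro exI[of _ q]) auto
  qed
  ultimately show ?thesis using assms by (auto simp: nice_fps_def)
qed

lemma nice_fps_add:
  assumes "prime l" "nice_fps l F" "nice_fps l G"
  shows "nice_fps l (F + G)"
proof -
  obtain D D' :: int where D: "D > 0" "\<forall>n. of_int D * fps_nth F n \<in> \<int>" "D' > 0" "\<forall>n. of_int D' * fps_nth G n \<in> \<int>"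
    using assms by (auto simp: nice_fps_def bounded_denominators_def)
  have "of_int (D * D') * fps_nth (F + G) n \<in> \<int>" for n
  proof -
    have "of_int (D * D') * fps_nth (F + G) n = of_int D' * (of_int D * fps_nth F n) + of_int D * (of_int D' * fps_nth G n)"
      by (simp add: algebra_simps)
    also have "\<dots> \<in> \<int>"
      by (rule Ints_add[OF Ints_mult[OF Ints_of_int D(2)[rule_format]] Ints_mult[OF Ints_of_int D(4)[rule_format]]])
    finally show ?thesis .
  qed
  hence "bounded_denominators (F + G)" unfolding bounded_denominators_def
    using D by (intro exI[of _ "D * D'"]) auto
  thus ?thesis using assms by (auto simp: nice_fps_def l_integral_rat_add)
qed

lemma nice_fps_mult:
  assumes "prime l" "nice_fps l F" "nice_fps l G"
  shows "nice_fps l (F * G)"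
proof -
  obtain D D' :: int where D: "D > 0" "\<forall>n. of_int D * fps_nth F n \<in> \<int>" "D' > 0" "\<forall>n. of_int D' * fps_nth G n \<in> \<int>"
    using assms by (auto simp: nice_fps_def bounded_denominators_def)
  have "of_int (D * D') * fps_nth (F * G) n \<in> \<int>" for n
  proof -
    have "of_int (D * D') * fps_nth (F * G) n = (\<Sum>i=0..n. (of_int D * fps_nth F i) * (of_int D' * fps_nth G (n - i)))"
      by (simp add: fps_mult_nth sum_distrib_left mult_ac)
    also have "\<dots> \<in> \<int>" by (rule Ints_sum, rule Ints_mult[OF D(2)[rule_format] D(4)[rule_format]])
    finally show ?thesis .
  qed
  hence "bounded_denominators (F * G)" unfolding bounded_denominators_def
    using D by (intro exI[of _ "D * D'"]) auto
  thus ?thesis using assms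
    by (auto simp: nice_fps_def fps_mult_nth intro!: l_integral_rat_sum l_integral_rat_mult)
qed

lemma nice_fps_of_int_coeffs:
  assumes "prime l" "\<And>n. fps_nth F n \<in> \<int>"
  shows "nice_fps l F"
  using assms l_integral_rat_of_int[OF assms(1)]
  by (auto simp: nice_fps_def bounded_denominators_def elim!: Ints_cases intro!: exI[of _ 1])
    (metis Ints_cases assms(2))

lemma nice_fps_delta_q:
  assumes "prime l" "nice_fps l F"
  shows "nice_fps l (delta_q F)"
proof -
  have "delta_q F $ n = of_nat n * fps_nth F n" for n by (simp add: delta_q_def)
  moreover obtain D :: int where D: "D > 0" "\<forall>n. of_int D * fps_nth F n \<in> \<int>"
    using assms by (auto simp: nice_fps_def bounded_denominators_def)
  moreover have "of_int D * (of_nat n * fps_nth F n) \<in> \<int>" for n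
  proof -
    have "of_int D * (of_nat n * fps_nth F n) = of_nat n * (of_int D * fps_nth F n)" by simp
    also have "\<dots> \<in> \<int>" by (rule Ints_mult[OF Ints_of_nat D(2)[rule_format]])
    finally show ?thesis .
  qed
  ultimately have "bounded_denominators (delta_q F)" unfolding bounded_denominators_def
    by (intro exI[of _ D]) auto
  thus ?thesis using assms
    by (auto simp: nice_fps_def delta_q_def intro!: l_integral_rat_mult l_integral_rat_of_nat)
qed

lemma nice_fps_Phi: "prime l \<Longrightarrow> nice_fps l (Phi j)"
  by (rule nice_fps_of_int_coeffs) (auto simp: Phi_def)

lemma nice_fps_E2: "prime l \<Longrightarrow> nice_fps l E2"
  by (rule nice_fps_of_int_coeffs) (auto simp: E2_def Phi_def numeral_fps_const)

subsection \<open>The filtered ring of quasimodular forms\<close>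

lemma delta_q_add: "delta_q (F + G) = delta_q F + delta_q G"
  by (simp add: delta_q_altdef algebra_simps)

lemma delta_q_mult: "delta_q (F * G) = delta_q F * G + F * delta_q G"
  by (simp add: delta_q_altdef algebra_simps)

lemma delta_q_power: "delta_q (F ^ n) = of_nat n * F ^ (n - 1) * delta_q F"
  by (simp add: delta_q_altdef fps_deriv_power algebra_simps fps_of_nat)

text \<open>Differentiating \<open>F (-1 / z) = z ^ b F z\<close> leaves the extra term
  \<open>b z ^ (b + 1) F / (2 pi i)\<close>; the anomaly \<open>12 z / (2 pi i)\<close> of
  \<open>E2\<close> cancels it exactly with the factor \<open>b / 12\<close>.\<close>

lemma modular_form_serre_derivative:
  assumes F: "modular_form b F"
  shows "modular_form (b + 2) (delta_q F + fps_const (- of_nat b / 12) * (E2 * F))"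
  unfolding modular_form_iff
proof (intro conjI allI impI)
  have c: "qconvergent F" using F by (simp add: modular_form_iff)
  note conv = qconvergent_E2 qconvergent_fps_const qconvergent_delta_q[OF c] c
  show "qconvergent (delta_q F + fps_const (- of_nat b / 12) * (E2 * F))"
    by (intro qconvergent_add qconvergent_mult conv)
  have val: "qfun (delta_q F + fps_const (- of_nat b / 12) * (E2 * F)) z =
     qfun (delta_q F) z - of_nat b / 12 * (qfun E2 z * qfun F z)" if "Im z > 0" for z
    using that conv by (simp add: qfun_add qfun_mult qconvergent_mult qfun_fps_const of_rat_divide of_rat_minus)
  have tr: "qfun F (- 1 / z) = z ^ b * qfun F z" if "Im z > 0" for z
    using F that by (simp add: modular_form_iff)
  fix z :: complex assume z: "Im z > 0"
  have z0: "z \<noteq> 0" using z by auto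
  define p where "p = 2 * complex_of_real pi * \<i>"
  have p0: "p \<noteq> 0" by (simp add: p_def)
  define d d' f where "d = qfun (delta_q F) z" and "d' = qfun (delta_q F) (- 1 / z)" and "f = qfun F z"
  have "2 * of_real pi * \<i> * qfun (delta_q F) (- 1 / z) / z\<^sup>2 =
     of_nat b * z ^ (b - 1) * f + z ^ b * (2 * of_real pi * \<i> * qfun (delta_q F) z)"
    by (rule DERIV_unique_halfplane[OF tr z has_field_derivative_qfun_inversion[OF c z]])
       (auto intro!: derivative_eq_intros has_field_derivative_qfun c z simp: f_def)
  hence "p * d' / z\<^sup>2 = of_nat b * z ^ (b - 1) * f + z ^ b * (p * d)"
    by (simp add: p_def d_def d'_def)
  hence "z\<^sup>2 / p * (p * d' / z\<^sup>2) = z\<^sup>2 / p * (of_nat b * z ^ (b - 1) * f + z ^ b * (p * d))" by (rule arg_cong)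
  moreover have "z\<^sup>2 / p * (p * d' / z\<^sup>2) = d'" using z0 p0 by simp
  moreover have "z\<^sup>2 * (of_nat b * z ^ (b - 1)) = of_nat b * z ^ (b + 1)"
    by (cases b) (simp_all add: power2_eq_square)
  ultimately have d': "d' = z ^ (b + 2) * d + of_nat b * z ^ (b + 1) * f / p"
    using p0 by (simp add: field_simps power_add power2_eq_square)
  have e: "qfun E2 (- 1 / z) = z ^ 2 * qfun E2 z + 12 * z / p"
    using E2_transformation[OF z] by (simp add: p_def)
  have "d' - of_nat b / 12 * ((z ^ 2 * qfun E2 z + 12 * z / p) * (z ^ b * f)) =
     z ^ (b + 2) * (d - of_nat b / 12 * (qfun E2 z * f))"
    unfolding d' using p0 by (simp add: field_simps power_add power2_eq_square)
  thus "qfun (delta_q F + fps_const (- of_nat b / 12) * (E2 * F)) (- 1 / z) =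
       z ^ (b + 2) * qfun (delta_q F + fps_const (- of_nat b / 12) * (E2 * F)) z"
    unfolding val[OF z] val[OF Im_minus_inverse_pos[OF z]] e tr[OF z] d_def d'_def f_def .
qed

text \<open>One of Ramanujan's identities in disguise: the form is classically \<open>- E_4\<close>.
  Its modularity is read off by differentiating the law of \<open>E2\<close>, without comparison to
  an Eisenstein series.\<close>

lemma modular_form_delta_E2: "modular_form 4 (fps_const 12 * delta_q E2 + fps_const (-1) * (E2 * E2))"
  unfolding modular_form_iff
proof (intro conjI allI impI)
  note conv = qconvergent_E2 qconvergent_fps_const qconvergent_delta_q[OF qconvergent_E2]
  let ?D = "fps_const 12 * delta_q E2 + fps_const (-1) * (E2 * E2)"
  show "qconvergent ?D"
    by (intro qconvergent_add qconvergent_mult conv)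
  have val: "qfun ?D z = 12 * qfun (delta_q E2) z - qfun E2 z * qfun E2 z" if "Im z > 0" for z
    using that conv
    by (simp add: qfun_add qfun_mult qconvergent_mult qfun_fps_const of_rat_minus del: fps_const_neg)
  fix z :: complex assume z: "Im z > 0"
  have z0: "z \<noteq> 0" using z by auto
  define p where "p = 2 * complex_of_real pi * \<i>"
  have p0: "p \<noteq> 0" by (simp add: p_def)
  define d d' f where "d = qfun (delta_q E2) z" and "d' = qfun (delta_q E2) (- 1 / z)" and "f = qfun E2 z"
  have e: "qfun E2 (- 1 / z) = z ^ 2 * qfun E2 z + 12 * z / p" if "Im z > 0" for z
    using E2_transformation[OF that] by (simp add: p_def)
  have "2 * of_real pi * \<i> * qfun (delta_q E2) (- 1 / z) / z\<^sup>2 =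
     2 * z * f + z ^ 2 * (2 * of_real pi * \<i> * qfun (delta_q E2) z) + 12 / p"
    by (rule DERIV_unique_halfplane[OF e z has_field_derivative_qfun_inversion[OF qconvergent_E2 z]])
       (auto intro!: derivative_eq_intros has_field_derivative_qfun qconvergent_E2 z simp: f_def p0)
  hence "p * d' / z\<^sup>2 = 2 * z * f + z ^ 2 * (p * d) + 12 / p"
    by (simp add: p_def d_def d'_def)
  hence "z\<^sup>2 / p * (p * d' / z\<^sup>2) = z\<^sup>2 / p * (2 * z * f + z ^ 2 * (p * d) + 12 / p)" by (rule arg_cong)
  moreover have "z\<^sup>2 / p * (p * d' / z\<^sup>2) = d'" using z0 p0 by simp
  ultimately have d': "d' = z ^ 4 * d + 2 * z ^ 3 * f / p + 12 * z ^ 2 / p ^ 2"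
    using p0 by (simp add: field_simps power2_eq_square power3_eq_cube power4_eq_xxxx)
  have "12 * d' - (z ^ 2 * f + 12 * z / p) * (z ^ 2 * f + 12 * z / p) = z ^ 4 * (12 * d - f * f)"
    unfolding d' using p0 by (simp add: field_simps power2_eq_square power3_eq_cube power4_eq_xxxx)
  thus "qfun ?D (- 1 / z) = z ^ 4 * qfun ?D z"
    unfolding val[OF z] val[OF Im_minus_inverse_pos[OF z]] e[OF z] d_def d'_def f_def .
qed

lemma Xset_induct [consumes 1, case_names zero step]:
  assumes "G \<in> Xset l k" "P 0"
    and "\<And>a b F H. 2 * a + b \<le> k \<Longrightarrow> good_modform l b F \<Longrightarrow> P H \<Longrightarrow> P (E2 ^ a * F + H)"
  shows "P G"
proof -
  obtain xs :: "(nat \<times> nat \<times> rat fps) list" where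
    xs: "\<forall>(a, b, F) \<in> set xs. 2 * a + b \<le> k \<and> good_modform l b F" "G = (\<Sum>(a, b, F) \<leftarrow> xs. E2 ^ a * F)"
    using assms(1) by (auto simp: Xset_def)
  from xs(1) have "P (\<Sum>(a, b, F) \<leftarrow> xs. E2 ^ a * F)"
    by (induction xs) (use assms(2,3) in auto)
  thus ?thesis using xs by simp
qed

lemma Xset_0: "0 \<in> Xset l k"
  unfolding Xset_def by (auto intro!: exI[of _ "[]"])

lemma Xset_gen: "2 * a + b \<le> k \<Longrightarrow> good_modform l b F \<Longrightarrow> E2 ^ a * F \<in> Xset l k"
  unfolding Xset_def by (auto intro!: exI[of _ "[(a, b, F)]"])

lemma Xset_add:
  assumes "F \<in> Xset l k" "G \<in> Xset l k" shows "F + G \<in> Xset l k"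
proof -
  obtain xs ys :: "(nat \<times> nat \<times> rat fps) list" where
    "\<forall>(a, b, F) \<in> set xs. 2 * a + b \<le> k \<and> good_modform l b F" "F = (\<Sum>(a, b, F) \<leftarrow> xs. E2 ^ a * F)"
    "\<forall>(a, b, F) \<in> set ys. 2 * a + b \<le> k \<and> good_modform l b F" "G = (\<Sum>(a, b, F) \<leftarrow> ys. E2 ^ a * F)"
    using assms by (auto simp: Xset_def)
  thus ?thesis unfolding Xset_def by (intro CollectI exI[of _ "xs @ ys"]) auto
qed

lemma Xset_mono: "F \<in> Xset l k \<Longrightarrow> k \<le> k' \<Longrightarrow> F \<in> Xset l k'"
  unfolding Xset_def by fastforce

lemma Xset_sum: "(\<And>i. i \<in> I \<Longrightarrow> f i \<in> Xset l k) \<Longrightarrow> sum f I \<in> Xset l k"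
  by (induction I rule: infinite_finite_induct) (auto intro: Xset_0 Xset_add)

section \<open>Closure properties and Eisenstein series in \<open>Xset\<close> at a fixed
  prime\<close>

context
  fixes l :: nat
  assumes l: "prime l"
begin

lemma good_modform_mult:
  "good_modform l a F \<Longrightarrow> good_modform l b G \<Longrightarrow> good_modform l (a + b) (F * G)"
  by (auto simp: good_modform_iff modular_form_mult nice_fps_mult[OF l])

lemma good_modform_const: "l_integral_rat l c \<Longrightarrow> good_modform l 0 (fps_const c)"
  by (auto simp: good_modform_iff modular_form_fps_const nice_fps_const[OF l])

lemma Xset_mult:
  assumes "F \<in> Xset l k" "G \<in> Xset l k'" shows "F * G \<in> Xset l (k + k')"
  using assms(1)
proof (induction rule: Xset_induct)
  case zero
  thus ?case by (simp add: Xset_0)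
next
  case (step a b F H)
  have "E2 ^ a * F * G \<in> Xset l (k + k')"
    using assms(2)
  proof (induction rule: Xset_induct)
    case zero
    thus ?case by (simp add: Xset_0)
  next
    case (step a' b' F' H')
    have "E2 ^ a * F * (E2 ^ a' * F' + H') = E2 ^ (a + a') * (F * F') + E2 ^ a * F * H'"
      by (simp add: algebra_simps power_add)
    also have "\<dots> \<in> Xset l (k + k')"
      using step \<open>2 * a + b \<le> k\<close> \<open>good_modform l b F\<close>
      by (intro Xset_add step.IH Xset_gen[of _ "b + b'"] good_modform_mult) auto
    finally show ?case .
  qed
  thus ?case using step by (simp add: distrib_right Xset_add)
qed

lemma Xset_const: "l_integral_rat l c \<Longrightarrow> fps_const c \<in> Xset l k"
  using Xset_gen[of 0 0 k l "fps_const c"] good_modform_const by simp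

lemma Xset_scale: "l_integral_rat l c \<Longrightarrow> F \<in> Xset l k \<Longrightarrow> fps_const c * F \<in> Xset l k"
  using Xset_mult[OF Xset_const[of c 0], of F k] by simp

lemma Xset_of_int: "of_int c \<in> Xset l k"
  using Xset_const[OF l_integral_rat_of_int[OF l, of c]] by (simp add: fps_of_int)

lemma Xset_of_nat: "of_nat c \<in> Xset l k"
  using Xset_of_int[of "int c"] by simp

lemma Xset_uminus: "F \<in> Xset l k \<Longrightarrow> - F \<in> Xset l k"
  using Xset_mult[OF Xset_of_int[of "-1" 0], of F k] by simp

lemma Xset_diff: "F \<in> Xset l k \<Longrightarrow> G \<in> Xset l k \<Longrightarrow> F - G \<in> Xset l k"
  using Xset_add[OF _ Xset_uminus[of G]] by fastforce

lemma good_modform_1: "good_modform l 0 1"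
  using good_modform_const[of 1] l_integral_rat_of_int[OF l, of 1] by simp

lemma Xset_E2_power: "2 * a \<le> k \<Longrightarrow> E2 ^ a \<in> Xset l k"
  using Xset_gen[OF _ good_modform_1, of a k] by simp

text \<open>On a generator \<open>E2 ^ a * F\<close> both derivatives are replaced:
  \<open>delta_q E2 = (E2\<^sup>2 + D) / 12\<close> and \<open>delta_q F = S + (b / 12) E2 F\<close>
  with modular \<open>D\<close> and \<open>S\<close>. Each piece has weight raised by 2, and 12 is
  invertible at \<open>l > 3\<close>.\<close>

lemma Xset_delta_q:
  assumes l3: "l > 3" and "F \<in> Xset l k"
  shows "delta_q F \<in> Xset l (k + 2)"
  using assms(2)
proof (induction rule: Xset_induct)
  case zero
  thus ?case by (simp add: delta_q_def Xset_0 flip: fps_zero_def)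
next
  case (step a b F H)
  define D where "D = fps_const 12 * delta_q E2 + fps_const (-1) * (E2 * E2)"
  define S where "S = delta_q F + fps_const (- of_nat b / 12) * (E2 * F)"
  have "\<not> l dvd 12"
  proof
    assume "l dvd 12"
    hence "l dvd 2 * 2 * 3" by simp
    hence "l dvd 2 \<or> l dvd 3" using l by (simp only: prime_dvd_mult_iff) auto
    thus False using l3 by (auto dest: dvd_imp_le)
  qed
  note i12 = l_integral_rat_inverse[OF l this]
  have im1: "l_integral_rat l (-1)" and i12': "l_integral_rat l 12"
    using l_integral_rat_of_int[OF l, of "-1"] l_integral_rat_of_int[OF l, of 12] by simp_all
  have ib: "l_integral_rat l (of_nat m / 12)" for m
    using l_integral_rat_mult[OF l l_integral_rat_of_nat[OF l, of m] i12] by simp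
  have ib': "l_integral_rat l (- of_nat m / 12)" for m
    using l_integral_rat_mult[OF l im1 ib[of m]] by simp
  have D: "good_modform l 4 D" unfolding D_def good_modform_iff
    by (intro conjI modular_form_delta_E2 nice_fps_add nice_fps_mult nice_fps_const nice_fps_delta_q
        nice_fps_E2 l im1 i12')
  have S: "good_modform l (b + 2) S" unfolding S_def using \<open>good_modform l b F\<close> unfolding good_modform_iff
    by (intro conjI modular_form_serre_derivative nice_fps_add nice_fps_mult nice_fps_const nice_fps_delta_q
        nice_fps_E2 l ib') auto
  have dE2: "delta_q E2 = fps_const (1 / 12) * (E2 * E2 + D)"
  proof -
    have "E2 * E2 + D = fps_const 12 * delta_q E2" unfolding D_def by (simp flip: fps_const_neg)
    thus ?thesis by (simp add: mult.assoc[symmetric])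
  qed
  have dF: "delta_q F = S + fps_const (of_nat b / 12) * (E2 * F)" unfolding S_def
  proof -
    have "fps_const (- of_nat b / 12) * (E2 * F) + fps_const (of_nat b / 12) * (E2 * F) =
       fps_const (- of_nat b / 12 + of_nat b / 12) * (E2 * F)"
      by (simp only: distrib_right fps_const_add[symmetric])
    thus "delta_q F = delta_q F + fps_const (- of_nat b / 12) * (E2 * F) + fps_const (of_nat b / 12) * (E2 * F)"
      by (simp add: add.assoc)
  qed
  have "delta_q (E2 ^ a * F) \<in> Xset l (k + 2)"
  proof -
    have 1: "fps_const (of_nat a / 12) * (E2 ^ (a + 1) * F) \<in> Xset l (k + 2)"
      using step by (intro Xset_scale ib Xset_gen[of _ b]) auto
    have 2: "fps_const (of_nat a / 12) * (E2 ^ (a - 1) * (D * F)) \<in> Xset l (k + 2)"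
    \<comment> \<open>For \<open>a = 0\<close> the truncated exponent \<open>a - 1\<close> would
      spoil the weight count, but then the coefficient is 0.\<close>
    proof (cases "a = 0")
      case False
      thus ?thesis
        using step by (intro Xset_scale ib Xset_gen[of _ "4 + b"] good_modform_mult D) auto
    qed (simp add: Xset_0)
    have 3: "E2 ^ a * S \<in> Xset l (k + 2)" using step by (intro Xset_gen[of _ "b + 2"] S) auto
    have 4: "fps_const (of_nat b / 12) * (E2 ^ (a + 1) * F) \<in> Xset l (k + 2)"
      using step by (intro Xset_scale ib Xset_gen[of _ b]) auto
    have c: "of_nat a * fps_const (1 / 12) = (fps_const (of_nat a / 12) :: rat fps)"
      by (simp add: fps_of_nat[symmetric])
    have "of_nat a * E2 ^ (a - 1) * delta_q E2 * F = fps_const (of_nat a / 12) * (E2 ^ (a + 1) * F) +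
        fps_const (of_nat a / 12) * (E2 ^ (a - 1) * (D * F))"
      unfolding dE2 c[symmetric] by (cases a) (simp_all add: algebra_simps)
    hence "delta_q (E2 ^ a * F) = fps_const (of_nat a / 12) * (E2 ^ (a + 1) * F) +
        fps_const (of_nat a / 12) * (E2 ^ (a - 1) * (D * F)) + E2 ^ a * S +
        fps_const (of_nat b / 12) * (E2 ^ (a + 1) * F)"
      by (simp add: delta_q_mult delta_q_power dF algebra_simps)
    thus ?thesis using 1 2 3 4 by (simp add: Xset_add)
  qed
  thus ?case using step by (simp add: delta_q_add Xset_add)
qed

text \<open>The recurrence expresses \<open>(k + 1) zeta_int k\<close> by values of index at most
  \<open>k - 2 <= l - 3\<close>, which are \<open>l\<close>-integral by induction. The only division
  that can hurt is by \<open>k + 1 = l\<close>, at the very last step.\<close>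

lemma zeta_int_rational:
  assumes l3: "l > 3" and k: "even k" "k \<ge> 2" "k \<le> l - 1"
  shows "\<exists>r. zeta_int k = (2 * of_real pi * \<i>) ^ k * of_rat r \<and>
     l_integral_rat l (if k = l - 1 then of_nat l * r else r)"
  using k
proof (induction k rule: less_induct)
  case (less k)
  define p where "p = 2 * complex_of_real pi * \<i>"
  have p0: "p \<noteq> 0" by (simp add: p_def)
  have ndvd: "\<not> l dvd m" if "0 < m" "m < l" for m using that by (auto dest: dvd_imp_le)
  show ?case
  proof (cases "k = 2")
    case True
    have Z: "zeta_int 2 = p ^ 2 * of_rat (- 1 / 12)"
      using zeta_int_recurrence(1) by (simp add: p_def power_mult_distrib of_rat_divide of_rat_minus mult.commute)
    have "\<not> l dvd 12"
    proof
      assume "l dvd 12"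
      hence "l dvd 2 * 2 * 3" by simp
      hence "l dvd 2 \<or> l dvd 3" using l by (simp only: prime_dvd_mult_iff) auto
      thus False using l3 by (auto dest: dvd_imp_le)
    qed
    hence "l_integral_rat l (- 1 / 12)"
      using l_integral_rat_mult[OF l l_integral_rat_of_int[OF l, of "-1"] l_integral_rat_inverse[OF l, of 12]] by simp
    thus ?thesis using Z True l3 by (intro exI[of _ "- 1 / 12"]) (auto simp: p_def)
  next
    case False
    hence k4: "k \<ge> 4" using less.prems by (cases "k = 3") auto
    define A where "A = {a\<in>{2..k-2}. even a}"
    have "\<exists>r. zeta_int a = p ^ a * of_rat r \<and> l_integral_rat l r" if "a \<in> A" for a
      using less.IH[of a] that k4 less.prems by (auto simp: A_def p_def)
    then obtain r where r: "\<And>a. a \<in> A \<Longrightarrow> zeta_int a = p ^ a * of_rat (r a)" "\<And>a. a \<in> A \<Longrightarrow> l_integral_rat l (r a)"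
      by metis
    define s where "s = (\<Sum>a\<in>A. r a * r (k - a))"
    have kA: "k - a \<in> A" if "a \<in> A" for a using that less.prems by (auto simp: A_def)
    have si: "l_integral_rat l s" unfolding s_def
      by (intro l_integral_rat_sum l_integral_rat_mult l r kA)
    have "of_nat (k + 1) * zeta_int k = (\<Sum>a\<in>A. zeta_int a * zeta_int (k - a))"
      using zeta_int_recurrence(2)[OF k4 less.prems(1)] by (simp add: A_def)
    also have "\<dots> = (\<Sum>a\<in>A. p ^ k * of_rat (r a * r (k - a)))"
    proof (rule sum.cong)
      fix a assume a: "a \<in> A"
      have "p ^ k = p ^ a * p ^ (k - a)" using a by (auto simp: A_def power_add[symmetric])
      thus "zeta_int a * zeta_int (k - a) = p ^ k * of_rat (r a * r (k - a))"
        using r(1)[OF a] r(1)[OF kA[OF a]] by (simp add: of_rat_mult)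
    qed simp
    also have "\<dots> = p ^ k * of_rat s" by (simp add: s_def of_rat_sum sum_distrib_left)
    finally have eq: "of_nat (k + 1) * zeta_int k = p ^ k * of_rat s" .
    have "zeta_int k = p ^ k * of_rat (s / of_nat (k + 1))"
    proof -
      have "zeta_int k = (of_nat (k + 1) * zeta_int k) / of_nat (k + 1)" by (simp del: of_nat_Suc of_nat_add)
      thus ?thesis unfolding eq by (simp only: of_rat_divide of_rat_of_nat_eq times_divide_eq_right)
    qed
    moreover have "l_integral_rat l (if k = l - 1 then of_nat l * (s / of_nat (k + 1)) else s / of_nat (k + 1))"
    proof (cases "k = l - 1")
      case True
      thus ?thesis using si l3 by (simp add: of_nat_diff)
    next
      case False
      hence "l_integral_rat l (1 / of_nat (k + 1))"
        using less.prems by (intro l_integral_rat_inverse l ndvd) auto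
      from l_integral_rat_mult[OF l si this] show ?thesis using False by simp
    qed
    ultimately show ?thesis unfolding p_def by blast
  qed
qed

lemma eisenstein_constant:
  assumes l3: "l > 3" and k: "even k" "k \<ge> 4" "k \<le> l - 1"
  shows "\<exists>c. modular_form k (fps_const c + Phi (k - 1)) \<and>
     l_integral_rat l (if k = l - 1 then of_nat l * c else c)"
proof -
  obtain r where r: "zeta_int k = (2 * of_real pi * \<i>) ^ k * of_rat r"
     "l_integral_rat l (if k = l - 1 then of_nat l * r else r)"
    using zeta_int_rational[OF l3, of k] k by auto
  \<comment> \<open>Solves \<open>zeta_int k = 2 (2 pi i) ^ k / (k - 1)! c\<close>; apart from
    \<open>r\<close>, only the denominator 2 is introduced.\<close>
  define c where "c = fact (k - 1) * (1 / of_nat 2) * r"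
  have "modular_form k (fps_const c + Phi (k - 1))"
  proof (rule modular_form_eisenstein)
    have "of_rat (fact n) = (fact n :: complex)" for n by (metis of_nat_fact of_rat_of_nat_eq)
    thus "zeta_int k = 2 * ((2 * of_real pi * \<i>) ^ k / fact (k - 1)) * of_rat c"
      unfolding r(1) c_def by (simp add: of_rat_mult of_rat_divide)
  qed (use k in auto)
  moreover have "l_integral_rat l (if k = l - 1 then of_nat l * c else c)"
  proof -
    have "\<not> l dvd 2" using l3 by (auto dest: dvd_imp_le)
    hence "l_integral_rat l (fact (k - 1) * (1 / of_nat 2) * (if k = l - 1 then of_nat l * r else r))"
      using l_integral_rat_of_nat[OF l, of "fact (k - 1)"]
      by (intro l_integral_rat_mult l l_integral_rat_inverse r(2)) simp_all
    thus ?thesis by (auto simp: c_def mult_ac split: if_splits)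
  qed
  ultimately show ?thesis by blast
qed

text \<open>\<open>Phi 1\<close> comes from \<open>E2\<close>, the others from an Eisenstein series
  minus its \<open>l\<close>-integral constant. The bound stops short of \<open>l - 2\<close>, for
  which only \<open>l\<close> times the constant is known to be \<open>l\<close>-integral.\<close>

lemma Xset_Phi:
  assumes l3: "l > 3" and j: "odd j" "j + 1 \<le> l - 3"
  shows "Phi j \<in> Xset l (j + 1)"
proof (cases "j = 1")
  case True
  have "\<not> l dvd 24"
  proof
    assume "l dvd 24"
    hence "l dvd 2 * 2 * 2 * 3" by simp
    hence "l dvd 2 \<or> l dvd 3" using l by (simp only: prime_dvd_mult_iff) auto
    thus False using l3 by (auto dest: dvd_imp_le)
  qed
  hence "fps_const (1 / of_nat 24) * (1 - E2) \<in> Xset l 2"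
    using Xset_E2_power[of 1 2] Xset_E2_power[of 0 2]
    by (intro Xset_scale l_integral_rat_inverse l Xset_diff) auto
  also have "fps_const (1 / of_nat 24) * (1 - E2) = Phi 1"
    by (simp add: E2_def numeral_fps_const mult.assoc[symmetric])
  finally show ?thesis using True by (simp add: numeral_2_eq_2)
next
  case False
  hence "j \<ge> 3" using j by (cases "j = 2"; cases "j = 0") auto
  then obtain c where c: "modular_form (j + 1) (fps_const c + Phi j)" "l_integral_rat l c"
  proof -
    have "j + 1 \<noteq> l - 1" "j + 1 \<le> l - 1" "even (j + 1)" "j + 1 \<ge> 4" using j l3 \<open>j \<ge> 3\<close> by auto
    thus ?thesis using eisenstein_constant[OF l3, of "j + 1"] that by auto
  qed
  have "good_modform l (j + 1) (fps_const c + Phi j)"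
    unfolding good_modform_iff by (intro conjI c nice_fps_add nice_fps_const nice_fps_Phi l)
  from Xset_diff[OF Xset_gen[OF _ this, of 0 "j + 1"] Xset_const[OF c(2), of "j + 1"]]
  show ?thesis by simp
qed

text \<open>Absorbs the multiple of \<open>l\<close> that is left over when the top rank moment is
  divided by its leading coefficient.\<close>

lemma Xset_l_Phi:
  assumes l3: "l > 3"
  shows "of_nat l * Phi (l - 2) \<in> Xset l (l - 1)"
proof -
  have "odd l" using l l3 prime_odd_nat by auto
  have "l \<noteq> 4" using \<open>odd l\<close> by auto
  hence l5: "l \<ge> 5" using l3 by simp
  then obtain c where c: "modular_form (l - 1) (fps_const c + Phi (l - 1 - 1))" "l_integral_rat l (of_nat l * c)"
    using eisenstein_constant[OF l3, of "l - 1"] \<open>odd l\<close> by fastforce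
  have l2: "l - 1 - 1 = l - 2" by simp
  have eq: "fps_const (of_nat l) * (fps_const c + Phi (l - 2)) = fps_const (of_nat l * c) + of_nat l * Phi (l - 2)"
    by (simp add: distrib_left flip: fps_of_nat)
  have "modular_form (0 + (l - 1)) (fps_const (of_nat l) * (fps_const c + Phi (l - 2)))"
    using c(1) unfolding l2 by (intro modular_form_mult modular_form_fps_const)
  hence "good_modform l (l - 1) (fps_const (of_nat l * c) + of_nat l * Phi (l - 2))"
    unfolding good_modform_iff eq
    using nice_fps_mult[OF l nice_fps_const[OF l l_integral_rat_of_nat[OF l, of l]] nice_fps_Phi[OF l, of "l - 2"]]
    by (intro conjI nice_fps_add nice_fps_const l c(2)) (auto simp: fps_of_nat)
  from Xset_diff[OF Xset_gen[OF _ this, of 0 "l - 1"] Xset_const[OF c(2), of "l - 1"]]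
  show ?thesis by simp
qed

end

subsection \<open>Infinite sums and products of formal power series\<close>

lemma fps_mult_nth_cong:
  assumes "\<And>k. k \<le> n \<Longrightarrow> F $ k = F' $ k" "\<And>k. k \<le> n \<Longrightarrow> G $ k = G' $ k"
  shows "(F * G) $ n = (F' * G') $ n"
  unfolding fps_mult_nth using assms by (intro sum.cong) auto

lemma fps_mult_nth_one_cong:
  fixes F G :: "'a :: comm_ring_1 fps"
  assumes "\<And>k. k \<le> n \<Longrightarrow> G $ k = 1 $ k"
  shows "(F * G) $ n = F $ n"
  using fps_mult_nth_cong[of n F F G 1] assms by simp

text \<open>Coefficient \<open>n\<close> uses only the factors 1 to \<open>n\<close>. This is the
  infinite product as soon as factor \<open>i\<close> agrees with 1 below degree \<open>i\<close>,
  which is what \<open>iprod_adm\<close> says; \<open>fps_isum\<close> and \<open>isum_adm\<close>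
  do the same for sums from index 0.\<close>

definition fps_iprod :: "(nat \<Rightarrow> 'a :: comm_ring_1 fps) \<Rightarrow> 'a fps" where
  "fps_iprod g = Abs_fps (\<lambda>n. (\<Prod>i\<in>{1..n}. g i) $ n)"

definition fps_isum :: "(nat \<Rightarrow> 'a :: comm_ring_1 fps) \<Rightarrow> 'a fps" where
  "fps_isum f = Abs_fps (\<lambda>n. (\<Sum>k\<le>n. f k $ n))"

definition iprod_adm :: "(nat \<Rightarrow> 'a :: comm_ring_1 fps) \<Rightarrow> bool" where
  "iprod_adm g \<longleftrightarrow> (\<forall>i n. n < i \<longrightarrow> g i $ n = 1 $ n)"

definition isum_adm :: "(nat \<Rightarrow> 'a :: comm_ring_1 fps) \<Rightarrow> bool" where
  "isum_adm f \<longleftrightarrow> (\<forall>k n. n < k \<longrightarrow> f k $ n = 0)"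

lemma iprod_admI: "(\<And>i n. n < i \<Longrightarrow> g i $ n = 1 $ n) \<Longrightarrow> iprod_adm g"
  by (auto simp: iprod_adm_def)

lemma isum_admI: "(\<And>k n. n < k \<Longrightarrow> f k $ n = 0) \<Longrightarrow> isum_adm f"
  by (auto simp: isum_adm_def)

lemma fps_iprod_nth:
  assumes "iprod_adm g" "n \<le> N"
  shows "fps_iprod g $ n = (\<Prod>i\<in>{1..N}. g i) $ n"
  using assms(2)
proof (induction N rule: dec_induct)
  case base
  show ?case by (simp add: fps_iprod_def)
next
  case (step N)
  have "(\<Prod>i\<in>{1..Suc N}. g i) $ n = ((\<Prod>i\<in>{1..N}. g i) * g (Suc N)) $ n" by simp
  also have "\<dots> = (\<Prod>i\<in>{1..N}. g i) $ n"
    by (rule fps_mult_nth_one_cong) (use assms(1) step in \<open>auto simp: iprod_adm_def\<close>)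
  finally show ?case using step by simp
qed

lemma fps_isum_nth:
  assumes "isum_adm f" "n \<le> N"
  shows "fps_isum f $ n = (\<Sum>k\<le>N. f k $ n)"
proof -
  have "(\<Sum>k\<le>N. f k $ n) = (\<Sum>k\<le>n. f k $ n)"
    using assms by (intro sum.mono_neutral_right) (auto simp: isum_adm_def not_le)
  thus ?thesis by (simp add: fps_isum_def)
qed

lemma fps_iprod_mult:
  assumes "iprod_adm g" "iprod_adm h"
  shows "fps_iprod g * fps_iprod h = fps_iprod (\<lambda>i. g i * h i)"
proof (rule fps_ext)
  fix n
  have "(fps_iprod g * fps_iprod h) $ n = ((\<Prod>i\<in>{1..n}. g i) * (\<Prod>i\<in>{1..n}. h i)) $ n"
    by (rule fps_mult_nth_cong) (auto simp: fps_iprod_nth assms)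
  thus "(fps_iprod g * fps_iprod h) $ n = fps_iprod (\<lambda>i. g i * h i) $ n"
    by (simp add: fps_iprod_def prod.distrib)
qed

lemma fps_iprod_1: "fps_iprod (\<lambda>i. 1) = 1"
  by (simp add: fps_iprod_def fps_eq_iff)

lemma fps_isum_mult_nth:
  assumes "isum_adm f" "isum_adm g"
  shows "(fps_isum f * fps_isum g) $ n = (\<Sum>i\<le>n. \<Sum>j\<le>n. (f i * g j) $ n)"
proof -
  have "(fps_isum f * fps_isum g) $ n = ((\<Sum>i\<le>n. f i) * (\<Sum>j\<le>n. g j)) $ n"
    by (rule fps_mult_nth_cong) (auto simp: fps_isum_nth assms fps_sum_nth)
  also have "(\<Sum>i\<le>n. f i) * (\<Sum>j\<le>n. g j) = (\<Sum>i\<le>n. \<Sum>j\<le>n. f i * g j)"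
    by (simp add: sum_product)
  finally show ?thesis by (simp add: fps_sum_nth)
qed

lemma fps_nth_mult_eq_0:
  fixes F G :: "'a :: comm_ring_1 fps"
  assumes "\<And>m. m < i \<Longrightarrow> F $ m = 0" "\<And>m. m < j \<Longrightarrow> G $ m = 0" "n < i + j"
  shows "(F * G) $ n = 0"
  unfolding fps_mult_nth
proof (rule sum.neutral, intro ballI)
  fix k assume k: "k \<in> {0..n}"
  show "F $ k * G $ (n - k) = 0"
  proof (cases "k < i")
    case False
    hence "n - k < j" using assms(3) k by auto
    thus ?thesis using assms(2) by simp
  qed (use assms(1) in simp)
qed

lemma fps_isum_mult:
  assumes "isum_adm f" "isum_adm g"
  shows "fps_isum f * fps_isum g = fps_isum (\<lambda>s. \<Sum>k\<le>s. f k * g (s - k))"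
proof (rule fps_ext)
  fix n
  have z: "(f i * g j) $ n = 0" if "n < i + j" for i j
    by (rule fps_nth_mult_eq_0[of i _ j]) (use assms that in \<open>auto simp: isum_adm_def\<close>)
  have "(fps_isum f * fps_isum g) $ n = (\<Sum>(i, j)\<in>{..n} \<times> {..n}. (f i * g j) $ n)"
    by (simp add: fps_isum_mult_nth[OF assms] sum.cartesian_product)
  also have "\<dots> = (\<Sum>(s, k)\<in>Sigma {..n} (\<lambda>s. {..s}). (f k * g (s - k)) $ n)"
  \<comment> \<open>Pairs with \<open>i + j > n\<close> contribute nothing to coefficient
    \<open>n\<close>; the others are regrouped by \<open>s = i + j\<close>.\<close>
  proof (rule sum.reindex_bij_witness_not_neutral[where S' = "{(i, j). i \<le> n \<and> j \<le> n \<and> i + j > n}" and T' = "{}"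
       and i = "\<lambda>(s, k). (k, s - k)" and j = "\<lambda>(i, j). (i + j, i)"])
    show "finite {(i, j). i \<le> n \<and> j \<le> n \<and> i + j > n}"
      by (rule finite_subset[of _ "{..n} \<times> {..n}"]) auto
  qed (auto simp: z)
  also have "\<dots> = fps_isum (\<lambda>s. \<Sum>k\<le>s. f k * g (s - k)) $ n"
    by (simp add: fps_isum_def fps_sum_nth sum.Sigma)
  finally show "(fps_isum f * fps_isum g) $ n = fps_isum (\<lambda>s. \<Sum>k\<le>s. f k * g (s - k)) $ n" .
qed

lemma fps_isum_mult_left:
  assumes "isum_adm f"
  shows "F * fps_isum f = fps_isum (\<lambda>k. F * f k)"
proof (rule fps_ext)
  fix n
  have "(F * fps_isum f) $ n = (F * (\<Sum>k\<le>n. f k)) $ n"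
    by (rule fps_mult_nth_cong) (auto simp: fps_isum_nth[OF assms] fps_sum_nth)
  thus "(F * fps_isum f) $ n = fps_isum (\<lambda>k. F * f k) $ n"
    by (simp add: fps_isum_def sum_distrib_left fps_sum_nth)
qed

lemma fps_isum_diff: "fps_isum (\<lambda>k. f k - g k) = fps_isum f - fps_isum g"
  by (simp add: fps_isum_def fps_eq_iff sum_subtractf)

lemma fps_isum_shift:
  assumes "isum_adm f"
  shows "fps_isum f = f 0 + fps_isum (\<lambda>k. f (Suc k))"
proof (rule fps_ext)
  fix n
  have "fps_isum f $ n = (\<Sum>k\<le>Suc n. f k $ n)" by (rule fps_isum_nth[OF assms]) simp
  also have "\<dots> = f 0 $ n + (\<Sum>k\<le>n. f (Suc k) $ n)" by (rule sum.atMost_Suc_shift)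
  finally show "fps_isum f $ n = (f 0 + fps_isum (\<lambda>k. f (Suc k))) $ n" by (simp add: fps_isum_def)
qed

text \<open>A finite product satisfies the identity by the Leibniz rule; \<open>cong\<close> says
  that \<open>D\<close> does not look beyond degree \<open>n\<close>, which allows truncation. With
  \<open>D\<close> abstract, the lemma serves both for \<open>delta_q\<close> and for the derivative
  in \<open>t\<close>.\<close>

lemma iprod_log_derivative:
  fixes D :: "'a :: comm_ring_1 fps \<Rightarrow> 'a fps"
  assumes D: "\<And>F G. D (F * G) = D F * G + F * D G"
    and cong: "\<And>F G n. (\<And>k. k \<le> n \<Longrightarrow> F $ k = G $ k) \<Longrightarrow> D F $ n = D G $ n"
    and adm: "iprod_adm g" and g: "\<And>i. i > 0 \<Longrightarrow> D (g i) = g i * h i"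
    and h: "\<And>i n. n < i \<Longrightarrow> h i $ n = 0"
  shows "D (fps_iprod g) = fps_iprod g * Abs_fps (\<lambda>n. \<Sum>i\<in>{1..n}. h i $ n)"
proof (rule fps_ext)
  fix n
  have D1: "D 1 = 0" using D[of 1 1] by simp
  have fin: "D (\<Prod>i\<in>{1..N}. g i) = (\<Prod>i\<in>{1..N}. g i) * (\<Sum>i\<in>{1..N}. h i)" for N
    by (induction N) (simp_all add: D D1 g algebra_simps)
  have "D (fps_iprod g) $ n = D (\<Prod>i\<in>{1..n}. g i) $ n"
    by (rule cong) (simp add: fps_iprod_nth[OF adm])
  also have "\<dots> = (fps_iprod g * Abs_fps (\<lambda>n. \<Sum>i\<in>{1..n}. h i $ n)) $ n"
    unfolding fin
  proof (rule fps_mult_nth_cong)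
    fix k assume k: "k \<le> n"
    have "(\<Sum>i\<in>{1..n}. h i $ k) = (\<Sum>i\<in>{1..k}. h i $ k)"
      using k h by (intro sum.mono_neutral_right) auto
    thus "(\<Sum>i\<in>{1..n}. h i) $ k = Abs_fps (\<lambda>n. \<Sum>i\<in>{1..n}. h i $ n) $ k"
      by (simp add: fps_sum_nth)
  qed (simp add: fps_iprod_nth[OF adm])
  finally show "D (fps_iprod g) $ n = (fps_iprod g * Abs_fps (\<lambda>n. \<Sum>i\<in>{1..n}. h i $ n)) $ n" .
qed

text \<open>The series \<open>1 / (1 - c q ^ i)\<close>, written out so that \<open>c\<close> may
  lie in any commutative ring, in particular in the power series in \<open>t\<close>.\<close>

definition geom_fps :: "'a :: comm_ring_1 \<Rightarrow> nat \<Rightarrow> 'a fps" where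
  "geom_fps c i = Abs_fps (\<lambda>n. if i dvd n then c ^ (n div i) else 0)"

lemma fps_const_X_power_mult_nth:
  "(fps_const c * fps_X ^ i * F) $ n = (if n < i then 0 else c * F $ (n - i))" for c :: "'a :: comm_ring_1"
  by (simp add: mult.assoc fps_X_power_mult_nth)

lemma geom_fps_inverse:
  assumes "i > 0"
  shows "(1 - fps_const c * fps_X ^ i) * geom_fps c i = 1"
proof (rule fps_ext)
  fix n
  have "((1 - fps_const c * fps_X ^ i) * geom_fps c i) $ n =
      geom_fps c i $ n - (if n < i then 0 else c * geom_fps c i $ (n - i))"
    by (simp add: left_diff_distrib fps_const_X_power_mult_nth)
  also have "\<dots> = 1 $ n"
  proof (cases "n < i")
    case True
    thus ?thesis using assms by (auto simp: geom_fps_def dest: dvd_imp_le)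
  next
    case False
    hence "i dvd n \<longleftrightarrow> i dvd (n - i)" "n div i = Suc ((n - i) div i)" "n > 0"
      using assms by (auto simp: dvd_minus_self le_div_geq dvd_diff_nat not_less)
    thus ?thesis using False by (auto simp: geom_fps_def)
  qed
  finally show "((1 - fps_const c * fps_X ^ i) * geom_fps c i) $ n = 1 $ n" .
qed

lemma geom_fps_minus_1:
  assumes "i > 0"
  shows "fps_const c * fps_X ^ i * geom_fps c i = geom_fps c i - 1"
  using geom_fps_inverse[OF assms, of c] by (simp add: algebra_simps)

lemma iprod_adm_geom: "iprod_adm (\<lambda>i. geom_fps (c i) i)"
  by (rule iprod_admI) (auto simp: geom_fps_def dest: dvd_imp_le)

lemma iprod_adm_one_minus: "(\<And>i. i \<le> e i) \<Longrightarrow> iprod_adm (\<lambda>i. 1 - fps_const (c i) * fps_X ^ e i)"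
  by (rule iprod_admI) (auto simp: fps_X_power_nth dest: le_less_trans)

lemma iprod_one_minus_mult_geom:
  "fps_iprod (\<lambda>i. 1 - fps_const c * fps_X ^ i) * fps_iprod (geom_fps c) = 1"
proof -
  have "fps_iprod (\<lambda>i. 1 - fps_const c * fps_X ^ i) * fps_iprod (geom_fps c) =
     fps_iprod (\<lambda>i. (1 - fps_const c * fps_X ^ i) * geom_fps c i)"
    using iprod_adm_geom[of "\<lambda>_. c"] by (intro fps_iprod_mult iprod_adm_one_minus) auto
  also have "\<dots> = fps_iprod (\<lambda>i. 1)"
    unfolding fps_iprod_def by (intro arg_cong[of _ _ Abs_fps] ext arg_cong2[of _ _ _ _ fps_nth] prod.cong)
      (auto simp: geom_fps_inverse)
  finally show ?thesis by (simp add: fps_iprod_1)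
qed

subsection \<open>The q-binomial theorem\<close>

text \<open>With \<open>z = y q ^ (k + 1)\<close> and \<open>a = u q\<close> this is the summand
  \<open>(a; q)_j z ^ j / (q; q)_j\<close> of the q-binomial series; increasing \<open>k\<close> by
  1 replaces \<open>z\<close> by \<open>z q\<close>.\<close>

definition qbinom_term :: "'a :: comm_ring_1 \<Rightarrow> 'a \<Rightarrow> nat \<Rightarrow> nat \<Rightarrow> 'a fps" where
  "qbinom_term y u k j = fps_const (y ^ j) * fps_X ^ (j * Suc k) *
     ((\<Prod>i\<in>{1..j}. geom_fps 1 i) * (\<Prod>i\<in>{1..j}. 1 - fps_const u * fps_X ^ i))"

lemma qbinom_term_nth_0: "n < j * Suc k \<Longrightarrow> qbinom_term y u k j $ n = 0"
  unfolding qbinom_term_def fps_const_X_power_mult_nth by simp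

lemma isum_adm_qbinom: "isum_adm (qbinom_term y u k)"
  by (rule isum_admI, rule qbinom_term_nth_0) auto

lemma qbinom_term_Suc:
  "(1 - fps_X ^ Suc j) * qbinom_term y u k (Suc j) =
     fps_const y * fps_X ^ Suc k * (1 - fps_const u * fps_X ^ Suc j) * qbinom_term y u k j"
proof -
  have g: "(1 - fps_X ^ Suc j) * geom_fps 1 (Suc j) = (1 :: 'a fps)"
    using geom_fps_inverse[of "Suc j" "1 :: 'a"] by (simp del: power_Suc)
  have "(1 - fps_X ^ Suc j) * qbinom_term y u k (Suc j) =
     ((1 - fps_X ^ Suc j) * geom_fps 1 (Suc j)) *
     (fps_const y * fps_X ^ Suc k * (1 - fps_const u * fps_X ^ Suc j) * qbinom_term y u k j)"
  proof -
    have 1: "fps_const (y ^ Suc j) = fps_const y * fps_const (y ^ j)" by simp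
    have 2: "fps_X ^ (Suc j * Suc k) = fps_X ^ Suc k * (fps_X ^ (j * Suc k) :: 'a fps)" by (simp only: mult_Suc power_add)
    have 3: "(\<Prod>i\<in>{1..Suc j}. f i) = f (Suc j) * (\<Prod>i\<in>{1..j}. f i)" for f :: "nat \<Rightarrow> 'a fps"
      by (simp add: mult.commute)
    show ?thesis unfolding qbinom_term_def 1 2 3 by (simp only: mult_ac)
  qed
  thus ?thesis by (simp only: g mult_1_left)
qed

text \<open>Comparing \<open>f z - f (q z)\<close> termwise, through the ratio of consecutive
  summands, gives the classical functional equation
  \<open>(1 - z) f z = (1 - a z) f (q z)\<close>.\<close>

lemma qbinom_step:
  "(1 - fps_const y * fps_X ^ Suc k) * fps_isum (qbinom_term y u k) =
   (1 - fps_const (y * u) * fps_X ^ Suc (Suc k)) * fps_isum (qbinom_term y u (Suc k))"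
proof -
  let ?t = "qbinom_term y u k"
  have t': "qbinom_term y u (Suc k) = (\<lambda>j. fps_X ^ j * ?t j)"
    by (rule ext) (simp add: qbinom_term_def power_add mult_ac)
  have adm: "isum_adm ?t" by (rule isum_adm_qbinom)
  have adm': "isum_adm (\<lambda>j. fps_X ^ j * ?t j)" unfolding t'[symmetric] by (rule isum_adm_qbinom)
  have adm1: "isum_adm (\<lambda>j. (1 - fps_X ^ j) * ?t j)"
  proof (rule isum_admI)
    fix j n :: nat assume "n < j"
    thus "((1 - fps_X ^ j) * ?t j) $ n = 0"
      using adm by (intro fps_nth_mult_eq_0[of 0 _ j]) (auto simp: isum_adm_def)
  qed
  have "fps_isum ?t - fps_isum (\<lambda>j. fps_X ^ j * ?t j) = fps_isum (\<lambda>j. (1 - fps_X ^ j) * ?t j)"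
    by (simp add: fps_isum_diff[symmetric] algebra_simps)
  also have "\<dots> = fps_isum (\<lambda>j. (1 - fps_X ^ Suc j) * ?t (Suc j))"
    by (subst fps_isum_shift[OF adm1]) simp
  also have "\<dots> = fps_isum (\<lambda>j. fps_const y * fps_X ^ Suc k * ?t j -
      fps_const (y * u) * fps_X ^ Suc (Suc k) * (fps_X ^ j * ?t j))"
    unfolding qbinom_term_Suc
    by (intro arg_cong[of _ _ fps_isum] ext) (simp add: algebra_simps fps_const_mult[symmetric] del: fps_const_mult)
  also have "\<dots> = fps_const y * fps_X ^ Suc k * fps_isum ?t -
      fps_const (y * u) * fps_X ^ Suc (Suc k) * fps_isum (\<lambda>j. fps_X ^ j * ?t j)"
    by (simp add: fps_isum_diff fps_isum_mult_left[OF adm] fps_isum_mult_left[OF adm'])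
  finally show ?thesis unfolding t' by (simp add: algebra_simps)
qed

text \<open>After \<open>n\<close> uses of the functional equation the remaining series is 1 up to
  degree \<open>n\<close>, since its summand \<open>j\<close> starts at degree
  \<open>j (n + 1)\<close>; so only the stripped factors matter for coefficient
  \<open>n\<close>.\<close>

theorem qbinomial_theorem:
  "fps_iprod (\<lambda>i. 1 - fps_const y * fps_X ^ i) * fps_isum (qbinom_term y u 0) =
   fps_iprod (\<lambda>i. 1 - fps_const (y * u) * fps_X ^ Suc i)"
proof (rule fps_ext)
  fix n
  have fin: "(\<Prod>i\<in>{1..N}. 1 - fps_const y * fps_X ^ i) * fps_isum (qbinom_term y u 0) =
      (\<Prod>i\<in>{1..N}. 1 - fps_const (y * u) * fps_X ^ Suc i) * fps_isum (qbinom_term y u N)" for N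
  proof (induction N)
    case (Suc N)
    have "(\<Prod>i\<in>{1..Suc N}. 1 - fps_const y * fps_X ^ i) * fps_isum (qbinom_term y u 0) =
       (1 - fps_const y * fps_X ^ Suc N) * ((\<Prod>i\<in>{1..N}. 1 - fps_const y * fps_X ^ i) * fps_isum (qbinom_term y u 0))"
      by (simp add: mult_ac)
    also have "\<dots> = (\<Prod>i\<in>{1..N}. 1 - fps_const (y * u) * fps_X ^ Suc i) *
       ((1 - fps_const y * fps_X ^ Suc N) * fps_isum (qbinom_term y u N))"
      unfolding Suc by (simp only: mult_ac)
    also have "\<dots> = (\<Prod>i\<in>{1..Suc N}. 1 - fps_const (y * u) * fps_X ^ Suc i) * fps_isum (qbinom_term y u (Suc N))"
      unfolding qbinom_step by (simp add: mult_ac)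
    finally show ?case .
  qed simp
  have one: "fps_isum (qbinom_term y u n) $ k = 1 $ k" if "k \<le> n" for k
  proof -
    have "fps_isum (qbinom_term y u n) = qbinom_term y u n 0 + fps_isum (\<lambda>j. qbinom_term y u n (Suc j))"
      by (rule fps_isum_shift[OF isum_adm_qbinom])
    moreover have "fps_isum (\<lambda>j. qbinom_term y u n (Suc j)) $ k = 0"
      unfolding fps_isum_def using that by (auto intro!: sum.neutral qbinom_term_nth_0)
    ultimately show ?thesis by (simp add: qbinom_term_def)
  qed
  have adm: "iprod_adm (\<lambda>i. 1 - fps_const y * fps_X ^ i)" "iprod_adm (\<lambda>i. 1 - fps_const (y * u) * fps_X ^ Suc i)"
    by (intro iprod_adm_one_minus; simp)+
  have "(fps_iprod (\<lambda>i. 1 - fps_const y * fps_X ^ i) * fps_isum (qbinom_term y u 0)) $ n =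
     ((\<Prod>i\<in>{1..n}. 1 - fps_const y * fps_X ^ i) * fps_isum (qbinom_term y u 0)) $ n"
    by (rule fps_mult_nth_cong) (simp_all only: fps_iprod_nth[OF adm(1)])
  also have "\<dots> = (\<Prod>i\<in>{1..n}. 1 - fps_const (y * u) * fps_X ^ Suc i) $ n"
    unfolding fin by (rule fps_mult_nth_one_cong) (rule one)
  finally show "(fps_iprod (\<lambda>i. 1 - fps_const y * fps_X ^ i) * fps_isum (qbinom_term y u 0)) $ n =
     fps_iprod (\<lambda>i. 1 - fps_const (y * u) * fps_X ^ Suc i) $ n"
    by (simp only: fps_iprod_nth[OF adm(2) order_refl])
qed

subsection \<open>Partition generating functions\<close>

lemma size_le_sum_mset: "(\<forall>x\<in>#p. 0 < x) \<Longrightarrow> size p \<le> sum_mset (p :: nat multiset)"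
  by (induction p) auto

lemma member_le_sum_mset: "x \<in># p \<Longrightarrow> x \<le> sum_mset (p :: nat multiset)"
  by (metis le_add1 multi_member_split sum_mset.add_mset)

lemma finite_partitions: "finite (partitions n)"
proof (rule finite_subset)
  show "partitions n \<subseteq> mset ` {xs. set xs \<subseteq> {..n} \<and> length xs \<le> n}"
  proof
    fix p assume p: "p \<in> partitions n"
    obtain xs where xs: "mset xs = p" by (metis ex_mset)
    have "set xs \<subseteq> {..n}" using p member_le_sum_mset[of _ p] unfolding partitions_def xs[symmetric] by auto
    moreover have "length xs \<le> n" using p size_le_sum_mset[of p] unfolding partitions_def xs[symmetric] by auto
    ultimately show "p \<in> mset ` {xs. set xs \<subseteq> {..n} \<and> length xs \<le> n}" using xs by blast
  qed
  show "finite (mset ` {xs. set xs \<subseteq> {..n} \<and> length xs \<le> n})"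
    by (intro finite_imageI finite_lists_length_le) simp
qed

definition parts_in :: "nat set \<Rightarrow> nat \<Rightarrow> nat multiset set" where
  "parts_in I n = {p. set_mset p \<subseteq> I \<and> sum_mset p = n}"

lemma parts_in_subset: "0 \<notin> I \<Longrightarrow> parts_in I n \<subseteq> partitions n"
  by (auto simp: parts_in_def partitions_def) (metis gr0I subsetD)

lemma finite_parts_in: "0 \<notin> I \<Longrightarrow> finite (parts_in I n)"
  using finite_subset[OF parts_in_subset finite_partitions] .

lemma partitions_eq_parts_in:
  assumes "n \<le> N"
  shows "partitions n = parts_in {1..N} n"
  using assms member_le_sum_mset by (fastforce simp: parts_in_def partitions_def Suc_le_eq)

lemma mset_split_value: "p = replicate_mset (count p i) i + filter_mset (\<lambda>x. x \<noteq> i) p"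
  using multiset_partition[of p "\<lambda>x. x = i"] by (simp add: filter_eq_replicate_mset)

lemma filter_replicate_mset_none: "\<not> P x \<Longrightarrow> filter_mset P (replicate_mset k x) = {#}"
  by (induction k) auto

text \<open>Induction on the set of allowed parts: all copies of the new part \<open>i\<close>, of
  total size \<open>a\<close>, are split off. The multiplicative weight \<open>g\<close> later lets
  parts carry powers of \<open>x\<close>.\<close>

lemma parts_in_gf:
  fixes g :: "nat \<Rightarrow> 'a :: comm_ring_1"
  assumes "finite I" "0 \<notin> I"
  shows "(\<Sum>p\<in>parts_in I n. prod_mset (image_mset g p)) = (\<Prod>i\<in>I. geom_fps (g i) i) $ n"
  using assms
proof (induction I arbitrary: n rule: finite_induct)
  case empty
  have "parts_in {} n = (if n = 0 then {{#}} else {})" by (auto simp: parts_in_def)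
  thus ?case by simp
next
  case (insert i I)
  let ?w = "\<lambda>p. prod_mset (image_mset g p)"
  have i: "i > 0" using insert.prems by (auto intro: gr0I)
  have fin: "finite (parts_in I m)" for m using insert.prems by (intro finite_parts_in) auto
  have "(\<Sum>p\<in>parts_in (insert i I) n. ?w p) =
     (\<Sum>(a, p)\<in>Sigma {a\<in>{0..n}. i dvd a} (\<lambda>a. parts_in I (n - a)). g i ^ (a div i) * ?w p)"
  proof (rule sum.reindex_bij_witness[where i = "\<lambda>(a, p). replicate_mset (a div i) i + p"
       and j = "\<lambda>p. (i * count p i, filter_mset (\<lambda>x. x \<noteq> i) p)"])
    fix p assume p: "p \<in> parts_in (insert i I) n"
    show "(case (i * count p i, filter_mset (\<lambda>x. x \<noteq> i) p) of (a, p) \<Rightarrow> replicate_mset (a div i) i + p) = p"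
      using i mset_split_value[of p i] by simp
    have "sum_mset p = i * count p i + sum_mset (filter_mset (\<lambda>x. x \<noteq> i) p)"
      by (subst mset_split_value[of p i]) (simp add: sum_mset_replicate_mset mult.commute)
    hence s: "n = i * count p i + sum_mset (filter_mset (\<lambda>x. x \<noteq> i) p)" using p by (simp add: parts_in_def)
    show "(i * count p i, filter_mset (\<lambda>x. x \<noteq> i) p) \<in> Sigma {a\<in>{0..n}. i dvd a} (\<lambda>a. parts_in I (n - a))"
      using p s by (auto simp: parts_in_def)
    have "?w p = g i ^ count p i * ?w (filter_mset (\<lambda>x. x \<noteq> i) p)"
      by (subst mset_split_value[of p i]) (simp add: image_replicate_mset)
    thus "(case (i * count p i, filter_mset (\<lambda>x. x \<noteq> i) p) of (a, p) \<Rightarrow> g i ^ (a div i) * ?w p) = ?w p"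
      using i by simp
  next
    fix ap assume ap: "ap \<in> Sigma {a\<in>{0..n}. i dvd a} (\<lambda>a. parts_in I (n - a))"
    then obtain a p where ap': "ap = (a, p)" "a \<le> n" "i dvd a" "p \<in> parts_in I (n - a)" by auto
    have np: "i \<notin># p" using ap'(4) insert.hyps by (auto simp: parts_in_def)
    hence "filter_mset (\<lambda>x. x \<noteq> i) p = p" by (intro filter_mset_eq_conv[THEN iffD2]) (auto simp: multiset_eq_iff)
    thus "(i * count (case ap of (a, p) \<Rightarrow> replicate_mset (a div i) i + p) i,
        filter_mset (\<lambda>x. x \<noteq> i) (case ap of (a, p) \<Rightarrow> replicate_mset (a div i) i + p)) = ap"
      using ap' np i by (simp add: not_in_iff filter_replicate_mset_none)
    show "(case ap of (a, p) \<Rightarrow> replicate_mset (a div i) i + p) \<in> parts_in (insert i I) n"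
      using ap' by (auto simp: parts_in_def sum_mset_replicate_mset)
  qed
  also have "\<dots> = (\<Sum>a\<in>{a\<in>{0..n}. i dvd a}. \<Sum>p\<in>parts_in I (n - a). g i ^ (a div i) * ?w p)"
    by (subst sum.Sigma) (auto simp: fin)
  also have "\<dots> = (\<Sum>a\<in>{a\<in>{0..n}. i dvd a}. g i ^ (a div i) * (\<Prod>i\<in>I. geom_fps (g i) i) $ (n - a))"
    using insert by (simp add: sum_distrib_left[symmetric])
  also have "\<dots> = (\<Sum>a\<in>{0..n}. geom_fps (g i) i $ a * (\<Prod>i\<in>I. geom_fps (g i) i) $ (n - a))"
    by (intro sum.mono_neutral_cong_left) (auto simp: geom_fps_def)
  also have "\<dots> = (\<Prod>i\<in>insert i I. geom_fps (g i) i) $ n"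
    using insert.hyps by (simp add: fps_mult_nth)
  finally show ?case .
qed

lemma Pser_eq_iprod: "Pser = fps_iprod (geom_fps 1)"
proof -
  have "inverse (1 - fps_X ^ n) = geom_fps (1 :: rat) n" if "n > 0" for n
    using fps_inverse_unique[of "1 - fps_X ^ n" "geom_fps (1 :: rat) n"] geom_fps_inverse[OF that, of "1 :: rat"] by simp
  thus ?thesis unfolding Pser_def fps_iprod_def
    by (intro arg_cong[of _ _ Abs_fps] ext arg_cong2[of _ _ _ _ fps_nth] prod.cong) auto
qed

lemma Pser_nth: "Pser $ n = of_nat (card (partitions n))"
proof -
  have "Pser $ n = (\<Prod>i\<in>{1..n}. geom_fps (1 :: rat) i) $ n"
    unfolding Pser_eq_iprod fps_iprod_def by simp
  also have "\<dots> = (\<Sum>p\<in>parts_in {1..n} n. prod_mset (image_mset (\<lambda>_. 1) p))"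
    by (subst parts_in_gf) auto
  also have "\<dots> = of_nat (card (partitions n))"
    by (simp add: partitions_eq_parts_in[of n n] image_mset_const_eq)
  finally show ?thesis .
qed

text \<open>The factor \<open>1 / (1 - q ^ i)\<close> has logarithmic derivative
  \<open>i (1 / (1 - q ^ i) - 1)\<close>; collecting the multiples of every \<open>i\<close> gives
  the divisor sum.\<close>

lemma delta_q_Pser: "delta_q Pser = Pser * Phi 1"
proof -
  have "delta_q (fps_iprod (geom_fps 1)) = fps_iprod (geom_fps 1) *
      Abs_fps (\<lambda>n. \<Sum>i\<in>{1..n}. (of_nat i * (geom_fps 1 i - 1) :: rat fps) $ n)"
  proof (rule iprod_log_derivative[OF delta_q_mult])
    show "iprod_adm (geom_fps (1 :: rat))" using iprod_adm_geom[of "\<lambda>_. 1"] by simp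
    fix i :: nat assume i: "i > 0"
    let ?g = "geom_fps (1 :: rat) i"
    have 1: "(1 - fps_X ^ i) * ?g = 1" using geom_fps_inverse[OF i, of 1] by simp
    have d: "delta_q (1 - fps_X ^ i) = - (of_nat i * fps_X ^ i :: rat fps)"
      using i by (intro fps_ext) (auto simp: delta_q_def fps_X_power_nth simp flip: fps_of_nat)
    have "0 = delta_q ((1 - fps_X ^ i) * ?g)" unfolding 1 by (simp add: delta_q_altdef)
    also have "\<dots> = - (of_nat i * fps_X ^ i) * ?g + (1 - fps_X ^ i) * delta_q ?g"
      unfolding delta_q_mult d ..
    finally have "(1 - fps_X ^ i) * delta_q ?g = of_nat i * (fps_X ^ i * ?g)" by (simp add: mult_ac)
    hence "?g * ((1 - fps_X ^ i) * delta_q ?g) = ?g * (of_nat i * (fps_X ^ i * ?g))" by simp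
    moreover have "?g * ((1 - fps_X ^ i) * delta_q ?g) = ((1 - fps_X ^ i) * ?g) * delta_q ?g" by (simp only: mult_ac)
    hence "?g * ((1 - fps_X ^ i) * delta_q ?g) = delta_q ?g" by (simp only: 1 mult_1_left)
    moreover have "fps_X ^ i * ?g = ?g - 1" using geom_fps_minus_1[OF i, of 1] by simp
    ultimately show "delta_q ?g = ?g * (of_nat i * (?g - 1))" by simp
  next
    fix i n :: nat assume "n < i"
    thus "(of_nat i * (geom_fps 1 i - 1) :: rat fps) $ n = 0"
      by (auto simp: geom_fps_def simp flip: fps_of_nat dest: dvd_imp_le)
  qed (simp add: delta_q_def)
  also have "Abs_fps (\<lambda>n. \<Sum>i\<in>{1..n}. (of_nat i * (geom_fps 1 i - 1) :: rat fps) $ n) = Phi 1"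
  proof (rule fps_ext)
    fix n
    have "(\<Sum>i\<in>{1..n}. (of_nat i * (geom_fps 1 i - 1) :: rat fps) $ n) = (\<Sum>i\<in>{i\<in>{1..n}. i dvd n}. of_nat i)"
      by (intro sum.mono_neutral_cong_right) (auto simp: geom_fps_def simp flip: fps_of_nat)
    also have "\<dots> = Phi 1 $ n"
    proof (cases "n = 0")
      case False
      hence "{i\<in>{1..n}. i dvd n} = {d. d dvd n}" by (auto dest: dvd_imp_le intro: Nat.gr0I simp: Suc_le_eq)
      thus ?thesis using False by (simp add: Phi_def Defs.sigma_def)
    qed (simp add: Phi_def)
    finally show "Abs_fps (\<lambda>n. \<Sum>i\<in>{1..n}. (of_nat i * (geom_fps 1 i - 1) :: rat fps) $ n) $ n = Phi 1 $ n" by simp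
  qed
  finally show ?thesis by (simp add: Pser_eq_iprod)
qed

subsection \<open>Dyson's map and the rank\<close>

lemma partition_nonempty: "p \<in> partitions n \<Longrightarrow> n > 0 \<Longrightarrow> p \<noteq> {#}"
  by (auto simp: partitions_def)

lemma partition_Max:
  assumes "p \<in> partitions n" "n > 0"
  shows "Max (set_mset p) \<in># p" "Max (set_mset p) \<ge> 1" "Max (set_mset p) \<le> n" "size p \<ge> 1" "size p \<le> n"
proof -
  have ne: "set_mset p \<noteq> {}" using partition_nonempty[OF assms] by simp
  show M: "Max (set_mset p) \<in># p" using Max_in[OF _ ne] by simp
  show "Max (set_mset p) \<ge> 1" "Max (set_mset p) \<le> n"
    using M assms member_le_sum_mset[OF M] by (auto simp: partitions_def Suc_le_eq)
  show "size p \<ge> 1" using partition_nonempty[OF assms] by (simp add: Suc_le_eq nonempty_has_size)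
  show "size p \<le> n" using assms size_le_sum_mset[of p] by (auto simp: partitions_def)
qed

lemma rank_bounds:
  assumes "p \<in> partitions n" "n > 0"
  shows "rank p \<le> int n - 1" "rank p \<ge> 1 - int n"
  using partition_Max[OF assms] by (auto simp: Defs.rank_def)

text \<open>\<open>r\<close> is the change of the size of the partition, that is
  \<open>m - 1\<close> for rank bound \<open>m\<close>. Parts equal to 1 become 0 and are
  dropped.\<close>

definition dyson :: "int \<Rightarrow> nat multiset \<Rightarrow> nat multiset" where
  "dyson r p = add_mset (nat (int (size p) + r)) (filter_mset (\<lambda>x. 0 < x) (image_mset (\<lambda>x. x - 1) p))"

text \<open>The added row is a largest part \<open>M\<close>, so it can be found and deleted; the
  restored first column must have length \<open>M - r\<close>, and the missing cells are supplied as
  parts 1.\<close>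

definition dyson_inv :: "int \<Rightarrow> nat multiset \<Rightarrow> nat multiset" where
  "dyson_inv r q = (let M = Max (set_mset q); q' = q - {#M#} in
     image_mset Suc q' + replicate_mset (nat (int M - r) - size q') 1)"

lemma sum_filter_pos: "sum_mset (filter_mset (\<lambda>x. 0 < x) p) = sum_mset (p :: nat multiset)"
  by (induction p) auto

lemma sum_image_pred: "(\<forall>x\<in>#p. 0 < x) \<Longrightarrow> sum_mset (image_mset (\<lambda>x. x - 1) p) + size p = sum_mset (p :: nat multiset)"
  by (induction p) auto

lemma sum_image_Suc: "sum_mset (image_mset Suc p) = sum_mset p + size p"
  by (induction p) auto

lemma image_Suc_filter_pred:
  "(\<forall>x\<in>#p. 0 < x) \<Longrightarrow>
   image_mset Suc (filter_mset (\<lambda>x. 0 < x) (image_mset (\<lambda>x. x - 1) p)) = filter_mset (\<lambda>x. x \<noteq> 1) p"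
  by (induction p) auto

lemma filter_pred_image_Suc:
  "(\<forall>x\<in>#p. 0 < x) \<Longrightarrow> filter_mset (\<lambda>x. 0 < x) (image_mset (\<lambda>x. x - 1) (image_mset Suc p)) = p"
  by (induction p) auto

text \<open>Rank at most \<open>r + 1\<close> says that the new row of length
  \<open>size p + r\<close> is at least the largest part minus 1, hence a largest part of the image.
  Conversely, rank at least \<open>r - 1\<close> says that the column of length \<open>M - r\<close>
  reaches past all remaining rows.\<close>

lemma dyson_bij:
  assumes n: "n > 0" "n' > 0" "int n' = int n + r"
  shows "bij_betw (dyson r) {p\<in>partitions n. rank p \<le> r + 1} {p\<in>partitions n'. rank p \<ge> r - 1}"
proof (rule bij_betw_byWitness[where f' = "dyson_inv r"])
  have dy: "Max (set_mset (dyson r p)) = nat (int (size p) + r) \<and> int (size p) + r \<ge> 1 \<and>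
     sum_mset (dyson r p) = n' \<and> (\<forall>x\<in>#dyson r p. 0 < x) \<and> size (dyson r p) \<le> size p + 1"
    if p: "p \<in> partitions n" "rank p \<le> r + 1" for p
  proof -
    define M where "M = Max (set_mset p)"
    have pos: "\<forall>x\<in>#p. 0 < x" and s: "sum_mset p = n" using p by (auto simp: partitions_def)
    note pM = partition_Max[OF p(1) n(1), folded M_def]
    have le: "x \<le> M" if "x \<in># p" for x using that by (simp add: M_def)
    have r: "int M - int (size p) \<le> r + 1" using p(2) by (simp add: Defs.rank_def M_def)
    \<comment> \<open>An empty new row would force all parts to be 1 and
      \<open>n = size p = - r\<close>, so that \<open>n' = 0\<close>.\<close>
    have "int (size p) + r \<noteq> 0"
    proof
      assume 0: "int (size p) + r = 0"
      hence "M \<le> 1" using r by linarith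
      have "x = 1" if "x \<in># p" for x using le[OF that] pos that \<open>M \<le> 1\<close> by force
      hence "p = replicate_mset (size p) 1" by (metis set_mset_subset_singletonD subsetI singleton_iff)
      hence "sum_mset p = size p" by (metis mult_1_right sum_mset_replicate_mset of_nat_id)
      thus False using s n 0 by simp
    qed
    hence ge1: "int (size p) + r \<ge> 1" using r pM by linarith
    have sum: "sum_mset (dyson r p) = n'"
      using sum_image_pred[OF pos] s n ge1 unfolding dyson_def by (simp add: sum_filter_pos)
    have "set_mset (dyson r p) \<subseteq> insert (nat (int (size p) + r)) ((\<lambda>x. x - 1) ` set_mset p)"
      by (auto simp: dyson_def)
    hence "x \<le> nat (int (size p) + r)" if "x \<in># dyson r p" for x
      using that le r by fastforce
    hence "Max (set_mset (dyson r p)) = nat (int (size p) + r)"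
      by (intro Max_eqI) (auto simp: dyson_def)
    moreover have "\<forall>x\<in>#dyson r p. 0 < x" using ge1 by (auto simp: dyson_def)
    moreover have "size (dyson r p) \<le> size p + 1"
      unfolding dyson_def by (simp, metis size_filter_mset_lesseq size_image_mset)
    ultimately show ?thesis using ge1 sum by blast
  qed
  show "dyson r ` {p\<in>partitions n. rank p \<le> r + 1} \<subseteq> {p\<in>partitions n'. rank p \<ge> r - 1}"
  proof safe
    fix p assume p: "p \<in> partitions n" "rank p \<le> r + 1"
    show "dyson r p \<in> partitions n'" using dy[OF p] by (auto simp: partitions_def)
    show "r - 1 \<le> rank (dyson r p)" using dy[OF p] unfolding Defs.rank_def by linarith
  qed
  show "\<forall>p\<in>{p\<in>partitions n. rank p \<le> r + 1}. dyson_inv r (dyson r p) = p"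
  proof safe
    fix p assume p: "p \<in> partitions n" "rank p \<le> r + 1"
    have pos: "\<forall>x\<in>#p. 0 < x" using p by (auto simp: partitions_def)
    define q' where "q' = filter_mset (\<lambda>x. 0 < x) (image_mset (\<lambda>x. x - 1) p)"
    have M: "Max (set_mset (dyson r p)) = nat (int (size p) + r)" and ge: "int (size p) + r \<ge> 1"
      using dy[OF p] by auto
    have q': "dyson r p - {#nat (int (size p) + r)#} = q'" by (simp add: dyson_def q'_def)
    have split: "p = replicate_mset (count p 1) 1 + filter_mset (\<lambda>x. x \<noteq> 1) p" by (rule mset_split_value)
    have im: "image_mset Suc q' = filter_mset (\<lambda>x. x \<noteq> 1) p" unfolding q'_def by (rule image_Suc_filter_pred[OF pos])
    hence "size q' = size (filter_mset (\<lambda>x. x \<noteq> 1) p)" by (metis size_image_mset)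
    moreover have "size p = count p 1 + size (filter_mset (\<lambda>x. x \<noteq> 1) p)"
      by (metis split size_union size_replicate_mset)
    ultimately have "nat (int (nat (int (size p) + r)) - r) - size q' = count p 1" using ge by simp
    thus "dyson_inv r (dyson r p) = p"
      unfolding dyson_inv_def Let_def M q' im using split by (simp add: add.commute)
  qed
  have inv: "sum_mset (dyson_inv r q) = n \<and> (\<forall>x\<in>#dyson_inv r q. 0 < x) \<and>
      int (size (dyson_inv r q)) = int (Max (set_mset q)) - r \<and> (\<forall>x\<in>#dyson_inv r q. x \<le> Max (set_mset q) + 1) \<and>
      dyson r (dyson_inv r q) = q"
    if q: "q \<in> partitions n'" "rank q \<ge> r - 1" for q
  proof -
    define M q' where "M = Max (set_mset q)" and "q' = q - {#M#}"
    have pos: "\<forall>x\<in>#q. 0 < x" and s: "sum_mset q = n'" using q by (auto simp: partitions_def)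
    note qM = partition_Max[OF q(1) n(2), folded M_def]
    have qq: "q = add_mset M q'" using qM(1) by (simp add: q'_def)
    have pos': "\<forall>x\<in>#q'. 0 < x" using pos qq by auto
    have le: "x \<le> M" if "x \<in># q'" for x using that unfolding M_def
      by (intro Max_ge) (auto simp: q'_def dest: in_diffD)
    have szq: "size q = size q' + 1" by (subst qq) simp
    have r: "int M - r \<ge> int (size q')" using q(2) szq by (simp add: Defs.rank_def M_def)
    have D: "dyson_inv r q = image_mset Suc q' + replicate_mset (nat (int M - r) - size q') 1"
      by (simp add: dyson_inv_def Let_def M_def q'_def)
    have sz: "int (size (dyson_inv r q)) = int M - r" unfolding D using r by simp
    have "sum_mset (dyson_inv r q) = sum_mset q' + nat (int M - r)"
      unfolding D using r by (simp add: sum_image_Suc sum_mset_replicate_mset)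
    moreover have "n' = M + sum_mset q'" using s by (subst (asm) qq) simp
    moreover have "S + nat (int M - r) = n" if "n' = M + S" for S using that n(3) r by linarith
    ultimately have sum: "sum_mset (dyson_inv r q) = n" by simp
    have "dyson r (dyson_inv r q) = add_mset M q'"
    proof -
      have "filter_mset (\<lambda>x. 0 < x) (image_mset (\<lambda>x. x - 1) (dyson_inv r q)) = q'"
        unfolding D image_mset_union filter_union_mset filter_pred_image_Suc[OF pos']
        by (simp add: image_replicate_mset filter_replicate_mset_none)
      moreover have "nat (int (size (dyson_inv r q)) + r) = M" using sz by simp
      ultimately show ?thesis by (simp add: dyson_def)
    qed
    moreover have "\<forall>x\<in>#dyson_inv r q. 0 < x" "\<forall>x\<in>#dyson_inv r q. x \<le> M + 1"
      unfolding D using le by (auto simp: in_replicate_mset)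
    ultimately show ?thesis using sum sz unfolding M_def[symmetric] qq[symmetric] by blast
  qed
  show "\<forall>q\<in>{p\<in>partitions n'. rank p \<ge> r - 1}. dyson r (dyson_inv r q) = q" using inv by blast
  show "dyson_inv r ` {p\<in>partitions n'. rank p \<ge> r - 1} \<subseteq> {p\<in>partitions n. rank p \<le> r + 1}"
  proof safe
    fix q assume q: "q \<in> partitions n'" "rank q \<ge> r - 1"
    show P: "dyson_inv r q \<in> partitions n" using inv[OF q] by (auto simp: partitions_def)
    have "Max (set_mset (dyson_inv r q)) \<le> Max (set_mset q) + 1"
      using inv[OF q] partition_Max(1)[OF P n(1)] by blast
    thus "rank (dyson_inv r q) \<le> r + 1" using inv[OF q] unfolding Defs.rank_def by linarith
  qed
qed

text \<open>The coefficient at \<open>n = 0\<close> is set by hand, giving the empty partition rank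
  0, because the maximum in \<open>rank\<close> is meaningless there.\<close>

definition rank_le_ser :: "int \<Rightarrow> rat fps" where
  "rank_le_ser m = Abs_fps (\<lambda>n. if n = 0 then (if m \<ge> 0 then 1 else 0)
     else of_nat (card {p\<in>partitions n. rank p \<le> m}))"

lemma card_rank_compl:
  "of_nat (card {p\<in>partitions n. rank p \<ge> m}) =
     (of_nat (card (partitions n)) - of_nat (card {p\<in>partitions n. rank p \<le> m - 1}) :: rat)"
proof -
  have un: "partitions n = {p\<in>partitions n. rank p \<ge> m} \<union> {p\<in>partitions n. rank p \<le> m - 1}" by auto
  have "{p\<in>partitions n. rank p \<ge> m} \<inter> {p\<in>partitions n. rank p \<le> m - 1} = {}" by auto
  with un have "card (partitions n) = card {p\<in>partitions n. rank p \<ge> m} + card {p\<in>partitions n. rank p \<le> m - 1}"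
    using card_Un_disjoint[of "{p\<in>partitions n. rank p \<ge> m}" "{p\<in>partitions n. rank p \<le> m - 1}"]
    by (auto simp: finite_partitions)
  thus ?thesis by simp
qed

lemma rank_top: 
  assumes "n > 0" shows "{p\<in>partitions n. rank p \<ge> int n - 1} = {{#n#}}"
proof (intro equalityI subsetI)
  fix p assume p: "p \<in> {p\<in>partitions n. rank p \<ge> int n - 1}"
  hence p': "p \<in> partitions n" by simp
  have "Max (set_mset p) = n" "size p = 1"
    using partition_Max[OF p' assms] p by (auto simp: Defs.rank_def)
  moreover obtain x where "p = {#x#}" using \<open>size p = 1\<close> size_1_singleton_mset by blast
  ultimately show "p \<in> {{#n#}}" by simp
qed (use assms in \<open>auto simp: partitions_def Defs.rank_def\<close>)

lemma rank_bottom: 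
  assumes "n > 0" shows "{p\<in>partitions n. rank p \<le> 1 - int n} = {replicate_mset n 1}"
proof (intro equalityI subsetI)
  fix p assume p: "p \<in> {p\<in>partitions n. rank p \<le> 1 - int n}"
  hence p': "p \<in> partitions n" by simp
  have M: "Max (set_mset p) = 1" "size p = n"
    using partition_Max[OF p' assms] p by (auto simp: Defs.rank_def)
  have "x = 1" if "x \<in># p" for x
    using Max_ge[of "set_mset p" x] that p' M by (force simp: partitions_def)
  hence "p = replicate_mset (size p) 1" by (metis set_mset_subset_singletonD subsetI singleton_iff)
  thus "p \<in> {replicate_mset n 1}" using M by simp
qed (use assms in \<open>auto simp: partitions_def Defs.rank_def in_replicate_mset sum_mset_replicate_mset\<close>)

lemma rank_le_ser_0: "rank_le_ser m $ 0 = (if m \<ge> 0 then 1 else 0)"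
  by (simp add: rank_le_ser_def)

lemma rank_le_ser_pos: "n > 0 \<Longrightarrow> rank_le_ser m $ n = of_nat (card {p\<in>partitions n. rank p \<le> m})"
  by (simp add: rank_le_ser_def)

lemma partitions_0: "partitions 0 = {{#}}"
  by (auto simp: partitions_def) (metis less_irrefl multiset_nonemptyE)

lemma rank_le_ser_all: "m \<ge> int n - 1 \<Longrightarrow> n > 0 \<Longrightarrow> rank_le_ser m $ n = Pser $ n"
  using rank_bounds(1) by (force simp: rank_le_ser_pos Pser_nth intro!: arg_cong[of _ _ card])

lemma rank_le_ser_none: "m < 1 - int n \<Longrightarrow> n > 0 \<Longrightarrow> rank_le_ser m $ n = 0"
  using rank_bounds(2) by (force simp: rank_le_ser_pos card_eq_0_iff)

text \<open>Besides Dyson's bijection there are the cases where one side is the empty partition: it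
  corresponds to a single row or to a single column of ones.\<close>

lemma dyson_count:
  assumes "int n' = int n + r" "n + n' > 0" "r \<noteq> 1 \<or> n' > 0" "r \<noteq> -1 \<or> n > 0"
  shows "rank_le_ser (r + 1) $ n = Pser $ n' - rank_le_ser (r - 2) $ n'"
proof -
  consider "n > 0" "n' > 0" | "n = 0" "n' > 0" | "n' = 0" "n > 0" using assms(2) by linarith
  thus ?thesis
  proof cases
    case 1
    have "card {p\<in>partitions n. rank p \<le> r + 1} = card {p\<in>partitions n'. rank p \<ge> r - 1}"
      by (rule bij_betw_same_card[OF dyson_bij[OF 1 assms(1)]])
    thus ?thesis using 1 card_rank_compl[of n' "r - 1"] by (simp add: rank_le_ser_pos Pser_nth)
  next
    case 2
    hence "{p\<in>partitions n'. rank p \<ge> r - 1} = {{#n'#}}" using rank_top[of n'] assms by simp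
    thus ?thesis using 2 assms card_rank_compl[of n' "r - 1"]
      by (simp add: rank_le_ser_pos rank_le_ser_0 Pser_nth)
  next
    case 3
    hence "r + 1 = 1 - int n" using assms by simp
    hence "{p\<in>partitions n. rank p \<le> r + 1} = {replicate_mset n 1}" using rank_bottom[of n] 3 by simp
    thus ?thesis using 3 assms by (simp add: rank_le_ser_pos rank_le_ser_0 Pser_nth partitions_0)
  qed
qed

text \<open>The correction terms account for the empty partition.\<close>

lemma rank_le_ser_rec_pos:
  assumes m: "m \<ge> 1"
  shows "fps_X ^ nat (m - 1) * rank_le_ser m + rank_le_ser (m - 3) = Pser - (if m = 2 then 1 else 0)"
proof (rule fps_ext)
  fix n' :: nat
  define r where "r = nat (m - 1)"
  have r: "int r = m - 1" using m by (simp add: r_def)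
  have L: "(fps_X ^ r * rank_le_ser m + rank_le_ser (m - 3)) $ n' =
     (if n' < r then 0 else rank_le_ser m $ (n' - r)) + rank_le_ser (m - 3) $ n'"
    by (simp add: fps_X_power_mult_nth)
  have P0: "Pser $ 0 = 1" by (simp add: Pser_nth partitions_0)
  show "(fps_X ^ nat (m - 1) * rank_le_ser m + rank_le_ser (m - 3)) $ n' = (Pser - (if m = 2 then 1 else 0)) $ n'"
  proof (cases "n' = 0")
    case True
    show ?thesis unfolding r_def[symmetric] L using True r m P0 by (auto simp: rank_le_ser_0)
  next
    case False
    show ?thesis
    proof (cases "n' < r")
      case True
      thus ?thesis unfolding r_def[symmetric] L using False r by (simp add: rank_le_ser_all)
    next
      case nlt: False
      have "rank_le_ser (int r + 1) $ (n' - r) = Pser $ n' - rank_le_ser (int r - 2) $ n'"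
        using False nlt by (intro dyson_count) auto
      moreover have "int r + 1 = m" "int r - 2 = m - 3" using r by auto
      ultimately show ?thesis unfolding r_def[symmetric] L using nlt False by auto
    qed
  qed
qed

text \<open>The same relation as for positive \<open>m\<close>, scaled by a power of
  \<open>q\<close> that keeps all exponents nonnegative.\<close>

lemma rank_le_ser_rec_nonpos:
  assumes m: "m \<le> 0"
  shows "rank_le_ser m + fps_X ^ nat (1 - m) * rank_le_ser (m - 3) = fps_X ^ nat (1 - m) * Pser + (if m = 0 then 1 else 0)"
proof (rule fps_ext)
  fix n :: nat
  define r where "r = nat (1 - m)"
  have r: "int r = 1 - m" using m by (simp add: r_def)
  have L: "(rank_le_ser m + fps_X ^ r * rank_le_ser (m - 3)) $ n =
     rank_le_ser m $ n + (if n < r then 0 else rank_le_ser (m - 3) $ (n - r))"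
    by (simp add: fps_X_power_mult_nth)
  have R: "(fps_X ^ r * Pser + (if m = 0 then 1 else 0)) $ n =
     (if n < r then 0 else Pser $ (n - r)) + (if m = 0 \<and> n = 0 then 1 else 0)"
    by (simp add: fps_X_power_mult_nth)
  show "(rank_le_ser m + fps_X ^ nat (1 - m) * rank_le_ser (m - 3)) $ n =
      (fps_X ^ nat (1 - m) * Pser + (if m = 0 then 1 else 0)) $ n"
    unfolding r_def[symmetric] L R
  proof (cases "n = 0")
    case True
    thus "rank_le_ser m $ n + (if n < r then 0 else rank_le_ser (m - 3) $ (n - r)) =
      (if n < r then 0 else Pser $ (n - r)) + (if m = 0 \<and> n = 0 then 1 else 0)"
      using r m by (auto simp: rank_le_ser_0)
  next
    case False
    show "rank_le_ser m $ n + (if n < r then 0 else rank_le_ser (m - 3) $ (n - r)) =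
      (if n < r then 0 else Pser $ (n - r)) + (if m = 0 \<and> n = 0 then 1 else 0)"
    proof (cases "n < r")
      case True
      thus ?thesis using False r by (simp add: rank_le_ser_none)
    next
      case nlt: False
      have "rank_le_ser (- int r + 1) $ n = Pser $ (n - r) - rank_le_ser (- int r - 2) $ (n - r)"
        using False nlt m r by (intro dyson_count) auto
      moreover have "- int r + 1 = m" "- int r - 2 = m - 3" using r by auto
      ultimately show ?thesis using nlt False by auto
    qed
  qed
qed

subsection \<open>The crank generating function\<close>

text \<open>Generating functions in \<open>x\<close> and \<open>q\<close> are specialised to \<open>x = exp t\<close>, so that moments become
  Taylor coefficients in \<open>t\<close>: the outer variable of type \<open>rat fps fps\<close> is \<open>q\<close>, the inner one is \<open>t\<close>.\<close>

definition xpow :: "int \<Rightarrow> rat fps" where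
  "xpow m = fps_exp (of_int m)"

lemma xpow_add: "xpow (a + b) = xpow a * xpow b"
  by (simp add: xpow_def fps_exp_add_mult)

lemma xpow_0 [simp]: "xpow 0 = 1"
  by (simp add: xpow_def)

lemma xpow_power: "xpow a ^ k = xpow (int k * a)"
  by (simp add: xpow_def fps_exp_power_mult)

lemma xpow_nth: "xpow m $ j = of_int m ^ j / fact j"
  by (simp add: xpow_def fps_exp_def)

lemma xpow_deriv: "fps_deriv (xpow m) = of_int m * xpow m"
  by (simp add: xpow_def fps_of_int[symmetric])

text \<open>Split off the largest part \<open>k\<close>; the rest has parts from 2 to
  \<open>k\<close>.\<close>

lemma sum_partitions_no_ones:
  assumes n: "n > 0"
  shows "(\<Sum>p\<in>{p\<in>partitions n. count p 1 = 0}. xpow (int (Max (set_mset p)))) =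
    (\<Sum>k\<in>{2..n}. xpow 1 ^ k * (\<Prod>i\<in>{2..k}. geom_fps 1 i) $ (n - k))"
proof -
  have "(\<Sum>p\<in>{p\<in>partitions n. count p 1 = 0}. xpow (int (Max (set_mset p)))) =
    (\<Sum>(k, p)\<in>Sigma {2..n} (\<lambda>k. parts_in {2..k} (n - k)). xpow 1 ^ k)"
  proof (rule sum.reindex_bij_witness[where i = "\<lambda>(k, p). add_mset k p"
      and j = "\<lambda>p. (Max (set_mset p), p - {#Max (set_mset p)#})"])
    fix p assume "p \<in> {p\<in>partitions n. count p 1 = 0}"
    hence p: "p \<in> partitions n" "1 \<notin># p" by (auto simp: count_eq_zero_iff)
    define M where "M = Max (set_mset p)"
    note pM = partition_Max[OF p(1) n, folded M_def]
    have pos: "\<forall>x\<in>#p. 0 < x" and s: "sum_mset p = n" using p by (auto simp: partitions_def)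
    have ge2: "x \<ge> 2" if "x \<in># p" for x using that pos p(2) by (cases "x = 1"; cases "x = 0") auto
    have pp: "p = add_mset M (p - {#M#})" using pM(1) by simp
    have "n = M + sum_mset (p - {#M#})" using s by (subst (asm) pp) simp
    moreover have "x \<le> M" if "x \<in># p" for x using that unfolding M_def by (intro Max_ge) auto
    ultimately show "(Max (set_mset p), p - {#Max (set_mset p)#}) \<in> Sigma {2..n} (\<lambda>k. parts_in {2..k} (n - k))"
      using pM ge2 by (auto simp: parts_in_def M_def[symmetric] dest!: in_diffD)
    show "(case (Max (set_mset p), p - {#Max (set_mset p)#}) of (k, p) \<Rightarrow> add_mset k p) = p"
      using pp by (simp add: M_def)
    show "(case (Max (set_mset p), p - {#Max (set_mset p)#}) of (k, p) \<Rightarrow> xpow 1 ^ k) = xpow (int (Max (set_mset p)))"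
      by (simp add: xpow_power)
  next
    fix kp assume "kp \<in> Sigma {2..n} (\<lambda>k. parts_in {2..k} (n - k))"
    then obtain k p where kp: "kp = (k, p)" "2 \<le> k" "k \<le> n" "set_mset p \<subseteq> {2..k}" "sum_mset p = n - k"
      by (auto simp: parts_in_def)
    have M: "Max (set_mset (add_mset k p)) = k" using kp by (intro Max_eqI) auto
    show "(Max (set_mset (case kp of (k, p) \<Rightarrow> add_mset k p)),
          (case kp of (k, p) \<Rightarrow> add_mset k p) - {#Max (set_mset (case kp of (k, p) \<Rightarrow> add_mset k p))#}) = kp"
      using M kp by simp
    show "(case kp of (k, p) \<Rightarrow> add_mset k p) \<in> {p\<in>partitions n. count p 1 = 0}"
      using kp by (auto simp: partitions_def count_eq_zero_iff)
  qed
  also have "\<dots> = (\<Sum>k\<in>{2..n}. \<Sum>p\<in>parts_in {2..k} (n - k). xpow 1 ^ k * prod_mset (image_mset (\<lambda>_. 1) p))"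
    by (subst sum.Sigma) (auto intro!: finite_parts_in simp: image_mset_const_eq)
  also have "\<dots> = (\<Sum>k\<in>{2..n}. xpow 1 ^ k * (\<Prod>i\<in>{2..k}. geom_fps 1 i) $ (n - k))"
    by (intro sum.cong refl, subst sum_distrib_left[symmetric], subst parts_in_gf) auto
  finally show ?thesis .
qed

lemma prod_mset_if: "prod_mset (image_mset (\<lambda>i. if P i then c else 1) p) = (c :: 'a :: comm_monoid_mult) ^ size (filter_mset P p)"
  by (induction p) auto

lemma crank_ones:
  "count p 1 \<noteq> 0 \<Longrightarrow> crank p = int (size (filter_mset (\<lambda>x. x > count p 1) p)) - int (count p 1)"
  unfolding crank_def Let_def by (rule if_not_P)

text \<open>With \<open>j\<close> ones, a part contributes a factor \<open>x\<close> when it exceeds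
  \<open>j\<close>, and the ones together contribute \<open>x ^ (- j)\<close>.\<close>

lemma sum_partitions_ones:
  assumes n: "n > 0"
  shows "(\<Sum>p\<in>{p\<in>partitions n. count p 1 \<noteq> 0}. xpow (crank p)) =
    (\<Sum>j\<in>{1..n}. xpow (-1) ^ j * (\<Prod>i\<in>{2..n}. geom_fps (if i > j then xpow 1 else 1) i) $ (n - j))"
proof -
  have "(\<Sum>p\<in>{p\<in>partitions n. count p 1 \<noteq> 0}. xpow (crank p)) =
    (\<Sum>(j, p)\<in>Sigma {1..n} (\<lambda>j. parts_in {2..n} (n - j)). xpow (-1) ^ j * xpow 1 ^ size (filter_mset (\<lambda>x. x > j) p))"
  proof (rule sum.reindex_bij_witness[where i = "\<lambda>(j, p). replicate_mset j 1 + p"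
      and j = "\<lambda>p. (count p 1, filter_mset (\<lambda>x. x \<noteq> 1) p)"])
    fix p assume "p \<in> {p\<in>partitions n. count p 1 \<noteq> 0}"
    hence p: "p \<in> partitions n" "count p 1 \<ge> 1" by auto
    have pos: "\<forall>x\<in>#p. 0 < x" and s: "sum_mset p = n" using p by (auto simp: partitions_def)
    note sp = mset_split_value[of p 1]
    have "n = count p 1 + sum_mset (filter_mset (\<lambda>x. x \<noteq> 1) p)"
      using s by (subst (asm) sp) (simp add: sum_mset_replicate_mset)
    moreover have "x \<le> n" if "x \<in># p" for x using member_le_sum_mset[OF that] s by simp
    ultimately show "(count p 1, filter_mset (\<lambda>x. x \<noteq> 1) p) \<in> Sigma {1..n} (\<lambda>j. parts_in {2..n} (n - j))"
      using p(2) pos by (force simp: parts_in_def)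
    show "(case (count p 1, filter_mset (\<lambda>x. x \<noteq> 1) p) of (j, p) \<Rightarrow> replicate_mset j 1 + p) = p"
      using sp by simp
    have "filter_mset (\<lambda>x. x > k) (filter_mset (\<lambda>x. x \<noteq> 1) p) = filter_mset (\<lambda>x. x > k) p" if "k \<ge> 1" for k
      using that by (auto simp: filter_filter_mset intro!: filter_mset_cong)
    note fil = this[OF p(2)]
    have "xpow (crank p) = xpow (-1) ^ count p 1 * xpow 1 ^ size (filter_mset (\<lambda>x. x > count p 1) (filter_mset (\<lambda>x. x \<noteq> 1) p))"
    proof -
      have "count p 1 \<noteq> 0" using p(2) by linarith
      from crank_ones[OF this] show ?thesis unfolding fil
        by (simp add: xpow_power xpow_add[symmetric])
    qed
    thus "(case (count p 1, filter_mset (\<lambda>x. x \<noteq> 1) p) of (j, p) \<Rightarrow> xpow (-1) ^ j * xpow 1 ^ size (filter_mset (\<lambda>x. x > j) p)) =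
        xpow (crank p)" by simp
  next
    fix jp assume "jp \<in> Sigma {1..n} (\<lambda>j. parts_in {2..n} (n - j))"
    then obtain j p where jp: "jp = (j, p)" "1 \<le> j" "j \<le> n" "set_mset p \<subseteq> {2..n}" "sum_mset p = n - j"
      by (auto simp: parts_in_def)
    have n1: "1 \<notin># p" "0 \<notin># p" using jp(4) by auto
    hence "filter_mset (\<lambda>x. x \<noteq> 1) p = p" by (intro filter_mset_eq_conv[THEN iffD2]) (auto simp: multiset_eq_iff)
    thus "(count (case jp of (j, p) \<Rightarrow> replicate_mset j 1 + p) 1,
        filter_mset (\<lambda>x. x \<noteq> 1) (case jp of (j, p) \<Rightarrow> replicate_mset j 1 + p)) = jp"
      using jp n1 by (simp add: not_in_iff filter_replicate_mset_none)
    show "(case jp of (j, p) \<Rightarrow> replicate_mset j 1 + p) \<in> {p\<in>partitions n. count p 1 \<noteq> 0}"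
      using jp n1 by (auto simp: partitions_def sum_mset_replicate_mset in_replicate_mset intro: Nat.gr0I)
  qed
  also have "\<dots> = (\<Sum>j\<in>{1..n}. \<Sum>p\<in>parts_in {2..n} (n - j). xpow (-1) ^ j *
      prod_mset (image_mset (\<lambda>i. if i > j then xpow 1 else 1) p))"
    unfolding prod_mset_if by (subst sum.Sigma) (auto intro!: finite_parts_in)
  also have "\<dots> = (\<Sum>j\<in>{1..n}. xpow (-1) ^ j * (\<Prod>i\<in>{2..n}. geom_fps (if i > j then xpow 1 else 1) i) $ (n - j))"
    by (intro sum.cong refl, subst sum_distrib_left[symmetric], subst parts_in_gf) auto
  finally show ?thesis .
qed

text \<open>The window is one wider than the support \<open>|m| <= n\<close> of the crank, rank and
  \<open>beta\<close> families, which leaves room for index shifts by 1.\<close>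

definition gf_of :: "(int \<Rightarrow> rat fps) \<Rightarrow> rat fps fps" where
  "gf_of f = Abs_fps (\<lambda>n. \<Sum>m\<in>{- int n - 1..int n + 1}. fps_const (f m $ n) * xpow m)"

definition crank_coeff :: "int \<Rightarrow> rat fps" where
  "crank_coeff m = Abs_fps (\<lambda>n. if n = 0 then (if m = 0 then 1 else 0) else of_int (M_crank m n))"

lemma crank_bounds:
  assumes "p \<in> partitions n" "n > 0"
  shows "\<bar>crank p\<bar> \<le> int n"
proof (cases "count p 1 = 0")
  case True
  thus ?thesis using partition_Max[OF assms] by (simp add: crank_def)
next
  case False
  have "count p 1 \<le> size p" by (rule count_le_size)
  moreover have "size (filter_mset (\<lambda>x. x > count p 1) p) \<le> size p" by (rule size_filter_mset_lesseq)
  ultimately show ?thesis using partition_Max(5)[OF assms] unfolding crank_ones[OF False] by linarith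
qed

lemma gf_of_crank_nth:
  assumes "n \<ge> 2"
  shows "gf_of crank_coeff $ n = (\<Sum>p\<in>partitions n. xpow (crank p))"
proof -
  have "gf_of crank_coeff $ n = (\<Sum>m\<in>{- int n - 1..int n + 1}. \<Sum>p\<in>{p\<in>partitions n. crank p = m}. xpow (crank p))"
    unfolding gf_of_def using assms
    by (auto simp: crank_coeff_def M_crank_def fps_of_nat intro!: sum.cong)
  also have "\<dots> = (\<Sum>p\<in>partitions n. xpow (crank p))"
    using crank_bounds assms by (intro sum.group finite_partitions) force+
  finally show ?thesis .
qed

lemma iprod_tail_geom:
  "fps_iprod (\<lambda>i. if i > j then geom_fps c i else 1) =
     fps_iprod (geom_fps c) * (\<Prod>i\<in>{1..j}. 1 - fps_const c * fps_X ^ i)"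
proof -
  have adm1: "iprod_adm (geom_fps c)" using iprod_adm_geom[of "\<lambda>_. c"] by simp
  have adm2: "iprod_adm (\<lambda>i. if i \<le> j then 1 - fps_const c * fps_X ^ i else 1)"
    by (rule iprod_admI) (auto simp: fps_X_power_nth)
  have "(\<Prod>i\<in>{1..j}. 1 - fps_const c * fps_X ^ i) = fps_iprod (\<lambda>i. if i \<le> j then 1 - fps_const c * fps_X ^ i else 1)"
  proof (rule fps_ext)
    fix n
    have "fps_iprod (\<lambda>i. if i \<le> j then 1 - fps_const c * fps_X ^ i else 1) $ n =
      (\<Prod>i\<in>{1..n + j}. if i \<le> j then 1 - fps_const c * fps_X ^ i else 1) $ n"
      by (rule fps_iprod_nth[OF adm2]) simp
    also have "(\<Prod>i\<in>{1..n + j}. if i \<le> j then 1 - fps_const c * fps_X ^ i else 1) = (\<Prod>i\<in>{1..j}. 1 - fps_const c * fps_X ^ i)"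
      by (intro prod.mono_neutral_cong_right) auto
    finally show "(\<Prod>i\<in>{1..j}. 1 - fps_const c * fps_X ^ i) $ n =
       fps_iprod (\<lambda>i. if i \<le> j then 1 - fps_const c * fps_X ^ i else 1) $ n" by simp
  qed
  also have "fps_iprod (geom_fps c) * \<dots> = fps_iprod (\<lambda>i. geom_fps c i * (if i \<le> j then 1 - fps_const c * fps_X ^ i else 1))"
    by (rule fps_iprod_mult[OF adm1 adm2])
  also have "\<dots> = fps_iprod (\<lambda>i. if i > j then geom_fps c i else 1)"
    unfolding fps_iprod_def
    by (intro arg_cong[of _ _ Abs_fps] ext arg_cong2[of _ _ _ _ fps_nth] prod.cong)
       (auto simp: mult.commute[of "geom_fps c _"] geom_fps_inverse)
  finally show ?thesis by simp
qed

lemma prod_geom_from_2: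
  assumes "k \<ge> 1"
  shows "(1 - fps_X) * (\<Prod>i\<in>{1..k}. geom_fps (1 :: 'a :: comm_ring_1) i) = (\<Prod>i\<in>{2..k}. geom_fps 1 i)"
proof -
  have "{1..k} = insert 1 {2..k}" using assms by auto
  moreover have "(1 - fps_X) * geom_fps 1 1 = (1 :: 'a fps)" using geom_fps_inverse[of 1 "1 :: 'a"] by simp
  ultimately show ?thesis by (simp add: mult.assoc[symmetric])
qed

text \<open>Partitions without ones are sorted by their largest part, the others by the number
  \<open>j\<close> of ones; multiplying by \<open>1 - q\<close> deletes the part 1 from
  \<open>1 / (q; q)_k\<close>. The exceptional values at \<open>n = 1\<close> are those for which
  the formula holds there.\<close>

lemma crank_gf_sum:
  defines "x \<equiv> xpow 1" and "y \<equiv> xpow (-1)"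
  shows "gf_of crank_coeff = (1 - fps_X) * fps_isum (qbinom_term x 0 0) +
    fps_isum (\<lambda>j. if j = 0 then 0 else (1 - fps_X) * (fps_const (y ^ j) * fps_X ^ j * (\<Prod>i\<in>{1..j}. geom_fps 1 i)) *
       fps_iprod (\<lambda>i. if i > j then geom_fps x i else 1))"
    (is "_ = ?A + fps_isum ?B")
proof (rule fps_ext)
  fix n
  have A: "?A $ n = (\<Sum>k\<le>n. ((1 - fps_X) * qbinom_term x 0 0 k) $ n)"
    by (subst fps_isum_mult_left[OF isum_adm_qbinom]) (simp add: fps_isum_def)
  have A0: "(1 - fps_X) * qbinom_term x 0 0 0 = 1 - fps_X"
    by (simp add: qbinom_term_def)
  have Ak: "(1 - fps_X) * qbinom_term x 0 0 k = fps_const (x ^ k) * fps_X ^ k * (\<Prod>i\<in>{2..k}. geom_fps 1 i)" if "k \<ge> 1" for k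
    unfolding prod_geom_from_2[OF that, symmetric] qbinom_term_def by (simp add: mult_ac)
  have B: "?B j $ n = y ^ j * (\<Prod>i\<in>{2..n}. geom_fps (if i > j then x else 1) i) $ (n - j)" if "1 \<le> j" "j \<le> n" for j
  proof -
    have adm: "iprod_adm (\<lambda>i. if i > j then geom_fps x i else 1)"
      by (rule iprod_admI) (auto simp: geom_fps_def dest: dvd_imp_le)
    have "?B j = fps_const (y ^ j) * fps_X ^ j * ((\<Prod>i\<in>{2..j}. geom_fps 1 i) * fps_iprod (\<lambda>i. if i > j then geom_fps x i else 1))"
      unfolding prod_geom_from_2[OF that(1), symmetric] using that by (simp add: mult_ac)
    hence "?B j $ n = y ^ j * ((\<Prod>i\<in>{2..j}. geom_fps 1 i) * fps_iprod (\<lambda>i. if i > j then geom_fps x i else 1)) $ (n - j)"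
      using that by (simp only: fps_const_X_power_mult_nth) simp
    also have "((\<Prod>i\<in>{2..j}. geom_fps 1 i) * fps_iprod (\<lambda>i. if i > j then geom_fps x i else 1)) $ (n - j) =
      ((\<Prod>i\<in>{2..j}. geom_fps 1 i) * (\<Prod>i\<in>{1..n}. if i > j then geom_fps x i else 1)) $ (n - j)"
      by (rule fps_mult_nth_cong) (auto simp: fps_iprod_nth[OF adm, of _ n])
    also have "(\<Prod>i\<in>{2..j}. geom_fps 1 i) * (\<Prod>i\<in>{1..n}. if i > j then geom_fps x i else 1) =
       (\<Prod>i\<in>{2..n}. geom_fps (if i > j then x else 1) i)"
    proof -
      have 1: "(\<Prod>i\<in>{1..n}. if i > j then geom_fps x i else 1) = (\<Prod>i\<in>{j<..n}. geom_fps x i)"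
        by (intro prod.mono_neutral_cong_right) auto
      have "{2..n} = {2..j} \<union> {j<..n}" using that by auto
      hence "(\<Prod>i\<in>{2..n}. geom_fps (if i > j then x else 1) i) =
         (\<Prod>i\<in>{2..j}. geom_fps (if i > j then x else 1) i) * (\<Prod>i\<in>{j<..n}. geom_fps (if i > j then x else 1) i)"
        by (simp only:) (rule prod.union_disjoint, auto)
      moreover have "(\<Prod>i\<in>{2..j}. geom_fps (if i > j then x else 1) i) = (\<Prod>i\<in>{2..j}. geom_fps 1 i)"
          "(\<Prod>i\<in>{j<..n}. geom_fps (if i > j then x else 1) i) = (\<Prod>i\<in>{j<..n}. geom_fps x i)"
        by (auto intro!: prod.cong)
      ultimately show ?thesis unfolding 1 by simp
    qed
    finally show ?thesis .
  qed
  have BB: "fps_isum ?B $ n = (\<Sum>j\<in>{1..n}. y ^ j * (\<Prod>i\<in>{2..n}. geom_fps (if i > j then x else 1) i) $ (n - j))"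
  proof -
    have "fps_isum ?B $ n = (\<Sum>j\<le>n. ?B j $ n)" by (simp add: fps_isum_def)
    also have "\<dots> = (\<Sum>j\<in>{1..n}. ?B j $ n)" by (rule sum.mono_neutral_right) auto
    also have "\<dots> = (\<Sum>j\<in>{1..n}. y ^ j * (\<Prod>i\<in>{2..n}. geom_fps (if i > j then x else 1) i) $ (n - j))"
      by (intro sum.cong refl B) auto
    finally show ?thesis .
  qed
  have cases: "n = 0 \<or> n = 1 \<or> n \<ge> 2" by auto
  show "gf_of crank_coeff $ n = (?A + fps_isum ?B) $ n"
    using cases
  proof (elim disjE)
    assume n: "n = 0"
    have "gf_of crank_coeff $ 0 = 1"
    proof -
      have "{- int 0 - 1..int 0 + 1} = {-1, 0, 1}" by auto
      thus ?thesis by (simp add: gf_of_def crank_coeff_def)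
    qed
    thus ?thesis using n A BB A0 by simp
  next
    assume n: "n = 1"
    have "{- int 1 - 1..int 1 + 1} = {-2, -1, 0, 1, 2}" by auto
    hence "gf_of crank_coeff $ 1 = x + y - 1"
      by (simp add: gf_of_def crank_coeff_def M_crank_def x_def y_def)
    \<comment> \<open>The \<open>-1\<close> stems from \<open>1 - q\<close> times the summand
      \<open>k = 0\<close>; it matches the convention \<open>M_crank 0 1 = -1\<close>.\<close>
    moreover have "?A $ 1 = x - 1"
    proof -
      have "(\<Sum>k\<le>1. f k) = f 0 + f 1" for f :: "nat \<Rightarrow> rat fps" by simp
      thus ?thesis unfolding A[unfolded n] by (simp only: A0 Ak[OF order_refl] fps_const_X_power_mult_nth) simp
    qed
    moreover have "fps_isum ?B $ 1 = y" unfolding BB[unfolded n] by simp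
    ultimately show ?thesis using n by simp
  next
    assume n: "n \<ge> 2"
    have "?A $ n = (\<Sum>k\<in>{2..n}. ((1 - fps_X) * qbinom_term x 0 0 k) $ n)"
      unfolding A
    proof (rule sum.mono_neutral_right)
      show "\<forall>i\<in>{..n} - {2..n}. ((1 - fps_X) * qbinom_term x 0 0 i) $ n = 0"
      proof
        fix i assume "i \<in> {..n} - {2..n}"
        hence "i = 0 \<or> i = 1" by auto
        thus "((1 - fps_X) * qbinom_term x 0 0 i) $ n = 0"
          using n A0 Ak[of 1] by auto
      qed
    qed auto
    also have "\<dots> = (\<Sum>k\<in>{2..n}. x ^ k * (\<Prod>i\<in>{2..k}. geom_fps 1 i) $ (n - k))"
    proof (intro sum.cong refl)
      fix k assume "k \<in> {2..n}"
      hence k: "k \<ge> 1" "k \<le> n" by auto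
      show "((1 - fps_X) * qbinom_term x 0 0 k) $ n = x ^ k * (\<Prod>i\<in>{2..k}. geom_fps 1 i) $ (n - k)"
        unfolding Ak[OF k(1)] fps_const_X_power_mult_nth using k by simp
    qed
    also have "\<dots> = (\<Sum>p\<in>{p\<in>partitions n. count p 1 = 0}. xpow (int (Max (set_mset p))))"
      using n unfolding x_def by (subst sum_partitions_no_ones) auto
    also have "\<dots> = (\<Sum>p\<in>{p\<in>partitions n. count p 1 = 0}. xpow (crank p))"
      by (intro sum.cong) (auto simp: crank_def)
    finally have A': "?A $ n = (\<Sum>p\<in>{p\<in>partitions n. count p 1 = 0}. xpow (crank p))" .
    have B': "fps_isum ?B $ n = (\<Sum>p\<in>{p\<in>partitions n. count p 1 \<noteq> 0}. xpow (crank p))"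
      using BB sum_partitions_ones[of n] n unfolding x_def y_def by simp
    have un: "partitions n = {p\<in>partitions n. count p 1 = 0} \<union> {p\<in>partitions n. count p 1 \<noteq> 0}" by blast
    have "(\<Sum>p\<in>{p\<in>partitions n. count p 1 = 0} \<union> {p\<in>partitions n. count p 1 \<noteq> 0}. xpow (crank p)) = ?A $ n + fps_isum ?B $ n"
      unfolding A' B' by (rule sum.union_disjoint) (simp add: finite_partitions, simp add: finite_partitions, blast)
    hence "(\<Sum>p\<in>partitions n. xpow (crank p)) = ?A $ n + fps_isum ?B $ n" by (simp only: un[symmetric])
    thus ?thesis using gf_of_crank_nth[OF n] by simp
  qed
qed

abbreviation euler_prod :: "'a :: comm_ring_1 fps" where
  "euler_prod \<equiv> fps_iprod (\<lambda>i. 1 - fps_X ^ i)"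

text \<open>The q-binomial theorem is used twice: with \<open>u = 0\<close> it sums the partitions
  without ones, with \<open>u = x\<close> and \<open>y = 1 / x\<close> it sums over the number of
  ones. In the second case \<open>y u = 1\<close>, so the numerator is free of \<open>x\<close> and
  completes to the Euler product.\<close>

theorem crank_gf_product:
  "gf_of crank_coeff = euler_prod * fps_iprod (geom_fps (xpow 1)) * fps_iprod (geom_fps (xpow (-1)))"
proof -
  define x y where "x = xpow 1" and "y = xpow (-1)"
  have yx: "y * x = 1" by (simp add: x_def y_def xpow_add[symmetric])
  define Gx Gy where "Gx = fps_iprod (geom_fps x)" and "Gy = fps_iprod (geom_fps y)"
  have "fps_iprod (\<lambda>i. 1 - fps_const x * fps_X ^ i) * fps_isum (qbinom_term x 0 0) = 1"
    unfolding qbinomial_theorem by (simp add: fps_iprod_1)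
  hence "Gx * (fps_iprod (\<lambda>i. 1 - fps_const x * fps_X ^ i) * fps_isum (qbinom_term x 0 0)) = Gx" by simp
  moreover have "Gx * (fps_iprod (\<lambda>i. 1 - fps_const x * fps_X ^ i) * fps_isum (qbinom_term x 0 0)) =
     (fps_iprod (\<lambda>i. 1 - fps_const x * fps_X ^ i) * Gx) * fps_isum (qbinom_term x 0 0)" by (simp only: mult_ac)
  ultimately have euler: "fps_isum (qbinom_term x 0 0) = Gx"
    unfolding Gx_def iprod_one_minus_mult_geom by simp
  have summand: "(if j = 0 then 0 else (1 - fps_X) * (fps_const (y ^ j) * fps_X ^ j * (\<Prod>i\<in>{1..j}. geom_fps 1 i)) *
       fps_iprod (\<lambda>i. if i > j then geom_fps x i else 1)) =
     (1 - fps_X) * Gx * (qbinom_term y x 0 j - (if j = 0 then 1 else 0))" for j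
    unfolding iprod_tail_geom Gx_def[symmetric] by (cases "j = 0") (simp_all add: qbinom_term_def mult_ac)
  have adm: "isum_adm (\<lambda>j. qbinom_term y x 0 j - (if j = 0 then 1 else 0))"
    using isum_adm_qbinom[of y x 0] by (auto simp: isum_adm_def)
  have one: "fps_isum (\<lambda>j. if j = 0 then 1 else 0 :: rat fps fps) = 1"
    by (simp add: fps_isum_def fps_eq_iff if_distrib[of "\<lambda>x. x $ _"] cong: if_cong)
  have "gf_of crank_coeff = (1 - fps_X) * Gx + (1 - fps_X) * Gx * (fps_isum (qbinom_term y x 0) - 1)"
    unfolding crank_gf_sum x_def[symmetric] y_def[symmetric] euler summand
    by (simp only: fps_isum_mult_left[OF adm, symmetric] fps_isum_diff one)
  hence C: "gf_of crank_coeff = (1 - fps_X) * Gx * fps_isum (qbinom_term y x 0)" by (simp add: algebra_simps)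
  have shift: "(1 - fps_X) * fps_iprod (\<lambda>i. 1 - fps_X ^ Suc i) = (euler_prod :: rat fps fps)"
  proof (rule fps_ext)
    fix n
    have adm1: "iprod_adm (\<lambda>i. 1 - fps_X ^ Suc i :: rat fps fps)" "iprod_adm (\<lambda>i. 1 - fps_X ^ i :: rat fps fps)"
      by (auto intro!: iprod_admI simp: fps_X_power_nth simp del: power_Suc)
    have "((1 - fps_X) * fps_iprod (\<lambda>i. 1 - fps_X ^ Suc i)) $ n =
        ((1 - fps_X) * (\<Prod>i\<in>{1..n}. 1 - fps_X ^ Suc i :: rat fps fps)) $ n"
      by (rule fps_mult_nth_cong) (simp, rule fps_iprod_nth[OF adm1(1)])
    also have "(1 - fps_X) * (\<Prod>i\<in>{1..n}. 1 - fps_X ^ Suc i :: rat fps fps) = (\<Prod>i\<in>{1..Suc n}. 1 - fps_X ^ i)"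
      by (subst prod.atLeast_Suc_atMost) (simp_all only: prod.shift_bounds_cl_Suc_ivl, simp_all)
    also have "\<dots> $ n = euler_prod $ n" by (rule fps_iprod_nth[OF adm1(2), symmetric]) simp
    finally show "((1 - fps_X) * fps_iprod (\<lambda>i. 1 - fps_X ^ Suc i)) $ n = (euler_prod :: rat fps fps) $ n" .
  qed
  have "gf_of crank_coeff = (fps_iprod (\<lambda>i. 1 - fps_const y * fps_X ^ i) * Gy) * gf_of crank_coeff"
    unfolding Gy_def iprod_one_minus_mult_geom by simp
  also have "\<dots> = (1 - fps_X) * Gx * Gy * (fps_iprod (\<lambda>i. 1 - fps_const y * fps_X ^ i) * fps_isum (qbinom_term y x 0))"
    unfolding C by (simp only: mult_ac)
  also have "\<dots> = ((1 - fps_X) * fps_iprod (\<lambda>i. 1 - fps_X ^ Suc i)) * Gx * Gy"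
    unfolding qbinomial_theorem yx by (simp only: fps_const_1_eq_1 mult_1_left mult_ac)
  finally show ?thesis unfolding shift Gx_def Gy_def x_def y_def .
qed

subsection \<open>Moments\<close>

text \<open>\<open>fact j\<close> turns the coefficient of \<open>t ^ j\<close> into a moment:
  \<open>exp (m t)\<close> yields \<open>m ^ j\<close>.\<close>

definition emom :: "nat \<Rightarrow> rat fps fps \<Rightarrow> rat fps" where
  "emom j F = Abs_fps (\<lambda>n. fact j * F $ n $ j)"

definition fps_Dt :: "rat fps fps \<Rightarrow> rat fps fps" where
  "fps_Dt F = Abs_fps (\<lambda>n. fps_deriv (F $ n))"

definition fps_Dq :: "rat fps fps \<Rightarrow> rat fps fps" where
  "fps_Dq F = Abs_fps (\<lambda>n. of_nat n * F $ n)"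

definition fps_emb :: "rat fps \<Rightarrow> rat fps fps" where
  "fps_emb F = Abs_fps (\<lambda>n. fps_const (F $ n))"

lemma emom_add: "emom j (F + G) = emom j F + emom j G"
  by (simp add: emom_def fps_eq_iff algebra_simps)

lemma emom_diff: "emom j (F - G) = emom j F - emom j G"
  by (simp add: emom_def fps_eq_iff algebra_simps)

lemma emom_Dt: "emom j (fps_Dt F) = emom (Suc j) F"
  by (simp add: emom_def fps_Dt_def fps_eq_iff mult_ac)

lemma emom_Dq: "emom j (fps_Dq F) = delta_q (emom j F)"
  by (simp add: emom_def fps_Dq_def delta_q_def fps_eq_iff flip: fps_of_nat)

lemma emom_mult: "emom j (F * G) = (\<Sum>i\<le>j. of_nat (j choose i) * (emom i F * emom (j - i) G))"
proof (rule fps_ext)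
  fix n
  have c: "fact j = of_nat (j choose i) * (fact i * fact (j - i) :: rat)" if "i \<le> j" for i
    using binomial_fact_lemma[OF that] by (metis mult.commute of_nat_fact of_nat_mult)
  have "emom j (F * G) $ n = fact j * (\<Sum>k=0..n. \<Sum>i=0..j. F $ k $ i * G $ (n - k) $ (j - i))"
    by (simp add: emom_def fps_mult_nth[of F G] fps_sum_nth fps_mult_nth)
  also have "\<dots> = (\<Sum>i=0..j. \<Sum>k=0..n. fact j * (F $ k $ i * G $ (n - k) $ (j - i)))"
    by (subst sum.swap) (simp add: sum_distrib_left)
  also have "\<dots> = (\<Sum>i=0..j. \<Sum>k=0..n. of_nat (j choose i) * ((fact i * F $ k $ i) * (fact (j - i) * G $ (n - k) $ (j - i))))"
    by (intro sum.cong refl) (simp add: c mult_ac)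
  also have "\<dots> = (\<Sum>i\<le>j. of_nat (j choose i) * (emom i F * emom (j - i) G)) $ n"
    by (simp add: fps_sum_nth atLeast0AtMost emom_def fps_mult_nth[of "Abs_fps _"] sum_distrib_left flip: fps_of_nat)
  finally show "emom j (F * G) $ n = (\<Sum>i\<le>j. of_nat (j choose i) * (emom i F * emom (j - i) G)) $ n" .
qed

lemma fps_Dt_mult: "fps_Dt (F * G) = fps_Dt F * G + F * fps_Dt G"
  by (simp add: fps_Dt_def fps_eq_iff fps_mult_nth fps_deriv_sum sum.distrib)

lemma fps_Dt_cong: "(\<And>k. k \<le> n \<Longrightarrow> F $ k = G $ k) \<Longrightarrow> fps_Dt F $ n = fps_Dt G $ n"
  by (simp add: fps_Dt_def)

lemma fps_const_sum: "fps_const (sum f A) = (\<Sum>a\<in>A. fps_const (f a))"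
  by (induction A rule: infinite_finite_induct) (simp_all add: fps_const_add[symmetric] del: fps_const_add)

lemma fps_emb_mult: "fps_emb (F * G) = fps_emb F * fps_emb G"
  by (simp add: fps_emb_def fps_eq_iff fps_mult_nth[of F] fps_mult_nth[of "Abs_fps _"] fps_const_sum)

lemma fps_emb_1: "fps_emb 1 = 1"
  by (simp add: fps_emb_def fps_eq_iff)

lemma fps_emb_add: "fps_emb (F + G) = fps_emb F + fps_emb G"
  by (simp add: fps_emb_def fps_eq_iff fps_const_add[symmetric] del: fps_const_add)

lemma fps_emb_sum: "fps_emb (sum f A) = (\<Sum>a\<in>A. fps_emb (f a))"
proof -
  have "fps_emb 0 = 0" by (simp add: fps_emb_def fps_eq_iff)
  thus ?thesis by (induction A rule: infinite_finite_induct) (auto simp: fps_emb_add)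
qed

lemma fps_emb_X_power: "fps_emb (fps_X ^ k) = fps_X ^ k"
  by (simp add: fps_emb_def fps_eq_iff fps_X_power_nth)

lemma fps_emb_power: "fps_emb (F ^ k) = fps_emb F ^ k"
  by (induction k) (auto simp: fps_emb_1 fps_emb_mult)

lemma emom_emb_mult: "emom j (fps_emb F * G) = F * emom j G"
proof (rule fps_ext)
  fix n
  have "(fps_emb F * G) $ n = (\<Sum>i=0..n. fps_const (F $ i) * G $ (n - i))"
    by (simp add: fps_mult_nth fps_emb_def)
  thus "emom j (fps_emb F * G) $ n = (F * emom j G) $ n"
    by (simp add: emom_def fps_sum_nth fps_mult_nth[of F] sum_distrib_left mult_ac)
qed

text \<open>A Lambert series: coefficient \<open>n\<close> collects \<open>x ^ (s d)\<close> over
  the complementary divisors \<open>d = n / i\<close>, and their \<open>j\<close>-th moments add up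
  to \<open>s ^ j\<close> times the divisor sum.\<close>

lemma emom_geom_gf:
  "emom j (Abs_fps (\<lambda>n. \<Sum>i\<in>{1..n}. (geom_fps (xpow s) i - 1) $ n)) = of_int s ^ j * Phi j"
proof (rule fps_ext)
  fix n
  have "(\<Sum>i\<in>{1..n}. (geom_fps (xpow s) i - 1) $ n $ j) = (\<Sum>i\<in>{i\<in>{1..n}. i dvd n}. (xpow s ^ (n div i)) $ j)"
    by (intro sum.mono_neutral_cong_right) (auto simp: geom_fps_def)
  also have "\<dots> = (\<Sum>i\<in>{i\<in>{1..n}. i dvd n}. of_int s ^ j * of_nat (n div i) ^ j / fact j)"
    by (intro sum.cong refl) (simp add: xpow_power xpow_nth power_mult_distrib mult.commute)
  also have "\<dots> = (\<Sum>d\<in>{i\<in>{1..n}. i dvd n}. of_int s ^ j * of_nat d ^ j / fact j)"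
    by (rule sum.reindex_bij_witness[where i = "\<lambda>d. n div d" and j = "\<lambda>d. n div d"])
       (auto simp: Suc_le_eq div_greater_zero_iff dvd_imp_le elim!: dvdE)
  finally have eq: "(\<Sum>i\<in>{1..n}. (geom_fps (xpow s) i - 1) $ n $ j) =
     (\<Sum>d\<in>{i\<in>{1..n}. i dvd n}. of_int s ^ j * of_nat d ^ j / fact j)" .
  have "{i\<in>{1..n}. i dvd n} = {d. d dvd n}" if "n \<noteq> 0"
    using that by (auto dest: dvd_imp_le intro: Nat.gr0I simp: Suc_le_eq)
  hence "(\<Sum>d\<in>{i\<in>{1..n}. i dvd n}. of_int s ^ j * of_nat d ^ j / fact j) = of_int s ^ j * Phi j $ n / fact j"
    by (cases "n = 0") (auto simp: Phi_def Defs.sigma_def sum_distrib_left sum_divide_distrib)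
  thus "emom j (Abs_fps (\<lambda>n. \<Sum>i\<in>{1..n}. (geom_fps (xpow s) i - 1) $ n)) $ n = (of_int s ^ j * Phi j) $ n"
  proof -
    have "(of_int s ^ j * Phi j) $ n = of_int s ^ j * Phi j $ n"
      by (simp add: fps_of_int[symmetric] fps_const_power)
    moreover have "emom j (Abs_fps (\<lambda>n. \<Sum>i\<in>{1..n}. (geom_fps (xpow s) i - 1) $ n)) $ n =
        fact j * (\<Sum>i\<in>{1..n}. (geom_fps (xpow s) i - 1) $ n $ j)"
      by (simp add: emom_def fps_sum_nth)
    ultimately show ?thesis using \<open>_ = of_int s ^ j * Phi j $ n / fact j\<close> unfolding eq by simp
  qed
qed

lemma fps_Dt_iprod_geom:
  "fps_Dt (fps_iprod (geom_fps (xpow s))) = fps_iprod (geom_fps (xpow s)) *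
     (of_int s * Abs_fps (\<lambda>n. \<Sum>i\<in>{1..n}. (geom_fps (xpow s) i - 1) $ n))"
proof -
  have "fps_Dt (fps_iprod (geom_fps (xpow s))) = fps_iprod (geom_fps (xpow s)) *
     Abs_fps (\<lambda>n. \<Sum>i\<in>{1..n}. (of_int s * (geom_fps (xpow s) i - 1)) $ n)"
  proof (rule iprod_log_derivative[OF fps_Dt_mult fps_Dt_cong])
    show "iprod_adm (geom_fps (xpow s))" using iprod_adm_geom[of "\<lambda>_. xpow s"] by simp
    fix i :: nat assume i: "i > 0"
    let ?g = "geom_fps (xpow s) i" and ?u = "fps_const (xpow s) * fps_X ^ i"
    have 1: "(1 - ?u) * ?g = 1" by (rule geom_fps_inverse[OF i])
    have d: "fps_Dt (1 - ?u) = - (of_int s * ?u)"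
      by (simp add: fps_Dt_def fps_eq_iff fps_X_power_nth xpow_deriv flip: fps_of_int)
    have "0 = fps_Dt ((1 - ?u) * ?g)" unfolding 1 by (auto simp: fps_Dt_def fps_eq_iff)
    also have "\<dots> = - (of_int s * ?u) * ?g + (1 - ?u) * fps_Dt ?g"
      unfolding fps_Dt_mult d ..
    finally have "(1 - ?u) * fps_Dt ?g = of_int s * (?u * ?g)" by (simp add: mult_ac)
    hence "?g * ((1 - ?u) * fps_Dt ?g) = ?g * (of_int s * (?u * ?g))" by simp
    moreover have "?g * ((1 - ?u) * fps_Dt ?g) = ((1 - ?u) * ?g) * fps_Dt ?g" by (simp only: mult_ac)
    hence "?g * ((1 - ?u) * fps_Dt ?g) = fps_Dt ?g" by (simp only: 1 mult_1_left)
    ultimately show "fps_Dt ?g = ?g * (of_int s * (?g - 1))"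
      using geom_fps_minus_1[OF i, of "xpow s"] by simp
  next
    fix i n :: nat assume "n < i"
    thus "(of_int s * (geom_fps (xpow s) i - 1)) $ n = 0"
      by (auto simp: geom_fps_def simp flip: fps_of_int dest: dvd_imp_le)
  qed auto
  also have "Abs_fps (\<lambda>n. \<Sum>i\<in>{1..n}. (of_int s * (geom_fps (xpow s) i - 1)) $ n) =
     of_int s * Abs_fps (\<lambda>n. \<Sum>i\<in>{1..n}. (geom_fps (xpow s) i - 1) $ n)"
    by (simp add: fps_eq_iff sum_distrib_left flip: fps_of_int)
  finally show ?thesis .
qed

lemma fps_Dt_euler_prod: "fps_Dt euler_prod = 0"
proof -
  have "fps_Dt euler_prod = euler_prod * Abs_fps (\<lambda>n. \<Sum>i\<in>{1..n}. (0 :: rat fps fps) $ n)"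
  proof (rule iprod_log_derivative[OF fps_Dt_mult fps_Dt_cong])
    show "iprod_adm (\<lambda>i. 1 - fps_X ^ i :: rat fps fps)" by (rule iprod_admI) (auto simp: fps_X_power_nth)
  qed (auto simp: fps_Dt_def fps_eq_iff fps_X_power_nth)
  thus ?thesis by (simp add: fps_eq_iff fps_mult_nth)
qed

lemma euler_prod_emb_Pser: "euler_prod * fps_emb Pser = 1"
proof -
  have "fps_emb Pser = fps_iprod (geom_fps 1)"
  proof (rule fps_ext)
    fix n
    have "fps_iprod (geom_fps 1) $ n = (\<Sum>p\<in>parts_in {1..n} n. prod_mset (image_mset (\<lambda>_. 1 :: rat fps) p))"
      by (subst parts_in_gf) (auto simp: fps_iprod_def)
    also have "\<dots> = of_nat (card (partitions n))"
      by (simp add: partitions_eq_parts_in[of n n] image_mset_const_eq)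
    finally show "fps_emb Pser $ n = fps_iprod (geom_fps 1) $ n"
      by (simp add: fps_emb_def Pser_nth fps_of_nat)
  qed
  thus ?thesis using iprod_one_minus_mult_geom[of "1 :: rat fps"] by simp
qed

abbreviation crank_gf :: "rat fps fps" where
  "crank_gf \<equiv> gf_of crank_coeff"

text \<open>The Euler product does not depend on \<open>t\<close>; the factors in \<open>x\<close>
  and \<open>1 / x\<close> contribute \<open>Phi j\<close> and \<open>- (-1) ^ j Phi j\<close> to
  the logarithmic derivative.\<close>

lemma crank_gf_Dt:
  "\<exists>L. fps_Dt crank_gf = crank_gf * L \<and> (\<forall>j. emom j L = (if odd j then 2 * Phi j else 0))"
proof -
  define H where "H s = Abs_fps (\<lambda>n. \<Sum>i\<in>{1..n}. (geom_fps (xpow s) i - 1) $ n)" for s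
  have "fps_Dt crank_gf = crank_gf * (H 1 - H (-1))"
    unfolding crank_gf_product fps_Dt_mult fps_Dt_iprod_geom fps_Dt_euler_prod H_def[symmetric]
    by (simp add: algebra_simps)
  moreover have "emom j (H 1 - H (-1)) = (if odd j then 2 * Phi j else 0)" for j
    unfolding emom_diff H_def emom_geom_gf by simp
  ultimately show ?thesis by blast
qed

lemma emom_gf_of:
  "emom j (gf_of f) $ n = (\<Sum>m\<in>{- int n - 1..int n + 1}. of_int m ^ j * f m $ n)"
  by (simp add: emom_def gf_of_def fps_sum_nth xpow_nth sum_distrib_left mult_ac)

text \<open>Setting \<open>x = 1\<close> counts partitions; at \<open>n = 1\<close> the exceptional
  values \<open>1 + 1 - 1\<close> still add up to 1.\<close>

lemma emom_crank_0: "emom 0 crank_gf = Pser"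
proof (rule fps_ext)
  fix n :: nat
  show "emom 0 crank_gf $ n = Pser $ n"
  proof (cases "n \<ge> 2")
    case True
    thus ?thesis by (simp add: emom_def gf_of_crank_nth fps_sum_nth xpow_nth Pser_nth)
  next
    case False
    have p1: "partitions 1 = {{#1#}}"
    proof (intro equalityI subsetI)
      fix p assume p: "p \<in> partitions 1"
      have "size p = 1" "Max (set_mset p) = 1" using partition_Max[OF p] by auto
      moreover obtain x where "p = {#x#}" using \<open>size p = 1\<close> size_1_singleton_mset by blast
      ultimately show "p \<in> {{#1#}}" by simp
    qed (auto simp: partitions_def)
    consider "n = 0" | "n = 1" using False by linarith
    thus ?thesis
    proof cases
      case 1
      have "{- int 0 - 1..int 0 + 1} = {-1, 0, 1}" by auto
      thus ?thesis using 1 by (simp add: emom_gf_of crank_coeff_def Pser_nth partitions_0)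
    next
      case 2
      have "{- int 1 - 1..int 1 + 1} = {-2, -1, 0, 1, 2}" by auto
      thus ?thesis using 2 p1 by (simp add: emom_gf_of crank_coeff_def M_crank_def Pser_nth)
    qed
  qed
qed

lemma Cser_eq_emom:
  assumes "j > 0"
  shows "Cser j = emom j crank_gf"
proof (rule fps_ext)
  fix n :: nat
  show "Cser j $ n = emom j crank_gf $ n"
  proof (cases "n = 0")
    case True
    have "{- int 0 - 1..int 0 + 1} = {-1, 0, 1}" by auto
    thus ?thesis using True assms by (simp add: emom_gf_of crank_coeff_def Cser_def)
  next
    case False
    have M0: "M_crank m n = 0" if "m \<notin> {- int n - 1..int n + 1}" for m
    proof (cases "n = 1")
      case False
      have "crank p \<noteq> m" if "p \<in> partitions n" for p
        using crank_bounds[OF that] \<open>n \<noteq> 0\<close> \<open>m \<notin> _\<close> by auto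
      hence "{p \<in> partitions n. crank p = m} = {}" by auto
      thus ?thesis using False by (simp only: M_crank_def if_False card.empty of_nat_0)
    qed (use that in \<open>auto simp: M_crank_def\<close>)
    have "M_mom j n = (\<Sum>m\<in>{- int n - 1..int n + 1}. m ^ j * M_crank m n)"
      unfolding M_mom_def 
      by (rule Sum_any.expand_superset) (simp, rule subsetI, rule ccontr, simp add: M0 del: atLeastAtMost_iff)
    thus ?thesis using False by (simp add: Cser_def emom_gf_of crank_coeff_def)
  qed
qed

lemma crank_moment_rec:
  "emom (Suc j) crank_gf = (\<Sum>i\<le>j. of_nat (j choose i) * (emom i crank_gf * (if odd (j - i) then 2 * Phi (j - i) else 0)))"
  using crank_gf_Dt emom_Dt[of j crank_gf] by (auto simp: emom_mult)

lemma crank_moment_odd: "odd j \<Longrightarrow> emom j crank_gf = 0"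
proof (induction j rule: less_induct)
  case (less j)
  then obtain i where j: "j = Suc i" by (cases j) auto
  have i: "even i" using less.prems j by simp
  have "emom k crank_gf * (if odd (i - k) then 2 * Phi (i - k) else 0) = 0" if "k \<le> i" for k
    using less.IH[of k] i that j by (cases "odd k") auto
  thus ?case unfolding j crank_moment_rec by (intro sum.neutral ballI) (simp only: atMost_iff mult_zero_right)
qed

lemma emom_crank_2: "emom 2 crank_gf = 2 * (Pser * Phi 1)"
  using crank_moment_rec[of 1] by (simp add: emom_crank_0 numeral_2_eq_2 crank_moment_odd)

subsection \<open>Laurent coefficients of the cube of the crank generating function\<close>

text \<open>\<open>inv_qpoch j\<close> is \<open>1 / (q; q)\<^sub>j\<close>, the coefficient of \<open>x ^ j\<close> in \<open>1 / (x; q)\<^sub>\<infinity>\<close>.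
  The outer variable of the generating function \<open>inv_qpoch_gf\<close> plays the role of \<open>x\<close>.\<close>

definition inv_qpoch :: "nat \<Rightarrow> rat fps" where
  "inv_qpoch j = (\<Prod>i\<in>{1..j}. geom_fps 1 i)"

definition inv_qpoch_gf :: "rat fps fps" where
  "inv_qpoch_gf = Abs_fps inv_qpoch"

text \<open>The substitution of \<open>x q\<close> for \<open>x\<close>, with \<open>x\<close> the
  outer variable.\<close>

definition fps_scale :: "rat fps fps \<Rightarrow> rat fps fps" where
  "fps_scale F = Abs_fps (\<lambda>i. fps_X ^ i * F $ i)"

definition int_nth :: "rat fps fps \<Rightarrow> int \<Rightarrow> rat fps" where
  "int_nth F i = (if i < 0 then 0 else F $ nat i)"

lemma fps_scale_mult: "fps_scale (F * G) = fps_scale F * fps_scale G"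
proof (rule fps_ext)
  fix n
  have aux: "fps_X ^ n * (F $ i * G $ (n - i)) = fps_X ^ i * F $ i * (fps_X ^ (n - i) * G $ (n - i))" if "i \<le> n" for i
  proof -
    have "fps_X ^ n = fps_X ^ i * (fps_X ^ (n - i) :: rat fps)" using that by (simp flip: power_add)
    thus ?thesis by (simp only: mult_ac)
  qed
  have "fps_scale (F * G) $ n = (\<Sum>i=0..n. fps_X ^ n * (F $ i * G $ (n - i)))"
    by (simp add: fps_scale_def fps_mult_nth[of F] sum_distrib_left)
  also have "\<dots> = (\<Sum>i=0..n. fps_X ^ i * F $ i * (fps_X ^ (n - i) * G $ (n - i)))"
    by (intro sum.cong refl aux) simp
  finally show "fps_scale (F * G) $ n = (fps_scale F * fps_scale G) $ n"
    by (simp add: fps_scale_def fps_mult_nth[of "Abs_fps _"])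
qed

text \<open>Passing from \<open>x\<close> to \<open>x q\<close> removes the first factor
  \<open>1 - x\<close> of the product; on coefficients this is the step from
  \<open>inv_qpoch j\<close> to \<open>inv_qpoch (Suc j)\<close>.\<close>

lemma fps_scale_inv_qpoch: "fps_scale inv_qpoch_gf = (1 - fps_X) * inv_qpoch_gf"
proof (rule fps_ext)
  fix n
  show "fps_scale inv_qpoch_gf $ n = ((1 - fps_X) * inv_qpoch_gf) $ n"
  proof (cases n)
    case 0
    thus ?thesis by (simp add: fps_scale_def inv_qpoch_gf_def)
  next
    case (Suc j)
    have g: "(1 - fps_X ^ Suc j) * geom_fps 1 (Suc j) = (1 :: rat fps)"
      using geom_fps_inverse[of "Suc j" "1 :: rat"] by (simp del: power_Suc)
    have "(1 - fps_X ^ Suc j) * inv_qpoch (Suc j) = ((1 - fps_X ^ Suc j) * geom_fps 1 (Suc j)) * inv_qpoch j"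
      by (simp add: inv_qpoch_def mult_ac)
    hence "inv_qpoch (Suc j) - fps_X ^ Suc j * inv_qpoch (Suc j) = inv_qpoch j"
      unfolding g by (simp add: algebra_simps)
    thus ?thesis unfolding Suc
      by (simp add: fps_scale_def inv_qpoch_gf_def left_diff_distrib algebra_simps del: power_Suc)
  qed
qed

lemma int_nth_one_minus_X: "int_nth ((1 - fps_X) * F) i = int_nth F i - int_nth F (i - 1)"
proof -
  consider "i < 0" | "i = 0" | "i > 0" by linarith
  thus ?thesis
  proof cases
    case 3
    hence "nat i \<noteq> 0" "nat i - 1 = nat (i - 1)" by auto
    thus ?thesis using 3 by (simp add: int_nth_def left_diff_distrib)
  qed (auto simp: int_nth_def left_diff_distrib)
qed

text \<open>Coefficients of \<open>1 / (x; q) ^ 3\<close>, the infinite product being meant,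
  extended by 0 to negative indices so that differences need no case split; \<open>sw_coeff\<close>
  belongs to \<open>1 / (x q; q) ^ 3\<close>.\<close>

definition w_coeff :: "int \<Rightarrow> rat fps" where
  "w_coeff = int_nth (inv_qpoch_gf ^ 3)"

definition sw_coeff :: "int \<Rightarrow> rat fps" where
  "sw_coeff = int_nth (fps_scale (inv_qpoch_gf ^ 3))"

lemma sw_coeff_eq: "sw_coeff i = (if i < 0 then 0 else fps_X ^ nat i * w_coeff i)"
  by (simp add: sw_coeff_def w_coeff_def int_nth_def fps_scale_def)

lemma w_coeff_third_difference:
  "w_coeff i - 3 * w_coeff (i - 1) + 3 * w_coeff (i - 2) - w_coeff (i - 3) = sw_coeff i"
proof -
  have "fps_scale (inv_qpoch_gf ^ 3) = (1 - fps_X) * ((1 - fps_X) * ((1 - fps_X) * inv_qpoch_gf ^ 3))"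
    by (simp add: power3_eq_cube fps_scale_mult fps_scale_inv_qpoch mult_ac)
  thus ?thesis unfolding sw_coeff_def w_coeff_def by (simp only: int_nth_one_minus_X) (simp add: algebra_simps)
qed

text \<open>Coefficient of \<open>x ^ m\<close> in \<open>1 / ((x; q) ^ 3 (q / x; q) ^ 3)\<close>,
  expanded for \<open>|q| < |x| < 1\<close>; as \<open>(q / x) ^ j\<close> brings
  \<open>q ^ j\<close>, the sum may stop at \<open>n\<close>. In \<open>beta\<close> the first
  product starts at \<open>x q\<close>, which removes the pole at \<open>x = 1\<close>.\<close>

definition alpha :: "int \<Rightarrow> rat fps" where
  "alpha m = Abs_fps (\<lambda>n. \<Sum>j\<le>n. (w_coeff (m + int j) * w_coeff (int j) * fps_X ^ j) $ n)"

definition beta :: "int \<Rightarrow> rat fps" where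
  "beta m = Abs_fps (\<lambda>n. \<Sum>j\<le>n. (sw_coeff (m + int j) * w_coeff (int j) * fps_X ^ j) $ n)"

text \<open>Multiplication by \<open>(1 - x) ^ 3\<close> cancels the first factor of
  \<open>(x; q) ^ 3\<close>.\<close>

lemma alpha_third_difference: "alpha m - 3 * alpha (m - 1) + 3 * alpha (m - 2) - alpha (m - 3) = beta m"
proof (rule fps_ext)
  fix n
  have "sw_coeff (m + int j) * w_coeff (int j) * fps_X ^ j =
     w_coeff (m + int j) * w_coeff (int j) * fps_X ^ j - fps_const 3 * (w_coeff (m - 1 + int j) * w_coeff (int j) * fps_X ^ j)
     + fps_const 3 * (w_coeff (m - 2 + int j) * w_coeff (int j) * fps_X ^ j) - w_coeff (m - 3 + int j) * w_coeff (int j) * fps_X ^ j" for j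
    unfolding w_coeff_third_difference[symmetric] by (simp add: algebra_simps numeral_fps_const)
  hence "beta m $ n = (\<Sum>j\<le>n. (w_coeff (m + int j) * w_coeff (int j) * fps_X ^ j - fps_const 3 * (w_coeff (m - 1 + int j) * w_coeff (int j) * fps_X ^ j)
     + fps_const 3 * (w_coeff (m - 2 + int j) * w_coeff (int j) * fps_X ^ j) - w_coeff (m - 3 + int j) * w_coeff (int j) * fps_X ^ j) $ n)"
    by (simp add: beta_def)
  also have "\<dots> = (alpha m - fps_const 3 * alpha (m - 1) + fps_const 3 * alpha (m - 2) - alpha (m - 3)) $ n"
    by (simp only: fps_sub_nth fps_add_nth fps_mult_left_const_nth sum_subtractf sum.distrib sum_distrib_left[symmetric]
        alpha_def fps_nth_Abs_fps)
  finally show "(alpha m - 3 * alpha (m - 1) + 3 * alpha (m - 2) - alpha (m - 3)) $ n = beta m $ n"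
    by (simp add: numeral_fps_const)
qed

lemma w_coeff_neg: "i < 0 \<Longrightarrow> w_coeff i = 0"
  by (simp add: w_coeff_def int_nth_def)

lemma fps_mult_X_power_nth_shift: "n < k \<Longrightarrow> (F * fps_X ^ k) $ n = 0" for F :: "rat fps"
  by (simp add: fps_X_power_mult_right_nth)

text \<open>The function is invariant under \<open>x\<close> to \<open>q / x\<close>, which
  preserves the annulus \<open>|q| < |x| < 1\<close>.\<close>

lemma alpha_reflect:
  assumes "m \<ge> 0"
  shows "alpha (- m) = fps_X ^ nat m * alpha m"
proof (rule fps_ext)
  fix n
  define k where "k = nat m"
  have m: "m = int k" using assms by (simp add: k_def)
  have "alpha (- m) $ n = (\<Sum>j\<le>n. (w_coeff (int j - int k) * w_coeff (int j) * fps_X ^ j) $ n)"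
    by (simp add: alpha_def m)
  also have "\<dots> = (\<Sum>j\<in>{k..n}. (w_coeff (int j - int k) * w_coeff (int j) * fps_X ^ j) $ n)"
    by (intro sum.mono_neutral_right) (auto simp: w_coeff_neg not_le)
  also have "\<dots> = (if n < k then 0 else alpha m $ (n - k))"
  proof (cases "n < k")
    case False
    have "(\<Sum>j\<in>{k..n}. (w_coeff (int j - int k) * w_coeff (int j) * fps_X ^ j) $ n) =
       (\<Sum>i\<le>n - k. (w_coeff (m + int i) * w_coeff (int i) * fps_X ^ i) $ (n - k))"
    proof (rule sum.reindex_bij_witness[where i = "\<lambda>i. i + k" and j = "\<lambda>j. j - k"])
      fix j assume j: "j \<in> {k..n}"
      have "w_coeff (int j - int k) * w_coeff (int j) * fps_X ^ j =
          w_coeff (m + int (j - k)) * w_coeff (int (j - k)) * fps_X ^ (j - k) * fps_X ^ k"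
        using j by (simp add: m of_nat_diff mult_ac flip: power_add)
      thus "(w_coeff (m + int (j - k)) * w_coeff (int (j - k)) * fps_X ^ (j - k)) $ (n - k) =
         (w_coeff (int j - int k) * w_coeff (int j) * fps_X ^ j) $ n"
        using False by (simp add: fps_X_power_mult_right_nth)
    qed (use False in auto)
    thus ?thesis using False by (simp add: alpha_def)
  qed simp
  finally show "alpha (- m) $ n = (fps_X ^ nat m * alpha m) $ n"
    by (simp add: fps_X_power_mult_nth k_def)
qed

lemma beta_summand:
  assumes "i \<ge> 0"
  shows "sw_coeff i * w_coeff (int j) * fps_X ^ j = w_coeff i * w_coeff (int j) * fps_X ^ (nat i + j)"
  using assms by (simp add: sw_coeff_eq power_add mult_ac)

text \<open>Each power of \<open>q\<close> carries only a Laurent polynomial in \<open>x\<close>, so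
  \<open>beta\<close>, unlike \<open>alpha\<close>, can be evaluated at
  \<open>x = exp t\<close>.\<close>

lemma beta_eq_0: "\<bar>m\<bar> > int n \<Longrightarrow> beta m $ n = 0"
proof -
  assume m: "\<bar>m\<bar> > int n"
  have "(sw_coeff (m + int j) * w_coeff (int j) * fps_X ^ j) $ n = 0" if "j \<le> n" for j
  proof (cases "m + int j < 0")
    case False
    hence "n < nat (m + int j) + j" using m that by linarith
    thus ?thesis using False by (simp only: beta_summand not_less fps_mult_X_power_nth_shift)
  qed (simp add: sw_coeff_eq)
  thus ?thesis by (simp add: beta_def)
qed

lemma alpha_eq_0: "m < - int n \<Longrightarrow> alpha m $ n = 0"
  by (simp add: alpha_def w_coeff_neg)

text \<open>Invariance of the product under \<open>x\<close> to \<open>1 / x\<close>.\<close>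

lemma beta_reflect: "beta (- m) = beta m"
proof -
  have *: "beta (- int k) = beta (int k)" for k
  proof (rule fps_ext)
    fix n
    have "beta (- int k) $ n = (\<Sum>j\<le>n. (sw_coeff (int j - int k) * w_coeff (int j) * fps_X ^ j) $ n)"
      by (simp add: beta_def)
    also have "\<dots> = (\<Sum>j\<in>{k..n + k}. (sw_coeff (int j - int k) * w_coeff (int j) * fps_X ^ j) $ n)"
      by (intro sum.mono_neutral_cong) (auto simp: sw_coeff_eq not_le fps_mult_X_power_nth_shift)
    also have "\<dots> = (\<Sum>i\<le>n. (sw_coeff (int k + int i) * w_coeff (int i) * fps_X ^ i) $ n)"
    proof (rule sum.reindex_bij_witness[where i = "\<lambda>i. i + k" and j = "\<lambda>j. j - k"])
      fix j assume j: "j \<in> {k..n + k}"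
      have "sw_coeff (int j - int k) * w_coeff (int j) * fps_X ^ j =
         sw_coeff (int k + int (j - k)) * w_coeff (int (j - k)) * fps_X ^ (j - k)"
      proof -
        have "int j - int k = int (j - k)" "int k + int (j - k) = int j" using j by auto
        thus ?thesis by (simp only: beta_summand[OF of_nat_0_le_iff] nat_int) (simp only: mult_ac add_ac)
      qed
      thus "(sw_coeff (int k + int (j - k)) * w_coeff (int (j - k)) * fps_X ^ (j - k)) $ n =
          (sw_coeff (int j - int k) * w_coeff (int j) * fps_X ^ j) $ n" by simp
    qed auto
    finally show "beta (- int k) $ n = beta (int k) $ n" by (simp add: beta_def)
  qed
  show ?thesis
  proof (cases "m \<ge> 0")
    case True
    thus ?thesis using *[of "nat m"] by simp
  next
    case False
    thus ?thesis using *[of "nat (- m)"] by simp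
  qed
qed

text \<open>The coefficients of \<open>(1 - x) ^ -3\<close> expanded at \<open>x = 0\<close>.\<close>

definition tri :: "int \<Rightarrow> rat" where
  "tri k = (if k \<ge> 0 then of_int ((k + 1) * (k + 2)) / 2 else 0)"

lemma tri_third_difference: "tri k - 3 * tri (k - 1) + 3 * tri (k - 2) - tri (k - 3) = (if k = 0 then 1 else 0)"
proof -
  consider "k < 0" | "k = 0" | "k = 1" | "k = 2" | "k \<ge> 3" by linarith
  thus ?thesis by cases (auto simp: tri_def field_simps)
qed

text \<open>The expansion of \<open>(1 - x) ^ (-3)\<close> at infinity has the coefficients
  \<open>- tri (- 3 - k)\<close>, so this is the difference of the two expansions. One polynomial
  covers all \<open>k\<close>, its zeros \<open>-1\<close> and \<open>-2\<close> filling the gap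
  between the supports.\<close>

lemma tri_reflect: "tri k + tri (- 3 - k) = of_int ((k + 1) * (k + 2)) / 2"
proof -
  consider "k \<ge> 0" | "k = -1" | "k = -2" | "k \<le> -3" by linarith
  thus ?thesis by cases (auto simp: tri_def algebra_simps)
qed

lemma third_difference_unique:
  fixes D :: "int \<Rightarrow> rat"
  assumes rec: "\<And>m. D m - 3 * D (m - 1) + 3 * D (m - 2) - D (m - 3) = 0" and D0: "\<And>m. m < a \<Longrightarrow> D m = 0"
  shows "D m = 0"
proof -
  have "\<forall>m < a + int k. D m = 0" for k
  proof (induction k)
    case 0
    thus ?case using D0 by simp
  next
    case (Suc k)
    show ?case
    proof (intro allI impI)
      fix m assume m: "m < a + int (Suc k)"
      have "D (m - 1) = 0" "D (m - 2) = 0" "D (m - 3) = 0" using Suc m by auto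
      thus "D m = 0" using rec[of m] by simp
    qed
  qed
  from this[of "nat (m - a) + 1"] show ?thesis by auto
qed

text \<open>Division by \<open>(1 - x) ^ 3\<close>, expanded at \<open>x = 0\<close>. Uniqueness
  justifies it: both sides have third difference \<open>beta\<close> and vanish for
  \<open>m < - n\<close>.\<close>

lemma alpha_eq_beta_sum: "alpha m $ n = (\<Sum>i\<in>{- int n..int n}. tri (m - i) * beta i $ n)"
proof -
  define D where "D m = alpha m $ n - (\<Sum>i\<in>{- int n..int n}. tri (m - i) * beta i $ n)" for m
  have "D m = 0" for m
  proof (rule third_difference_unique[where a = "- int n"])
    fix m
    have "(alpha m - 3 * alpha (m - 1) + 3 * alpha (m - 2) - alpha (m - 3)) $ n = beta m $ n"
      by (simp only: alpha_third_difference)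
    hence A: "alpha m $ n - 3 * alpha (m - 1) $ n + 3 * alpha (m - 2) $ n - alpha (m - 3) $ n = beta m $ n"
      by (simp add: numeral_fps_const)
    have "(\<Sum>i\<in>{- int n..int n}. tri (m - i) * beta i $ n) - 3 * (\<Sum>i\<in>{- int n..int n}. tri (m - 1 - i) * beta i $ n)
        + 3 * (\<Sum>i\<in>{- int n..int n}. tri (m - 2 - i) * beta i $ n) - (\<Sum>i\<in>{- int n..int n}. tri (m - 3 - i) * beta i $ n)
      = (\<Sum>i\<in>{- int n..int n}. (tri (m - i) - 3 * tri (m - i - 1) + 3 * tri (m - i - 2) - tri (m - i - 3)) * beta i $ n)"
      by (simp add: sum_distrib_left sum_subtractf[symmetric] sum.distrib[symmetric] algebra_simps)
    also have "\<dots> = (\<Sum>i\<in>{- int n..int n}. if i = m then beta i $ n else 0)"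
      unfolding tri_third_difference by (intro sum.cong) auto
    also have "\<dots> = beta m $ n" using beta_eq_0[of n m] by (auto simp: sum.delta abs_if split: if_splits)
    finally show "D m - 3 * D (m - 1) + 3 * D (m - 2) - D (m - 3) = 0"
      using A unfolding D_def by (simp add: algebra_simps)
  next
    fix m assume m: "m < - int n"
    have "(\<Sum>i\<in>{- int n..int n}. tri (m - i) * beta i $ n) = 0"
      using m by (intro sum.neutral) (auto simp: tri_def)
    thus "D m = 0" using m by (simp add: D_def alpha_eq_0)
  qed
  thus ?thesis by (simp add: D_def)
qed

text \<open>By the symmetry of \<open>beta\<close>, the coefficient at \<open>- m - 3\<close>
  supplies the opposite expansion of the pole, so the sum weights \<open>beta i\<close> by a
  quadratic polynomial in \<open>m - i\<close>. Expanding in \<open>i\<close> leaves the moments of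
  order 0, 1, 2, the jet at \<open>x = 1\<close>.\<close>

lemma alpha_quadratic:
  "alpha m + alpha (- m - 3) = fps_const (1 / 2) * (of_int ((m + 1) * (m + 2)) * emom 0 (gf_of beta) -
     of_int (2 * m + 3) * emom 1 (gf_of beta) + emom 2 (gf_of beta))"
proof (rule fps_ext)
  fix n
  have mom: "emom j (gf_of beta) $ n = (\<Sum>i\<in>{- int n..int n}. of_int i ^ j * beta i $ n)" for j
    unfolding emom_gf_of by (rule sum.mono_neutral_right) (auto simp: beta_eq_0)
  have "alpha (- m - 3) $ n = (\<Sum>i\<in>{- int n..int n}. tri (- 3 - (m - i)) * beta i $ n)"
    unfolding alpha_eq_beta_sum
  proof (rule sum.reindex_bij_witness[where i = uminus and j = uminus])
    fix i
    have "- 3 - (m - - i) = - m - 3 - i" by simp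
    thus "tri (- 3 - (m - - i)) * beta (- i) $ n = tri (- m - 3 - i) * beta i $ n" by (simp only: beta_reflect)
  qed auto
  hence "(alpha m + alpha (- m - 3)) $ n = (\<Sum>i\<in>{- int n..int n}. (tri (m - i) + tri (- 3 - (m - i))) * beta i $ n)"
    by (simp add: alpha_eq_beta_sum sum.distrib[symmetric] algebra_simps)
  also have "\<dots> = (\<Sum>i\<in>{- int n..int n}. 1 / 2 * (of_int ((m + 1) * (m + 2)) * (of_int i ^ 0 * beta i $ n) -
      of_int (2 * m + 3) * (of_int i ^ 1 * beta i $ n) + of_int i ^ 2 * beta i $ n))"
    unfolding tri_reflect by (intro sum.cong refl) (simp add: field_simps power2_eq_square)
  also have "\<dots> = 1 / 2 * (of_int ((m + 1) * (m + 2)) * emom 0 (gf_of beta) $ n -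
      of_int (2 * m + 3) * emom 1 (gf_of beta) $ n + emom 2 (gf_of beta) $ n)"
    unfolding mom by (simp only: sum_distrib_left[symmetric] sum.distrib sum_subtractf)
  finally show "(alpha m + alpha (- m - 3)) $ n = (fps_const (1 / 2) * (of_int ((m + 1) * (m + 2)) * emom 0 (gf_of beta) -
     of_int (2 * m + 3) * emom 1 (gf_of beta) + emom 2 (gf_of beta))) $ n"
    by (simp only: fps_mult_left_const_nth fps_add_nth fps_sub_nth fps_of_int[symmetric])
qed

lemma fps_emb_prod: "fps_emb (prod f A) = (\<Prod>a\<in>A. fps_emb (f a))"
  by (induction A rule: infinite_finite_induct) (auto simp: fps_emb_1 fps_emb_mult)

lemma fps_emb_geom: "fps_emb (geom_fps 1 i) = geom_fps 1 i"
  by (simp add: fps_emb_def geom_fps_def fps_eq_iff)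

text \<open>The summands of \<open>F (c q)\<close>: the outer variable of \<open>F\<close> is
  replaced by \<open>c q\<close>, and its coefficients are embedded as constants in
  \<open>t\<close>.\<close>

definition x_eval :: "rat fps \<Rightarrow> rat fps fps \<Rightarrow> nat \<Rightarrow> rat fps fps" where
  "x_eval c F s = fps_const (c ^ s) * fps_X ^ s * fps_emb (F $ s)"

lemma isum_adm_x_eval: "isum_adm (x_eval c F)"
  by (rule isum_admI) (simp add: x_eval_def fps_const_X_power_mult_nth)

lemma x_eval_mult: "fps_isum (x_eval c F) * fps_isum (x_eval c G) = fps_isum (x_eval c (F * G))"
proof -
  have "(\<Sum>k\<le>s. x_eval c F k * x_eval c G (s - k)) = x_eval c (F * G) s" for s
  proof -
    have "x_eval c F k * x_eval c G (s - k) = fps_const (c ^ s) * fps_X ^ s * fps_emb (F $ k * G $ (s - k))" if "k \<le> s" for k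
    proof -
      have 1: "fps_X ^ s = fps_X ^ k * (fps_X ^ (s - k) :: rat fps fps)" using that by (simp flip: power_add)
      have 2: "fps_const (c ^ s) = fps_const (c ^ k) * fps_const (c ^ (s - k))" using that by (simp flip: power_add)
      show ?thesis unfolding x_eval_def 1 2 fps_emb_mult by (simp only: mult_ac)
    qed
    thus ?thesis unfolding x_eval_def
      by (simp add: fps_mult_nth[of F] fps_emb_sum sum_distrib_left atLeast0AtMost)
  qed
  thus ?thesis by (simp add: fps_isum_mult[OF isum_adm_x_eval isum_adm_x_eval])
qed

lemma iprod_geom_x_eval: "fps_iprod (geom_fps c) = fps_isum (x_eval c inv_qpoch_gf)"
proof -
  have "fps_iprod (\<lambda>i. 1 - fps_const c * fps_X ^ i) * fps_isum (qbinom_term c 0 0) = 1"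
    unfolding qbinomial_theorem by (simp add: fps_iprod_1)
  hence "fps_iprod (geom_fps c) * (fps_iprod (\<lambda>i. 1 - fps_const c * fps_X ^ i) * fps_isum (qbinom_term c 0 0)) =
     fps_iprod (geom_fps c)" by simp
  moreover have "fps_iprod (geom_fps c) * (fps_iprod (\<lambda>i. 1 - fps_const c * fps_X ^ i) * fps_isum (qbinom_term c 0 0)) =
     (fps_iprod (\<lambda>i. 1 - fps_const c * fps_X ^ i) * fps_iprod (geom_fps c)) * fps_isum (qbinom_term c 0 0)" by (simp only: mult_ac)
  ultimately have "fps_isum (qbinom_term c 0 0) = fps_iprod (geom_fps c)"
    unfolding iprod_one_minus_mult_geom by simp
  moreover have "qbinom_term c 0 0 = x_eval c inv_qpoch_gf"
    by (rule ext) (simp add: qbinom_term_def x_eval_def inv_qpoch_gf_def inv_qpoch_def fps_emb_prod fps_emb_geom)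
  ultimately show ?thesis by simp
qed

text \<open>At \<open>x = exp t\<close> the factors \<open>1 / (x q; q) ^ 3\<close> and
  \<open>1 / (q / x; q) ^ 3\<close> become power series in \<open>q\<close>; their product,
  regrouped by \<open>m = i - j\<close>, is the generating function of \<open>beta\<close>.\<close>

lemma gf_of_beta: "gf_of beta = (fps_iprod (geom_fps (xpow 1)) * fps_iprod (geom_fps (xpow (-1)))) ^ 3"
proof -
  define W where "W = inv_qpoch_gf ^ 3"
  have cube: "fps_iprod (geom_fps c) ^ 3 = fps_isum (x_eval c W)" for c
    unfolding iprod_geom_x_eval W_def by (simp add: power3_eq_cube x_eval_mult)
  have "gf_of beta = fps_isum (x_eval (xpow 1) W) * fps_isum (x_eval (xpow (-1)) W)"
  proof (rule fps_ext)
    fix n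
    define T where "T i j = (w_coeff (int i) * w_coeff (int j) * fps_X ^ (i + j)) $ n" for i j
    have "gf_of beta $ n = (\<Sum>m\<in>{- int n - 1..int n + 1}. \<Sum>j\<le>n.
        fps_const ((sw_coeff (m + int j) * w_coeff (int j) * fps_X ^ j) $ n) * xpow m)"
      by (simp add: gf_of_def beta_def fps_const_sum sum_distrib_right)
    also have "\<dots> = (\<Sum>j\<le>n. \<Sum>m\<in>{- int n - 1..int n + 1}.
        fps_const ((sw_coeff (m + int j) * w_coeff (int j) * fps_X ^ j) $ n) * xpow m)"
      by (rule sum.swap)
    also have "\<dots> = (\<Sum>j\<le>n. \<Sum>i\<le>n. fps_const (T i j) * xpow (int i - int j))"
    proof (rule sum.cong[OF refl])
      fix j assume j: "j \<in> {..n}"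
      let ?f = "\<lambda>m. fps_const ((sw_coeff (m + int j) * w_coeff (int j) * fps_X ^ j) $ n) * xpow m"
      have "(\<Sum>m\<in>{- int n - 1..int n + 1}. ?f m) = (\<Sum>m\<in>{- int j..int n - int j}. ?f m)"
      proof (rule sum.mono_neutral_right)
        show "\<forall>m\<in>{- int n - 1..int n + 1} - {- int j..int n - int j}. ?f m = 0"
        proof
          fix m assume m: "m \<in> {- int n - 1..int n + 1} - {- int j..int n - int j}"
          show "?f m = 0"
          proof (cases "m + int j < 0")
            case False
            hence "n < nat (m + int j) + j" using m by auto
            hence "(sw_coeff (m + int j) * w_coeff (int j) * fps_X ^ j) $ n = 0"
              using False by (simp only: beta_summand not_less fps_mult_X_power_nth_shift)
            thus ?thesis by simp
          qed (simp add: sw_coeff_eq)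
        qed
      qed (use j in auto)
      also have "\<dots> = (\<Sum>i\<le>n. fps_const (T i j) * xpow (int i - int j))"
      proof (rule sum.reindex_bij_witness[where i = "\<lambda>i. int i - int j" and j = "\<lambda>m. nat (m + int j)"])
        fix m assume m: "m \<in> {- int j..int n - int j}"
        hence i: "m + int j \<ge> 0" by auto
        have "(sw_coeff (m + int j) * w_coeff (int j) * fps_X ^ j) $ n = T (nat (m + int j)) j"
          unfolding beta_summand[OF i] T_def using i by simp
        thus "fps_const (T (nat (m + int j)) j) * xpow (int (nat (m + int j)) - int j) = ?f m" using i by simp
      qed auto
      finally show "(\<Sum>m\<in>{- int n - 1..int n + 1}. ?f m) = (\<Sum>i\<le>n. fps_const (T i j) * xpow (int i - int j))" .
    qed
    also have "\<dots> = (\<Sum>i\<le>n. \<Sum>j\<le>n. fps_const (T i j) * xpow (int i - int j))" by (rule sum.swap)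
    also have "\<dots> = (\<Sum>i\<le>n. \<Sum>j\<le>n. (x_eval (xpow 1) W i * x_eval (xpow (-1)) W j) $ n)"
    proof (intro sum.cong refl)
      fix i j
      have "x_eval (xpow 1) W i * x_eval (xpow (-1)) W j =
          fps_const (xpow 1 ^ i * xpow (-1) ^ j) * fps_emb (W $ i * W $ j * fps_X ^ (i + j))"
        unfolding x_eval_def fps_emb_mult fps_emb_X_power power_add fps_const_mult[symmetric] by (simp only: mult_ac)
      moreover have "xpow 1 ^ i * xpow (-1) ^ j = xpow (int i - int j)"
        by (simp add: xpow_power xpow_add[symmetric])
      moreover have "fps_emb (W $ i * W $ j * fps_X ^ (i + j)) $ n = fps_const (T i j)"
        by (simp add: fps_emb_def T_def w_coeff_def int_nth_def W_def)
      ultimately show "fps_const (T i j) * xpow (int i - int j) = (x_eval (xpow 1) W i * x_eval (xpow (-1)) W j) $ n"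
        by (simp add: mult.commute)
    qed
    also have "\<dots> = (fps_isum (x_eval (xpow 1) W) * fps_isum (x_eval (xpow (-1)) W)) $ n"
      by (rule fps_isum_mult_nth[OF isum_adm_x_eval isum_adm_x_eval, symmetric])
    finally show "gf_of beta $ n = (fps_isum (x_eval (xpow 1) W) * fps_isum (x_eval (xpow (-1)) W)) $ n" .
  qed
  thus ?thesis by (simp add: power_mult_distrib cube)
qed

lemma gf_of_beta_crank: "gf_of beta = fps_emb (Pser ^ 3) * crank_gf ^ 3"
proof -
  have "fps_iprod (geom_fps (xpow 1)) * fps_iprod (geom_fps (xpow (-1))) = (euler_prod * fps_emb Pser) * (fps_iprod (geom_fps (xpow 1)) * fps_iprod (geom_fps (xpow (-1))))"
    unfolding euler_prod_emb_Pser by simp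
  also have "\<dots> = fps_emb Pser * crank_gf" unfolding crank_gf_product by (simp only: mult_ac)
  finally show ?thesis unfolding gf_of_beta by (simp add: power_mult_distrib fps_emb_power)
qed

text \<open>Second moments, relative to the zeroth ones, add up because first moments vanish: each
  of the three factors contributes \<open>2 Phi 1\<close>, whence 6.\<close>

lemma beta_moments:
  "emom 0 (gf_of beta) = Pser ^ 6" "emom 1 (gf_of beta) = 0" "emom 2 (gf_of beta) = 6 * Pser ^ 6 * Phi 1"
proof -
  have c1: "emom 1 crank_gf = 0" by (rule crank_moment_odd) simp
  have s0: "{..0::nat} = {0}" and s1: "{..1::nat} = {0, 1}" and s2: "{..2::nat} = {0, 1, 2}" by auto
  have m0: "emom 0 (crank_gf ^ 2) = Pser ^ 2" unfolding power2_eq_square emom_mult s0 by (simp add: emom_crank_0)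
  have m1: "emom 1 (crank_gf ^ 2) = 0" unfolding power2_eq_square emom_mult s1 by (simp add: c1[simplified])
  have m2: "emom 2 (crank_gf ^ 2) = 4 * (Pser ^ 2 * Phi 1)"
    unfolding power2_eq_square emom_mult s2
    by (simp add: c1[simplified] emom_crank_0 emom_crank_2 algebra_simps)
  have cube: "F ^ 3 = F * F ^ 2" for F :: "'a :: comm_ring_1" by (simp add: power3_eq_cube power2_eq_square mult.assoc)
  have n0: "emom 0 (crank_gf ^ 3) = Pser ^ 3"
    unfolding cube emom_mult s0 by (simp add: m0 emom_crank_0)
  have n1: "emom 1 (crank_gf ^ 3) = 0"
    unfolding cube emom_mult s1 by (simp add: m1[simplified] c1[simplified])
  have n2: "emom 2 (crank_gf ^ 3) = 6 * (Pser ^ 3 * Phi 1)"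
    unfolding cube emom_mult s2
    by (simp add: m0 m2 c1[simplified] emom_crank_0 emom_crank_2 algebra_simps)
  have p6: "Pser ^ 6 = Pser ^ 3 * Pser ^ 3" by (simp flip: power_add)
  show "emom 0 (gf_of beta) = Pser ^ 6" "emom 1 (gf_of beta) = 0" "emom 2 (gf_of beta) = 6 * Pser ^ 6 * Phi 1"
    unfolding gf_of_beta_crank emom_emb_mult n0 n1 n2 p6 by (simp_all add: mult_ac)
qed

lemma alpha_sum: "alpha m + alpha (- m - 3) = Pser ^ 6 * (fps_const (of_int ((m + 1) * (m + 2)) / 2) + 3 * Phi 1)"
proof -
  have "fps_const (of_int ((m + 1) * (m + 2)) / 2) = fps_const (1 / 2) * (of_int ((m + 1) * (m + 2)) :: rat fps)"
    by (simp add: fps_of_int[symmetric] del: of_int_mult of_int_add)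
  moreover have "3 * Phi 1 = fps_const (1 / 2) * (6 * Phi 1)" by (simp add: numeral_fps_const mult.assoc[symmetric])
  ultimately show ?thesis unfolding alpha_quadratic beta_moments by (simp only:) (simp add: algebra_simps)
qed

subsection \<open>The rank-crank relation\<close>

definition half_tri :: "int \<Rightarrow> rat" where
  "half_tri m = of_int (m * (m + 1)) / 2"

text \<open>The weights are matched to the shift by 3: moving \<open>3 delta_q\<close> past
  \<open>q ^ (m - 1)\<close> costs \<open>3 (m - 1) = half_tri m - half_tri (m - 3)\<close>, so one
  operator acts on both terms of Dyson's relation.\<close>

definition rank_heat :: "int \<Rightarrow> rat fps" where
  "rank_heat m = 3 * delta_q (rank_le_ser m) + fps_const (half_tri m) * rank_le_ser m"

lemma delta_q_X_power_mult: "delta_q (fps_X ^ k * F) = fps_X ^ k * (delta_q F + of_nat k * F)"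
proof -
  have "delta_q (fps_X ^ k) = of_nat k * (fps_X ^ k :: rat fps)"
    by (rule fps_ext) (auto simp: delta_q_def fps_X_power_nth simp flip: fps_of_nat)
  thus ?thesis by (simp add: delta_q_mult algebra_simps)
qed

lemma delta_q_diff: "delta_q (F - G) = delta_q F - delta_q G"
  by (simp add: delta_q_altdef algebra_simps)

lemma delta_q_0 [simp]: "delta_q 0 = 0"
  by (simp add: delta_q_altdef)

lemma delta_q_1 [simp]: "delta_q 1 = 0"
  by (simp add: delta_q_altdef)

lemma rank_heat_rec_pos:
  assumes m: "m \<ge> 1"
  shows "fps_X ^ nat (m - 1) * rank_heat m + rank_heat (m - 3) = Pser * (fps_const (half_tri (m - 3)) + 3 * Phi 1)"
proof -
  define r where "r = nat (m - 1)"
  have r: "int r = m - 1" using m by (simp add: r_def)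
  have c: "fps_const (half_tri m) = fps_const (half_tri (m - 3)) + 3 * (of_nat r :: rat fps)"
  proof -
    have "(of_nat r :: rat) = of_int (m - 1)" using r by (metis of_int_of_nat_eq)
    hence "half_tri m = half_tri (m - 3) + 3 * of_nat r" by (simp add: half_tri_def field_simps)
    thus ?thesis by (simp add: fps_of_nat[symmetric] numeral_fps_const)
  qed
  define e :: "rat fps" where "e = (if m = 2 then 1 else 0)"
  \<comment> \<open>The empty-partition term occurs only at \<open>m = 2\<close>, where
    \<open>half_tri (-1) = 0\<close>; being constant, it is also killed by
    \<open>delta_q\<close>.\<close>
  have e: "fps_const (half_tri (m - 3)) * e = 0" "delta_q e = 0" by (auto simp: e_def half_tri_def)
  have rec: "fps_X ^ r * rank_le_ser m + rank_le_ser (m - 3) = Pser - e"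
    using rank_le_ser_rec_pos[OF m] by (simp add: r_def e_def)
  have "fps_X ^ r * rank_heat m + rank_heat (m - 3) =
     3 * delta_q (fps_X ^ r * rank_le_ser m + rank_le_ser (m - 3)) +
     fps_const (half_tri (m - 3)) * (fps_X ^ r * rank_le_ser m + rank_le_ser (m - 3))"
    unfolding rank_heat_def c delta_q_add delta_q_X_power_mult by (simp add: algebra_simps)
  also have "\<dots> = 3 * (Pser * Phi 1) + fps_const (half_tri (m - 3)) * Pser"
    unfolding rec delta_q_diff delta_q_Pser e(2) right_diff_distrib e(1) by simp
  finally show ?thesis by (simp add: r_def algebra_simps)
qed

lemma rank_heat_rec_nonpos:
  assumes m: "m \<le> 0"
  shows "rank_heat m + fps_X ^ nat (1 - m) * rank_heat (m - 3) =
     fps_X ^ nat (1 - m) * (Pser * (fps_const (half_tri (m - 3)) + 3 * Phi 1))"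
proof -
  define r where "r = nat (1 - m)"
  have r: "int r = 1 - m" using m by (simp add: r_def)
  have c: "fps_const (half_tri (m - 3)) = fps_const (half_tri m) + 3 * (of_nat r :: rat fps)"
  proof -
    have "(of_nat r :: rat) = of_int (1 - m)" using r by (metis of_int_of_nat_eq)
    hence "half_tri (m - 3) = half_tri m + 3 * of_nat r" by (simp add: half_tri_def field_simps)
    thus ?thesis by (simp add: fps_of_nat[symmetric] numeral_fps_const)
  qed
  define e :: "rat fps" where "e = (if m = 0 then 1 else 0)"
  have e: "fps_const (half_tri m) * e = 0" "delta_q e = 0" by (auto simp: e_def half_tri_def)
  have rec: "rank_le_ser m + fps_X ^ r * rank_le_ser (m - 3) = fps_X ^ r * Pser + e"
    using rank_le_ser_rec_nonpos[OF m] by (simp add: r_def e_def)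
  have "rank_heat m + fps_X ^ r * rank_heat (m - 3) =
     3 * delta_q (rank_le_ser m + fps_X ^ r * rank_le_ser (m - 3)) +
     fps_const (half_tri m) * (rank_le_ser m + fps_X ^ r * rank_le_ser (m - 3))"
    unfolding rank_heat_def c delta_q_add delta_q_X_power_mult by (simp add: algebra_simps)
  also have "\<dots> = 3 * delta_q (fps_X ^ r * Pser) + fps_const (half_tri m) * (fps_X ^ r * Pser)"
    unfolding rec delta_q_add e(2) distrib_left e(1) by simp
  also have "\<dots> = fps_X ^ r * (Pser * (fps_const (half_tri (m - 3)) + 3 * Phi 1))"
    unfolding delta_q_X_power_mult delta_q_Pser c by (simp add: algebra_simps)
  finally show ?thesis by (simp add: r_def)
qed

text \<open>For \<open>m >= -1\<close> each use of the relation at \<open>m + 3\<close> brings a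
  positive power of \<open>q\<close>, so all coefficients vanish by induction on the degree;
  \<open>m = -2\<close> has exponent 0 but reduces to \<open>d 1\<close>. The remaining
  \<open>m\<close> follow downwards in steps of 3.\<close>

lemma shift_recurrence_unique:
  fixes d :: "int \<Rightarrow> rat fps"
  assumes pos: "\<And>m. m \<ge> 1 \<Longrightarrow> fps_X ^ nat (m - 1) * d m + d (m - 3) = 0"
    and nonpos: "\<And>m. m \<le> 0 \<Longrightarrow> d m + fps_X ^ nat (1 - m) * d (m - 3) = 0"
  shows "d m = 0"
proof -
  have up: "d m = - (fps_X ^ nat (m + 2) * d (m + 3))" if "m \<ge> -2" for m
    using pos[of "m + 3"] that by (simp add: eq_neg_iff_add_eq_0 add.commute)
  have zero: "\<forall>m \<ge> -2. \<forall>i < n. d m $ i = 0" for n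
  proof (induction n)
    case (Suc n)
    have pos': "d m $ i = 0" if "m \<ge> -1" "i < Suc n" for m i
    proof -
      define k where "k = nat (m + 2)"
      have k: "k \<ge> 1" using that by (simp add: k_def)
      have "d m $ i = - ((fps_X ^ k * d (m + 3)) $ i)" using up[of m] that by (simp add: k_def)
      also have "\<dots> = - (if i < k then 0 else d (m + 3) $ (i - k))" by (simp add: fps_X_power_mult_nth)
      also have "\<dots> = 0" using Suc that k by auto
      finally show ?thesis .
    qed
    show ?case
    proof (intro allI impI)
      fix m :: int and i assume mi: "m \<ge> -2" "i < Suc n"
      show "d m $ i = 0"
      proof (cases "m \<ge> -1")
        case False
        hence m: "m = -2" using mi by simp
        have "d (-2) = - d 1" using up[of "-2"] by simp
        thus ?thesis using m pos'[of 1 i] mi by simp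
      qed (use pos' mi in auto)
    qed
  qed simp
  have z1: "d m = 0" if "m \<ge> -2" for m
    by (rule fps_ext) (use zero that in \<open>metis fps_zero_nth lessI\<close>)
  have down: "\<forall>m \<ge> -2 - 3 * int k. d m = 0" for k
  proof (induction k)
    case 0
    show ?case using z1 by simp
  next
    case (Suc k)
    show ?case
    proof (intro allI impI)
      fix m assume m: "m \<ge> -2 - 3 * int (Suc k)"
      show "d m = 0"
      proof (cases "m \<ge> -2")
        case False
        have "d (m + 3) = 0" using Suc m by simp
        hence "fps_X ^ nat (1 - (m + 3)) * d m = 0" using nonpos[of "m + 3"] False by simp
        thus ?thesis by simp
      qed (rule z1)
    qed
  qed
  show ?thesis using down[of "nat (- m)"] by auto
qed

text \<open>By \<open>alpha_reflect\<close>,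
  \<open>q ^ (m - 1) alpha (m - 1) = alpha (1 - m)\<close> for \<open>m >= 1\<close>, and
  \<open>alpha_sum\<close> at \<open>m - 4\<close> evaluates
  \<open>alpha (m - 4) + alpha (1 - m)\<close>. Hence both sides satisfy the same recurrence; the
  index \<open>m - 1\<close> reflects the factor \<open>x\<close> in
  \<open>x C(x) ^ 3 / (1 - x) ^ 3\<close>.\<close>

lemma rank_heat_eq_alpha: "Pser ^ 5 * rank_heat m = alpha (m - 1)"
proof -
  define d where "d m = Pser ^ 5 * rank_heat m - alpha (m - 1)" for m
  have sum: "alpha (m - 4) + alpha (1 - m) = Pser ^ 5 * (Pser * (fps_const (half_tri (m - 3)) + 3 * Phi 1))" for m
  proof -
    have "- (m - 4) - 3 = 1 - m" "(m - 4 + 1) * (m - 4 + 2) = (m - 3) * (m - 3 + 1)" by simp_all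
    moreover have "Pser ^ 6 = Pser ^ 5 * Pser" using power_Suc2[of Pser 5] by simp
    ultimately show ?thesis using alpha_sum[of "m - 4"] by (simp only: half_tri_def mult.assoc)
  qed
  have m4: "m - 3 - 1 = m - 4" for m :: int by simp
  have "d m = 0"
  proof (rule shift_recurrence_unique)
    fix m :: int assume m: "m \<ge> 1"
    have "alpha (1 - m) = fps_X ^ nat (m - 1) * alpha (m - 1)"
      using alpha_reflect[of "m - 1"] m by simp
    moreover have "Pser ^ 5 * (fps_X ^ nat (m - 1) * rank_heat m + rank_heat (m - 3)) =
        Pser ^ 5 * (Pser * (fps_const (half_tri (m - 3)) + 3 * Phi 1))"
      unfolding rank_heat_rec_pos[OF m] ..
    ultimately show "fps_X ^ nat (m - 1) * d m + d (m - 3) = 0"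
      using sum[of m] unfolding d_def m4 by (simp add: algebra_simps)
  next
    fix m :: int assume m: "m \<le> 0"
    have "alpha (m - 1) = fps_X ^ nat (1 - m) * alpha (1 - m)"
      using alpha_reflect[of "1 - m"] m by simp
    moreover have "Pser ^ 5 * (rank_heat m + fps_X ^ nat (1 - m) * rank_heat (m - 3)) =
        fps_X ^ nat (1 - m) * (alpha (m - 4) + alpha (1 - m))"
      unfolding rank_heat_rec_nonpos[OF m] sum by (simp only: mult_ac)
    ultimately show "d m + fps_X ^ nat (1 - m) * d (m - 3) = 0"
      unfolding d_def m4 by (simp add: algebra_simps)
  qed
  thus ?thesis by (simp add: d_def)
qed

definition rank_coeff :: "int \<Rightarrow> rat fps" where
  "rank_coeff m = rank_le_ser m - rank_le_ser (m - 1)"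

abbreviation rank_gf :: "rat fps fps" where
  "rank_gf \<equiv> gf_of rank_coeff"

text \<open>For a fixed power of \<open>q\<close> the cumulative \<open>rank_le_ser m\<close> stays
  constant for large \<open>m\<close>, so \<open>x\<close> cannot be specialised in it. Third
  differences lead to \<open>beta\<close> and \<open>rank_coeff\<close>, both of finite
  support.\<close>

lemma rank_coeff_eq_beta:
  "fps_const 2 * beta m = Pser ^ 5 *
    (6 * delta_q (rank_coeff (m + 1) - 2 * rank_coeff m + rank_coeff (m - 1)) +
     (of_int (m + 1) * (of_int (m + 1) * rank_coeff (m + 1)) + of_int (m + 1) * rank_coeff (m + 1)) +
     (2 * rank_coeff m - 2 * (of_int m * (of_int m * rank_coeff m))) +
     (of_int (m - 1) * (of_int (m - 1) * rank_coeff (m - 1)) - of_int (m - 1) * rank_coeff (m - 1)))"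
proof -
  \<comment> \<open>All four series are written over \<open>L\<close>, whose total coefficient is a
    third difference of polynomials in \<open>m\<close> of degree at most 2 and so vanishes.\<close>
  define L where "L = rank_le_ser (m - 2)"
  have l1: "rank_le_ser (m - 1) = L + rank_coeff (m - 1)" by (simp add: L_def rank_coeff_def)
  have l2: "rank_le_ser m = L + rank_coeff (m - 1) + rank_coeff m" by (simp add: L_def rank_coeff_def)
  have l3: "rank_le_ser (m + 1) = L + rank_coeff (m - 1) + rank_coeff m + rank_coeff (m + 1)" by (simp add: L_def rank_coeff_def)
  define M :: "rat fps" where "M = of_int m"
  have ht: "fps_const 2 * fps_const (half_tri k) = (of_int (k * (k + 1)) :: rat fps)" for k
    by (simp add: half_tri_def fps_of_int[symmetric] del: of_int_mult of_int_add)
  have B: "fps_const 2 * rank_heat k = 6 * delta_q (rank_le_ser k) + of_int (k * (k + 1)) * rank_le_ser k" for k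
    unfolding rank_heat_def distrib_left mult.assoc[symmetric] ht by (simp add: numeral_fps_const)
  have idx: "m + 1 - 1 = m" "m + 1 - 2 = m - 1" "m + 1 - 3 = m - 2" by simp_all
  have "beta m = alpha m - 3 * alpha (m - 1) + 3 * alpha (m - 2) - alpha (m - 3)"
    by (rule alpha_third_difference[symmetric])
  also have "\<dots> = Pser ^ 5 * (rank_heat (m + 1) - 3 * rank_heat m + 3 * rank_heat (m - 1) - rank_heat (m - 2))"
    using rank_heat_eq_alpha[of "m + 1"] rank_heat_eq_alpha[of m] rank_heat_eq_alpha[of "m - 1"] rank_heat_eq_alpha[of "m - 2"]
    by (simp add: algebra_simps)
  finally have "fps_const 2 * beta m = Pser ^ 5 * (fps_const 2 * rank_heat (m + 1) - 3 * (fps_const 2 * rank_heat m)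
      + 3 * (fps_const 2 * rank_heat (m - 1)) - fps_const 2 * rank_heat (m - 2))"
    by (simp only: right_diff_distrib distrib_left mult_ac)
  also have "fps_const 2 * rank_heat (m + 1) - 3 * (fps_const 2 * rank_heat m)
      + 3 * (fps_const 2 * rank_heat (m - 1)) - fps_const 2 * rank_heat (m - 2) =
    6 * delta_q (rank_coeff (m + 1) - 2 * rank_coeff m + rank_coeff (m - 1)) +
     ((M + 1) * ((M + 1) * rank_coeff (m + 1)) + (M + 1) * rank_coeff (m + 1)) +
     (2 * rank_coeff m - 2 * (M * (M * rank_coeff m))) +
     ((M - 1) * ((M - 1) * rank_coeff (m - 1)) - (M - 1) * rank_coeff (m - 1))"
  proof -
    have d2: "delta_q (2 * F) = 2 * delta_q F" for F by (simp add: delta_q_altdef numeral_fps_const)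
    have "of_int ((m + 1) * (m + 1 + 1)) = (M + 1) * (M + 2)" "of_int (m * (m + 1)) = M * (M + 1)"
      "of_int ((m - 1) * (m - 1 + 1)) = (M - 1) * M" "of_int ((m - 2) * (m - 2 + 1)) = (M - 2) * (M - 1)"
      by (simp_all add: M_def algebra_simps)
    thus ?thesis unfolding B l1 l2 l3 L_def[symmetric] delta_q_add delta_q_diff d2
      by (simp only:) (simp add: algebra_simps)
  qed
  finally show ?thesis by (simp add: M_def)
qed

lemma rank_coeff_0: "rank_coeff m $ 0 = (if m = 0 then 1 else 0)"
  by (auto simp: rank_coeff_def rank_le_ser_0)

lemma rank_coeff_pos: "n > 0 \<Longrightarrow> rank_coeff m $ n = of_int (N_rank m n)"
proof -
  assume n: "n > 0"
  have "{p\<in>partitions n. rank p \<le> m} = {p\<in>partitions n. rank p \<le> m - 1} \<union> {p\<in>partitions n. rank p = m}" by auto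
  hence "card {p\<in>partitions n. rank p \<le> m} = card {p\<in>partitions n. rank p \<le> m - 1} + card {p\<in>partitions n. rank p = m}"
    by (simp only:) (rule card_Un_disjoint, auto simp: finite_partitions)
  thus ?thesis using n by (simp add: rank_coeff_def rank_le_ser_pos N_rank_def)
qed

lemma N_rank_eq_0: "n > 0 \<Longrightarrow> \<bar>m\<bar> \<ge> int n \<Longrightarrow> N_rank m n = 0"
proof -
  assume n: "n > 0" "\<bar>m\<bar> \<ge> int n"
  have "{p\<in>partitions n. rank p = m} = {}" using rank_bounds[OF _ n(1)] n(2) by fastforce
  thus ?thesis by (simp only: N_rank_def card.empty of_nat_0)
qed

lemma rank_coeff_eq_0: "\<bar>m\<bar> > int n \<Longrightarrow> rank_coeff m $ n = 0"
  by (cases "n = 0") (auto simp: rank_coeff_0 rank_coeff_pos N_rank_eq_0)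

lemma Rser_eq_emom:
  assumes "j > 0"
  shows "Rser j = emom j rank_gf"
proof (rule fps_ext)
  fix n :: nat
  show "Rser j $ n = emom j rank_gf $ n"
  proof (cases "n = 0")
    case True
    have "{- int 0 - 1..int 0 + 1} = {-1, 0, 1}" by auto
    thus ?thesis using True assms by (simp add: emom_gf_of rank_coeff_0 Rser_def)
  next
    case False
    have N0: "N_rank m n = 0" if "m \<notin> {- int n - 1..int n + 1}" for m
      using that False by (intro N_rank_eq_0) auto
    have "N_mom j n = (\<Sum>m\<in>{- int n - 1..int n + 1}. m ^ j * N_rank m n)"
      unfolding N_mom_def
      by (rule Sum_any.expand_superset) (simp, rule subsetI, rule ccontr, simp add: N0 del: atLeastAtMost_iff)
    thus ?thesis using False by (simp add: Rser_def emom_gf_of rank_coeff_pos)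
  qed
qed

lemma emom_rank_0: "emom 0 rank_gf = Pser"
proof (rule fps_ext)
  fix n :: nat
  show "emom 0 rank_gf $ n = Pser $ n"
  proof (cases "n = 0")
    case True
    have "{- int 0 - 1..int 0 + 1} = {-1, 0, 1}" by auto
    thus ?thesis using True by (simp add: emom_gf_of rank_coeff_0 Pser_nth partitions_0)
  next
    case False
    have "emom 0 rank_gf $ n = (\<Sum>m\<in>{- int n - 1..int n + 1}. \<Sum>p\<in>{p\<in>partitions n. rank p = m}. 1)"
      using False by (simp add: emom_gf_of rank_coeff_pos N_rank_def)
    also have "\<dots> = (\<Sum>p\<in>partitions n. 1)"
      using rank_bounds[of _ n] False by (intro sum.group finite_partitions) force+
    finally show ?thesis by (simp add: Pser_nth)
  qed
qed

section \<open>Operations on coefficient families and their effect on generating functions\<close>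

lemma gf_of_add: "gf_of (\<lambda>m. f m + g m) = gf_of f + gf_of g"
  by (simp add: gf_of_def fps_eq_iff sum.distrib algebra_simps fps_const_add[symmetric] del: fps_const_add)

lemma gf_of_diff: "gf_of (\<lambda>m. f m - g m) = gf_of f - gf_of g"
  by (simp add: gf_of_def fps_eq_iff sum_subtractf algebra_simps fps_const_sub[symmetric] del: fps_const_sub)

lemma gf_of_const_mult: "gf_of (\<lambda>m. fps_const c * f m) = fps_const (fps_const c) * gf_of f"
  by (rule fps_ext)
    (simp add: gf_of_def sum_distrib_left fps_const_mult[symmetric] mult.assoc del: fps_const_mult)

lemma gf_of_numeral_mult: "gf_of (\<lambda>m. numeral k * f m) = numeral k * gf_of f"
  using gf_of_const_mult[of "numeral k" f] by (simp add: numeral_fps_const)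

lemma gf_of_delta_q: "gf_of (\<lambda>m. delta_q (f m)) = fps_Dq (gf_of f)"
  by (rule fps_ext)
    (simp add: gf_of_def fps_Dq_def delta_q_def sum_distrib_left mult.assoc fps_const_mult[symmetric] fps_of_nat del: fps_const_mult)

lemma gf_of_index_mult: "gf_of (\<lambda>m. of_int m * f m) = fps_Dt (gf_of f)"
proof (rule fps_ext)
  fix n
  have "fps_const ((of_int m * f m) $ n) * xpow m = fps_deriv (fps_const (f m $ n) * xpow m)" for m
  proof -
    have "(of_int m * f m) $ n = of_int m * f m $ n" by (simp flip: fps_of_int)
    thus ?thesis by (simp add: xpow_deriv mult_ac fps_of_int[symmetric])
  qed
  thus "gf_of (\<lambda>m. of_int m * f m) $ n = fps_Dt (gf_of f) $ n"
    by (simp add: gf_of_def fps_Dt_def fps_deriv_sum)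
qed

lemma gf_of_shift:
  assumes f: "\<And>m n. \<bar>m\<bar> > int n \<Longrightarrow> f m $ n = 0" and s: "\<bar>s\<bar> \<le> 1"
  shows "gf_of (\<lambda>m. f (m + s)) = fps_const (xpow (- s)) * gf_of f"
proof (rule fps_ext)
  fix n
  have "gf_of (\<lambda>m. f (m + s)) $ n = (\<Sum>m\<in>{- int n - 1..int n + 1}. fps_const (f (m + s) $ n) * xpow m)"
    by (simp add: gf_of_def)
  also have "\<dots> = (\<Sum>m\<in>{- int n - s..int n - s}. fps_const (f (m + s) $ n) * xpow m)"
    using s f by (intro sum.mono_neutral_right) auto
  also have "\<dots> = (\<Sum>m\<in>{- int n..int n}. fps_const (f m $ n) * xpow (m - s))"
    by (rule sum.reindex_bij_witness[where i = "\<lambda>m. m - s" and j = "\<lambda>m. m + s"]) auto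
  also have "\<dots> = (\<Sum>m\<in>{- int n - 1..int n + 1}. fps_const (f m $ n) * xpow (m - s))"
    using f by (intro sum.mono_neutral_left) auto
  also have "\<dots> = (\<Sum>m\<in>{- int n - 1..int n + 1}. xpow (- s) * (fps_const (f m $ n) * xpow m))"
    using xpow_add[of _ "- s"] by (simp add: mult_ac)
  finally show "gf_of (\<lambda>m. f (m + s)) $ n = (fps_const (xpow (- s)) * gf_of f) $ n"
    by (simp add: gf_of_def sum_distrib_left)
qed

lemma gf_of_fps_mult:
  assumes f: "\<And>m n. \<bar>m\<bar> > int n + 1 \<Longrightarrow> f m $ n = 0"
  shows "gf_of (\<lambda>m. F * f m) = fps_emb F * gf_of f"
proof (rule fps_ext)
  fix n
  have "gf_of (\<lambda>m. F * f m) $ n = (\<Sum>m\<in>{- int n - 1..int n + 1}. \<Sum>k=0..n. fps_const (F $ k) * (fps_const (f m $ (n - k)) * xpow m))"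
    by (simp add: gf_of_def fps_mult_nth fps_const_sum sum_distrib_left mult_ac fps_const_mult[symmetric] del: fps_const_mult)
  also have "\<dots> = (\<Sum>k=0..n. fps_const (F $ k) * (\<Sum>m\<in>{- int n - 1..int n + 1}. fps_const (f m $ (n - k)) * xpow m))"
    by (subst sum.swap) (simp add: sum_distrib_left)
  also have "\<dots> = (\<Sum>k=0..n. fps_const (F $ k) * gf_of f $ (n - k))"
  proof (intro sum.cong refl arg_cong2[of _ _ _ _ "(*)"])
    fix k assume "k \<in> {0..n}"
    show "(\<Sum>m\<in>{- int n - 1..int n + 1}. fps_const (f m $ (n - k)) * xpow m) = gf_of f $ (n - k)"
      unfolding gf_of_def fps_nth_Abs_fps using f[of "n - k"] by (intro sum.mono_neutral_right) auto
  qed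
  finally show "gf_of (\<lambda>m. F * f m) $ n = (fps_emb F * gf_of f) $ n"
    by (simp add: fps_mult_nth fps_emb_def)
qed

text \<open>\<open>rank_coeff_eq_beta\<close> summed against \<open>x ^ m\<close>: index shifts
  become factors \<open>x\<close> and \<open>1 / x\<close>, multiplication by \<open>m\<close>
  becomes the derivative in \<open>t\<close>. Since
  \<open>x + 1 / x - 2 = (1 - x)\<^sup>2 / x\<close>, this is the classical equation with its
  denominators cleared.\<close>

theorem rank_crank_pde:
  defines "x \<equiv> fps_const (xpow 1)" and "y \<equiv> fps_const (xpow (-1))" and "R \<equiv> rank_gf"
  shows "fps_emb (Pser ^ 2) * ((x + y - 2) * (6 * fps_Dq R + fps_Dt (fps_Dt R)) - (x - y) * fps_Dt R + 2 * R) = 2 * crank_gf ^ 3"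
proof -
  define N where "N = rank_coeff"
  define N1 where "N1 = (\<lambda>m. of_int m * N m)"
  define N2 where "N2 = (\<lambda>m. of_int m * N1 m)"
  have sN: "N m $ n = 0" if "\<bar>m\<bar> > int n" for m n using that by (simp add: N_def rank_coeff_eq_0)
  have sN1: "N1 m $ n = 0" if "\<bar>m\<bar> > int n" for m n using sN[OF that] by (simp add: N1_def flip: fps_of_int)
  have sN2: "N2 m $ n = 0" if "\<bar>m\<bar> > int n" for m n using sN1[OF that] by (simp add: N2_def flip: fps_of_int)
  define g where "g m = 6 * delta_q (N (m + 1) - 2 * N m + N (m + - 1)) + (N2 (m + 1) + N1 (m + 1)) + (2 * N m - 2 * N2 m) +
     (N2 (m + - 1) - N1 (m + - 1))" for m
  have g: "fps_const 2 * beta m = Pser ^ 5 * g m" for m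
    using rank_coeff_eq_beta[of m] by (simp add: g_def N2_def N1_def N_def)
  have sg: "g m $ n = 0" if "\<bar>m\<bar> > int n + 1" for m n
  proof -
    have "\<bar>m + 1\<bar> > int n" "\<bar>m\<bar> > int n" "\<bar>m + - 1\<bar> > int n" using that by auto
    thus ?thesis unfolding g_def by (simp add: sN sN1 sN2 delta_q_def numeral_fps_const)
  qed
  have R1: "gf_of N1 = fps_Dt R" unfolding N1_def gf_of_index_mult by (simp add: R_def N_def)
  have R2: "gf_of N2 = fps_Dt (fps_Dt R)" unfolding N2_def gf_of_index_mult R1 ..
  have R0: "gf_of N = R" by (simp add: R_def N_def)
  have up: "gf_of (\<lambda>m. f (m + 1)) = y * gf_of f" and dn: "gf_of (\<lambda>m. f (m + - 1)) = x * gf_of f"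
    if "\<And>m n. \<bar>m\<bar> > int n \<Longrightarrow> f m $ n = 0" for f
    using gf_of_shift[of f 1] gf_of_shift[of f "-1"] that by (simp_all add: x_def y_def)
  have DqR: "fps_Dq (y * R - 2 * R + x * R) = (x + y - 2) * fps_Dq R"
  proof -
    have 1: "fps_Dq (fps_const c * F) = fps_const c * fps_Dq F" for c F by (simp add: fps_Dq_def fps_eq_iff mult_ac)
    have 2: "fps_Dq (F + G) = fps_Dq F + fps_Dq G" "fps_Dq (F - G) = fps_Dq F - fps_Dq G" for F G
      by (simp_all add: fps_Dq_def fps_eq_iff algebra_simps)
    have "fps_Dq (y * R - 2 * R + x * R) = y * fps_Dq R - 2 * fps_Dq R + x * fps_Dq R"
      unfolding x_def y_def numeral_fps_const by (simp only: 1 2)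
    thus ?thesis by (simp add: algebra_simps)
  qed
  have "gf_of g = 6 * fps_Dq (y * R - 2 * R + x * R) + (y * fps_Dt (fps_Dt R) + y * fps_Dt R) + (2 * R - 2 * fps_Dt (fps_Dt R)) +
     (x * fps_Dt (fps_Dt R) - x * fps_Dt R)"
    unfolding g_def gf_of_add gf_of_diff gf_of_numeral_mult gf_of_delta_q
    by (simp only: up[of N, OF sN] up[of N1, OF sN1] up[of N2, OF sN2]
        dn[of N, OF sN] dn[of N1, OF sN1] dn[of N2, OF sN2] R0 R1 R2)
  also have "\<dots> = (x + y - 2) * (6 * fps_Dq R + fps_Dt (fps_Dt R)) - (x - y) * fps_Dt R + 2 * R"
    unfolding DqR by (simp add: algebra_simps)
  finally have gg: "gf_of g = (x + y - 2) * (6 * fps_Dq R + fps_Dt (fps_Dt R)) - (x - y) * fps_Dt R + 2 * R" .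
  have P5: "fps_emb (Pser ^ 5) = fps_emb (Pser ^ 3) * fps_emb (Pser ^ 2)" by (simp add: fps_emb_mult[symmetric] flip: power_add)
  have "gf_of (\<lambda>m. fps_const 2 * beta m) = 2 * gf_of beta" using gf_of_const_mult[of 2 beta] by (simp add: numeral_fps_const)
  moreover have "gf_of (\<lambda>m. fps_const 2 * beta m) = fps_emb (Pser ^ 5) * gf_of g"
    unfolding g by (rule gf_of_fps_mult) (rule sg)
  ultimately have "fps_emb (Pser ^ 5) * gf_of g = 2 * gf_of beta" by simp
  hence eq: "fps_emb (Pser ^ 3) * (fps_emb (Pser ^ 2) * gf_of g) = fps_emb (Pser ^ 3) * (2 * crank_gf ^ 3)"
    unfolding gf_of_beta_crank P5 by (simp only: mult_ac)
  \<comment> \<open>The cube of the Euler product inverts \<open>Pser ^ 3\<close> and allows its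
    cancellation.\<close>
  have "euler_prod ^ 3 * fps_emb (Pser ^ 3) = 1"
    by (simp add: fps_emb_power euler_prod_emb_Pser flip: power_mult_distrib)
  hence cancel: "euler_prod ^ 3 * (fps_emb (Pser ^ 3) * F) = F" for F by (simp add: mult.assoc[symmetric])
  have "fps_emb (Pser ^ 2) * gf_of g = 2 * crank_gf ^ 3"
    using arg_cong[OF eq, of "\<lambda>F. euler_prod ^ 3 * F"] unfolding cancel .
  thus ?thesis unfolding gg .
qed

lemma emom_xpow_mult:
  "emom j (fps_const (xpow s) * F) = (\<Sum>i\<le>j. of_nat (j choose i) * (of_int (s ^ i) * emom (j - i) F))"
proof -
  have "emom i (fps_const (xpow s)) = of_int (s ^ i)" for i
    by (rule fps_ext) (simp add: emom_def xpow_nth fps_of_int[symmetric] del: of_int_power)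
  thus ?thesis by (simp add: emom_mult)
qed

lemma sum_even_odd: "(\<Sum>i\<le>2 * k. f i) = (\<Sum>s\<le>k. f (2 * s)) + (\<Sum>s<k. f (2 * s + 1))"
  for f :: "nat \<Rightarrow> 'a :: comm_monoid_add"
  by (induction k) (auto simp: add_ac)

abbreviation rmom :: "nat \<Rightarrow> rat fps" where
  "rmom j \<equiv> emom j rank_gf"

text \<open>The equation is multiplied by \<open>x + 1 / x = 2 cosh t\<close> before moments are
  taken. The powers of 2, 0 and -1 are the moments of \<open>(x + 1 / x) (x + 1 / x - 2) = x\<^sup>2
  + x ^ (-2) + 2 - 2 x - 2 / x\<close>, with \<open>0 ^ i\<close> coming from the constant.\<close>

lemma rank_crank_moments_raw:
  "Pser ^ 2 * (\<Sum>i\<le>2 * k. of_nat (2 * k choose i) *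
      (of_int (2 ^ i + (-2) ^ i + 2 * 0 ^ i - 2 - 2 * (-1) ^ i) * (6 * delta_q (rmom (2 * k - i)) + rmom (Suc (Suc (2 * k - i))))
       - of_int (2 ^ i - (-2) ^ i) * rmom (Suc (2 * k - i)) + of_int (2 * (1 + (-1) ^ i)) * rmom (2 * k - i))) =
   (\<Sum>i\<le>2 * k. of_nat (2 * k choose i) * (of_int (2 * (1 + (-1) ^ i)) * emom (2 * k - i) (crank_gf ^ 3)))"
proof -
  define X where "X s = fps_const (xpow s)" for s
  have X: "X a * X b = X (a + b)" for a b by (simp add: X_def xpow_add)
  have X0: "X 0 = 1" by (simp add: X_def)
  define S where "S = 6 * fps_Dq rank_gf + fps_Dt (fps_Dt rank_gf)"
  have pde: "fps_emb (Pser ^ 2) * ((X 1 + X (-1) - 2) * S - (X 1 - X (-1)) * fps_Dt rank_gf + 2 * rank_gf) = 2 * crank_gf ^ 3"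
    using rank_crank_pde unfolding X_def S_def .
  have "fps_emb (Pser ^ 2) * ((X 1 + X (-1)) * ((X 1 + X (-1) - 2) * S - (X 1 - X (-1)) * fps_Dt rank_gf + 2 * rank_gf)) =
      (X 1 + X (-1)) * (2 * crank_gf ^ 3)"
    unfolding pde[symmetric] by (simp only: mult_ac)
  also have "(X 1 + X (-1)) * ((X 1 + X (-1) - 2) * S - (X 1 - X (-1)) * fps_Dt rank_gf + 2 * rank_gf) =
     (X 2 * S + X (-2) * S + (X 0 * S + X 0 * S) - (X 1 * S + X 1 * S) - (X (-1) * S + X (-1) * S))
     - (X 2 * fps_Dt rank_gf - X (-2) * fps_Dt rank_gf) + ((X 1 * rank_gf + X 1 * rank_gf) + (X (-1) * rank_gf + X (-1) * rank_gf))"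
  proof -
    have "X 2 = X 1 * X 1" "X (-2) = X (-1) * X (-1)" "X 0 = X 1 * X (-1)" by (simp_all add: X)
    thus ?thesis by (simp only:) (simp add: algebra_simps)
  qed
  also have "(X 1 + X (-1)) * (2 * crank_gf ^ 3) =
     (X 1 * crank_gf ^ 3 + X 1 * crank_gf ^ 3) + (X (-1) * crank_gf ^ 3 + X (-1) * crank_gf ^ 3)"
    by (simp add: algebra_simps)
  finally have eq: "emom (2 * k) (fps_emb (Pser ^ 2) * ((X 2 * S + X (-2) * S + (X 0 * S + X 0 * S) - (X 1 * S + X 1 * S) - (X (-1) * S + X (-1) * S))
     - (X 2 * fps_Dt rank_gf - X (-2) * fps_Dt rank_gf) + ((X 1 * rank_gf + X 1 * rank_gf) + (X (-1) * rank_gf + X (-1) * rank_gf)))) =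
     emom (2 * k) ((X 1 * crank_gf ^ 3 + X 1 * crank_gf ^ 3) + (X (-1) * crank_gf ^ 3 + X (-1) * crank_gf ^ 3))"
    by (rule arg_cong)
  have Sm: "emom j S = 6 * delta_q (rmom j) + rmom (Suc (Suc j))" for j
  proof -
    have "emom j (6 * F) = 6 * emom j F" for F by (simp add: emom_def fps_eq_iff numeral_fps_const)
    thus ?thesis by (simp add: S_def emom_add emom_Dt emom_Dq)
  qed
  have mr: "emom (2 * k) (X s * F) = (\<Sum>i\<le>2 * k. of_nat (2 * k choose i) * (of_int (s ^ i) * emom (2 * k - i) F))" for s F
    unfolding X_def by (rule emom_xpow_mult)
  show ?thesis
    using eq unfolding emom_emb_mult emom_add emom_diff mr Sm emom_Dt
    by (simp only: sum.distrib[symmetric] sum_subtractf[symmetric])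
       (simp add: algebra_simps)
qed

text \<open>\<open>coefA k i\<close> and \<open>coefB k i\<close> are the coefficient of
  \<open>x\<close> and the constant term of the linear factor in the recurrence of
  \<open>Ppoly\<close>, before normalisation.\<close>

definition coefA :: "nat \<Rightarrow> nat \<Rightarrow> int" where
  "coefA k i = 6 * int (2 * k choose (2 * i)) * (2 ^ (2 * i - 1) - 1)"

definition coefB :: "nat \<Rightarrow> nat \<Rightarrow> int" where
  "coefB k i = int (2 * k choose (2 * i + 2)) * (2 ^ (2 * i + 1) - 1) - 2 ^ (2 * i) * int (2 * k choose (2 * i + 1)) +
     int (2 * k choose (2 * i))"

text \<open>Even \<open>i\<close> carry the symmetric factors, odd \<open>i\<close> only the
  antisymmetric \<open>x\<^sup>2 - x ^ (-2)\<close>, and a common factor 4 is cancelled. Reindexing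
  the second derivatives in \<open>t\<close> by one step merges three binomials into
  \<open>coefB\<close>; the zeroth moment \<open>Pser\<close> is split off.\<close>

lemma rank_crank_moments:
  "Pser ^ 2 * ((\<Sum>i<k. of_int (coefB k i) * rmom (2 * k - 2 * i)) + Pser +
      (\<Sum>i\<in>{1..k}. of_int (coefA k i) * delta_q (rmom (2 * k - 2 * i)))) =
   (\<Sum>s\<le>k. of_nat (2 * k choose (2 * s)) * emom (2 * k - 2 * s) (crank_gf ^ 3))"
proof -
  define T where "T j = 6 * delta_q (rmom j) + rmom (Suc (Suc j))" for j
  define f where "f i = of_nat (2 * k choose i) *
      (of_int (2 ^ i + (-2) ^ i + 2 * 0 ^ i - 2 - 2 * (-1) ^ i) * T (2 * k - i)
       - of_int (2 ^ i - (-2) ^ i) * rmom (Suc (2 * k - i)) + of_int (2 * (1 + (-1) ^ i)) * rmom (2 * k - i))" for i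
  have four: "of_int 4 = (4 :: rat fps)" by simp
  have fe: "f (2 * s) = 4 * (of_int (int (2 * k choose (2 * s)) * (if s = 0 then 0 else 2 ^ (2 * s - 1) - 1)) * T (2 * k - 2 * s) +
      of_int (int (2 * k choose (2 * s))) * rmom (2 * k - 2 * s))" for s
  proof -
    have e: "(-2 :: int) ^ (2 * s) = 2 ^ (2 * s)" "(-1 :: int) ^ (2 * s) = 1" by simp_all
    have "2 ^ (2 * s) + (2 ^ (2 * s)) + 2 * 0 ^ (2 * s) - 2 - 2 * 1 = 4 * (if s = 0 then 0 else 2 ^ (2 * s - 1) - 1 :: int)"
      by (cases s) simp_all
    hence "f (2 * s) = of_nat (2 * k choose (2 * s)) * (of_int (4 * (if s = 0 then 0 else 2 ^ (2 * s - 1) - 1)) * T (2 * k - 2 * s) + of_int 4 * rmom (2 * k - 2 * s))"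
      unfolding f_def e by simp
    thus ?thesis by (simp only: of_int_mult four of_int_of_nat_eq) (simp only: distrib_left mult_ac)
  qed
  have fo: "f (2 * s + 1) = - (4 * (of_int (2 ^ (2 * s) * int (2 * k choose (2 * s + 1))) * rmom (2 * k - 2 * s)))" if "s < k" for s
  proof -
    have e: "(-2 :: int) ^ (2 * s + 1) = - (2 * 2 ^ (2 * s))" "(-1 :: int) ^ (2 * s + 1) = -1" "(2 :: int) ^ (2 * s + 1) = 2 * 2 ^ (2 * s)"
      by simp_all
    have idx: "Suc (2 * k - (2 * s + 1)) = 2 * k - 2 * s" using that by simp
    have "f (2 * s + 1) = of_nat (2 * k choose (2 * s + 1)) * (- (of_int (4 * 2 ^ (2 * s)) * rmom (2 * k - 2 * s)))"
      unfolding f_def e idx by simp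
    thus ?thesis by (simp only: of_int_mult four of_int_of_nat_eq) (simp only: mult_minus_right mult_ac)
  qed
  define g where "g i = of_nat (2 * k choose i) * (of_int (2 * (1 + (-1) ^ i)) * emom (2 * k - i) (crank_gf ^ 3))" for i
  have ge: "g (2 * s) = 4 * (of_nat (2 * k choose (2 * s)) * emom (2 * k - 2 * s) (crank_gf ^ 3))" for s
    by (simp add: g_def)
  have go: "g (2 * s + 1) = 0" for s by (simp add: g_def)
  have "Pser ^ 2 * (\<Sum>i\<le>2 * k. f i) = (\<Sum>i\<le>2 * k. g i)"
    using rank_crank_moments_raw[of k] unfolding f_def g_def T_def .
  note fg = this
  define E where "E s = of_int (int (2 * k choose (2 * s)) * (if s = 0 then 0 else 2 ^ (2 * s - 1) - 1)) * T (2 * k - 2 * s) +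
      of_int (int (2 * k choose (2 * s))) * rmom (2 * k - 2 * s)" for s
  define Od where "Od s = of_int (2 ^ (2 * s) * int (2 * k choose (2 * s + 1))) * rmom (2 * k - 2 * s)" for s
  have "(\<Sum>s<k. f (2 * s + 1)) = (\<Sum>s<k. - (4 * Od s))"
    by (intro sum.cong refl) (simp only: fo Od_def lessThan_iff)
  hence F: "(\<Sum>i\<le>2 * k. f i) = 4 * ((\<Sum>s\<le>k. E s) - (\<Sum>s<k. Od s))"
    unfolding sum_even_odd fe E_def[symmetric] by (simp add: sum_negf sum_distrib_left right_diff_distrib)
  have G: "(\<Sum>i\<le>2 * k. g i) = 4 * (\<Sum>s\<le>k. of_nat (2 * k choose (2 * s)) * emom (2 * k - 2 * s) (crank_gf ^ 3))"
    unfolding sum_even_odd ge go by (simp add: sum_distrib_left)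
  have "4 * (Pser ^ 2 * ((\<Sum>s\<le>k. E s) - (\<Sum>s<k. Od s))) =
     4 * (\<Sum>s\<le>k. of_nat (2 * k choose (2 * s)) * emom (2 * k - 2 * s) (crank_gf ^ 3))"
    using fg unfolding F G by (simp only: mult_ac)
  hence main: "Pser ^ 2 * ((\<Sum>s\<le>k. E s) - (\<Sum>s<k. Od s)) =
     (\<Sum>s\<le>k. of_nat (2 * k choose (2 * s)) * emom (2 * k - 2 * s) (crank_gf ^ 3))"
    by (subst (asm) mult_left_cancel) simp_all
  have "(\<Sum>s\<le>k. of_int (int (2 * k choose (2 * s)) * (if s = 0 then 0 else 2 ^ (2 * s - 1) - 1)) * T (2 * k - 2 * s)) =
    (\<Sum>s\<in>{1..k}. of_int (int (2 * k choose (2 * s)) * (2 ^ (2 * s - 1) - 1)) * T (2 * k - 2 * s))"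
    by (intro sum.mono_neutral_cong_right) auto
  also have "\<dots> = (\<Sum>i\<in>{1..k}. of_int (coefA k i) * delta_q (rmom (2 * k - 2 * i))) +
      (\<Sum>s\<in>{1..k}. of_int (int (2 * k choose (2 * s)) * (2 ^ (2 * s - 1) - 1)) * rmom (Suc (Suc (2 * k - 2 * s))))"
    unfolding sum.distrib[symmetric] T_def coefA_def by (intro sum.cong refl) (simp add: distrib_left mult_ac)
  also have "(\<Sum>s\<in>{1..k}. of_int (int (2 * k choose (2 * s)) * (2 ^ (2 * s - 1) - 1)) * rmom (Suc (Suc (2 * k - 2 * s)))) =
      (\<Sum>i<k. of_int (int (2 * k choose (2 * i + 2)) * (2 ^ (2 * i + 1) - 1)) * rmom (2 * k - 2 * i))"
  proof (rule sum.reindex_bij_witness[where i = "\<lambda>i. i + 1" and j = "\<lambda>s. s - 1"])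
    fix s assume s: "s \<in> {1..k}"
    then obtain t where t: "s = Suc t" by (cases s) auto
    have "Suc (Suc (2 * k - 2 * s)) = 2 * k - 2 * t" using s t by auto
    thus "of_int (int (2 * k choose (2 * (s - 1) + 2)) * (2 ^ (2 * (s - 1) + 1) - 1)) * rmom (2 * k - 2 * (s - 1)) =
       of_int (int (2 * k choose (2 * s)) * (2 ^ (2 * s - 1) - 1)) * rmom (Suc (Suc (2 * k - 2 * s)))"
      by (simp add: t)
  qed auto
  finally have A: "(\<Sum>s\<le>k. of_int (int (2 * k choose (2 * s)) * (if s = 0 then 0 else 2 ^ (2 * s - 1) - 1)) * T (2 * k - 2 * s)) =
     (\<Sum>i\<in>{1..k}. of_int (coefA k i) * delta_q (rmom (2 * k - 2 * i))) +
      (\<Sum>i<k. of_int (int (2 * k choose (2 * i + 2)) * (2 ^ (2 * i + 1) - 1)) * rmom (2 * k - 2 * i))" .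
  have B: "(\<Sum>s\<le>k. of_int (int (2 * k choose (2 * s))) * rmom (2 * k - 2 * s)) =
     (\<Sum>i<k. of_int (int (2 * k choose (2 * i))) * rmom (2 * k - 2 * i)) + Pser"
    by (simp add: lessThan_Suc_atMost[symmetric] emom_rank_0)
  have arith: "b + p + a = a + s1 + (s3 + p) - s2" if "b = s1 - s2 + s3" for a b p s1 s2 s3 :: "rat fps"
    using that by (simp add: algebra_simps)
  have "(\<Sum>i<k. of_int (coefB k i) * rmom (2 * k - 2 * i)) =
     (\<Sum>i<k. of_int (int (2 * k choose (2 * i + 2)) * (2 ^ (2 * i + 1) - 1)) * rmom (2 * k - 2 * i)) -
     (\<Sum>s<k. of_int (2 ^ (2 * s) * int (2 * k choose (2 * s + 1))) * rmom (2 * k - 2 * s)) +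
     (\<Sum>i<k. of_int (int (2 * k choose (2 * i))) * rmom (2 * k - 2 * i))"
    unfolding coefB_def of_int_add of_int_diff distrib_right left_diff_distrib sum.distrib sum_subtractf ..
  from arith[OF this] show ?thesis unfolding main[symmetric] E_def Od_def sum.distrib A B by (rule arg_cong)
qed

subsection \<open>Quasimodularity of the moments\<close>

declare Ppoly.simps [simp del]

lemma poly_delta_add: "poly_delta (p + q) F = poly_delta p F + poly_delta q F"
  by (simp add: poly_delta_def fps_eq_iff algebra_simps)

lemma poly_delta_sum: "poly_delta (\<Sum>i\<in>I. p i) F = (\<Sum>i\<in>I. poly_delta (p i) F)"
proof -
  have "poly_delta 0 F = 0" by (simp add: poly_delta_def fps_eq_iff)
  thus ?thesis by (induction I rule: infinite_finite_induct) (auto simp: poly_delta_add)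
qed

lemma poly_delta_smult: "poly_delta (smult c p) F = fps_const c * poly_delta p F"
  by (simp add: poly_delta_def fps_eq_iff)

lemma poly_delta_linear_mult:
  "poly_delta ([:b, a:] * p) F = fps_const b * poly_delta p F + fps_const a * delta_q (poly_delta p F)"
  by (simp add: poly_delta_def delta_q_def fps_eq_iff algebra_simps)

lemma Ppoly_rec:
  assumes "k \<ge> 2"
  shows "of_nat ((2 * k - 1) * (k - 1)) * poly_delta (Ppoly k) F =
     - (\<Sum>i\<in>{1..k-1}. of_int (coefB k i) * poly_delta (Ppoly (k - i)) F + of_int (coefA k i) * delta_q (poly_delta (Ppoly (k - i)) F))"
proof -
  define N :: rat where "N = of_nat (2 * k - 1) * of_nat (k - 1)"
  have N0: "N \<noteq> 0" using assms by (simp add: N_def)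
  have "Ppoly k = smult (- 1 / N) (\<Sum>i\<in>{1..k-1}. [:of_int (coefB k i), of_int (coefA k i):] * Ppoly (k - i))"
    using assms by (subst Ppoly.simps) (simp add: N_def coefA_def coefB_def)
  hence "poly_delta (Ppoly k) F = fps_const (- 1 / N) * (\<Sum>i\<in>{1..k-1}. of_int (coefB k i) * poly_delta (Ppoly (k - i)) F +
      of_int (coefA k i) * delta_q (poly_delta (Ppoly (k - i)) F))"
    by (simp only: poly_delta_smult poly_delta_sum poly_delta_linear_mult fps_of_int)
  moreover have "of_nat ((2 * k - 1) * (k - 1)) = fps_const N" by (simp add: N_def fps_of_nat[symmetric] del: of_nat_diff)
  moreover have "fps_const N * (fps_const (- 1 / N) * G) = - G" for G
  proof -
    have "fps_const N * fps_const (- 1 / N) = fps_const (- 1)" using N0 by simp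
    hence "fps_const N * (fps_const (- 1 / N) * G) = fps_const (- 1) * G" by (metis mult.assoc)
    also have "\<dots> = - G" by (metis fps_const_1_eq_1 fps_const_neg mult_minus1)
    finally show ?thesis .
  qed
  ultimately show ?thesis by simp
qed

lemma Pser_nonzero: "Pser \<noteq> 0"
proof
  assume "Pser = 0"
  hence "Pser $ 0 = 0" by simp
  thus False by (simp add: Pser_nth partitions_0)
qed

text \<open>\<open>poly_delta (Ppoly k) (rmom 2)\<close> solves the homogeneous recurrence with
  leading coefficient \<open>coefB k 0 = (2 k - 1) (k - 1)\<close>, so subtracting it preserves the
  shape. Inhomogeneous are only \<open>Z\<close> and the terms from \<open>rmom 0 = Pser\<close>:
  the 1 and, through \<open>delta_q Pser\<close>, the multiple of \<open>Phi 1\<close>.\<close>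

lemma rank_residual_rec:
  assumes k: "k \<ge> 2"
    and Z: "(\<Sum>s\<le>k. of_nat (2 * k choose (2 * s)) * emom (2 * k - 2 * s) (crank_gf ^ 3)) = Pser ^ 3 * Z"
  defines "U \<equiv> \<lambda>k. rmom (2 * k) - poly_delta (Ppoly k) (rmom 2)"
  shows "of_nat ((2 * k - 1) * (k - 1)) * U k = Pser * (Z - 1 - of_int (coefA k k) * Phi 1) -
     (\<Sum>i\<in>{1..k-1}. of_int (coefB k i) * U (k - i) + of_int (coefA k i) * delta_q (U (k - i)))"
proof -
  have "Pser ^ 2 * ((\<Sum>i<k. of_int (coefB k i) * rmom (2 * k - 2 * i)) + Pser +
      (\<Sum>i\<in>{1..k}. of_int (coefA k i) * delta_q (rmom (2 * k - 2 * i)))) = Pser ^ 2 * (Pser * Z)"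
    using rank_crank_moments[of k] unfolding Z by (simp add: power3_eq_cube power2_eq_square mult_ac)
  hence "(\<Sum>i<k. of_int (coefB k i) * rmom (2 * k - 2 * i)) + Pser +
      (\<Sum>i\<in>{1..k}. of_int (coefA k i) * delta_q (rmom (2 * k - 2 * i))) = Pser * Z"
    using Pser_nonzero by (subst (asm) mult_left_cancel) simp_all
  moreover have "(\<Sum>i<k. of_int (coefB k i) * rmom (2 * k - 2 * i)) =
     of_nat ((2 * k - 1) * (k - 1)) * rmom (2 * k) + (\<Sum>i\<in>{1..k-1}. of_int (coefB k i) * rmom (2 * (k - i)))"
  proof -
    have "{..<k} = insert 0 {1..k-1}" using k by auto
    moreover have "coefB k 0 = int ((2 * k - 1) * (k - 1))"
    proof -
      have c2: "(2 * k) choose 2 = k * (2 * k - 1)" by (simp add: choose_two)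
      have "coefB k 0 = int ((2 * k) choose 2) - int (2 * k) + 1" unfolding coefB_def by (simp add: numeral_2_eq_2)
      also have "\<dots> = int ((2 * k - 1) * (k - 1))" 
      proof -
        obtain j where "k = Suc j" using k by (cases k) auto
        thus ?thesis unfolding c2 by (simp add: algebra_simps)
      qed
      finally show ?thesis .
    qed
    ultimately show ?thesis by (simp add: diff_mult_distrib2 del: of_nat_mult)
  qed
  moreover have "(\<Sum>i\<in>{1..k}. of_int (coefA k i) * delta_q (rmom (2 * k - 2 * i))) =
     (\<Sum>i\<in>{1..k-1}. of_int (coefA k i) * delta_q (rmom (2 * (k - i)))) + of_int (coefA k k) * (Pser * Phi 1)"
  proof -
    have "{1..k} = insert k {1..k-1}" using k by auto
    thus ?thesis using k by (simp add: diff_mult_distrib2 emom_rank_0 delta_q_Pser add.commute)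
  qed
  ultimately have R: "of_nat ((2 * k - 1) * (k - 1)) * rmom (2 * k) = Pser * (Z - 1 - of_int (coefA k k) * Phi 1) -
      (\<Sum>i\<in>{1..k-1}. of_int (coefB k i) * rmom (2 * (k - i)) + of_int (coefA k i) * delta_q (rmom (2 * (k - i))))"
    unfolding sum.distrib by (simp add: algebra_simps)
  show ?thesis
    unfolding U_def right_diff_distrib R Ppoly_rec[OF k] delta_q_diff sum_subtractf[symmetric]
    by (simp add: sum.distrib sum_subtractf algebra_simps)
qed

section \<open>Membership of the moments at a fixed prime \<open>l > 3\<close>\<close>

context
  fixes l :: nat
  assumes l: "prime l" and l3: "l > 3"
begin

lemma l_odd: "odd l" and l5: "l \<ge> 5"
proof -
  show "odd l" using l l3 prime_odd_nat by auto
  hence "l \<noteq> 4" by auto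
  thus "l \<ge> 5" using l3 by simp
qed

lemma X_Phi_1: "Phi 1 \<in> Xset l 2"
  using Xset_Phi[OF l l3, of 1] l5 by (simp add: numeral_2_eq_2)

text \<open>In the recurrence for \<open>j = Suc n\<close> the weights add up,
  \<open>i + (n - i + 1) = j\<close>, and every \<open>Phi\<close> that occurs has weight at most
  \<open>l - 3\<close>.\<close>

lemma crank_moment_mem:
  "j \<le> l - 3 \<Longrightarrow> \<exists>G\<in>Xset l j. emom j crank_gf = Pser * G"
proof (induction j rule: less_induct)
  case (less j)
  show ?case
  proof (cases j)
    case 0
    have "1 \<in> Xset l 0" using Xset_of_int[OF l, of 1] by simp
    thus ?thesis using 0 by (auto simp: emom_crank_0)
  next
    case (Suc n)
    have "\<exists>G\<in>Xset l j. of_nat (n choose i) * (emom i crank_gf * (if odd (n - i) then 2 * Phi (n - i) else 0)) = Pser * G"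
      if i: "i \<le> n" for i
    proof (cases "odd (n - i)")
      case True
      obtain G where G: "G \<in> Xset l i" "emom i crank_gf = Pser * G" using less.IH[of i] less.prems i Suc by auto
      have "Phi (n - i) \<in> Xset l (n - i + 1)" using True less.prems Suc by (intro Xset_Phi l l3) auto
      hence "of_nat (n choose i) * (G * (of_nat 2 * Phi (n - i))) \<in> Xset l (0 + (i + (0 + (n - i + 1))))"
        by (intro Xset_mult l Xset_of_nat G)
      thus ?thesis using True G i Suc by (intro bexI[of _ "of_nat (n choose i) * (G * (of_nat 2 * Phi (n - i)))"]) auto
    qed (auto intro!: bexI[of _ 0] Xset_0)
    then obtain H where H: "\<And>i. i \<le> n \<Longrightarrow> H i \<in> Xset l j"
      "\<And>i. i \<le> n \<Longrightarrow> of_nat (n choose i) * (emom i crank_gf * (if odd (n - i) then 2 * Phi (n - i) else 0)) = Pser * H i"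
      by metis
    have "emom j crank_gf = (\<Sum>i\<le>n. Pser * H i)"
      unfolding Suc crank_moment_rec by (intro sum.cong refl H) simp
    hence "emom j crank_gf = Pser * (\<Sum>i\<le>n. H i)" by (simp add: sum_distrib_left)
    moreover have "(\<Sum>i\<le>n. H i) \<in> Xset l j" by (intro Xset_sum H) simp
    ultimately show ?thesis by blast
  qed
qed

text \<open>\<open>Phi (l - 2)\<close> occurs only next to the zeroth moment. Every other nonzero
  term has an even \<open>i >= 2\<close>, so that both of its factors lie in the range already
  covered.\<close>

lemma crank_moment_top:
  "\<exists>G\<in>Xset l (l - 1). emom (l - 1) crank_gf = Pser * (2 * Phi (l - 2) + G)"
proof -
  define n where "n = l - 2"
  have n: "l - 1 = Suc n" "odd n" "n \<ge> 3" using l5 l_odd by (auto simp: n_def)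
  have "\<exists>G\<in>Xset l (l - 1). of_nat (n choose i) * (emom i crank_gf * (if odd (n - i) then 2 * Phi (n - i) else 0)) = Pser * G"
    if i: "i \<in> {1..n}" for i
  proof (cases "odd (n - i)")
    case True
    hence ev: "even i" using n i by auto
    hence "i \<noteq> n" "i \<noteq> 1" using n(2) by auto
    hence i2: "i \<ge> 2" "i \<le> l - 3" using i unfolding n_def by auto
    obtain G where G: "G \<in> Xset l i" "emom i crank_gf = Pser * G" using crank_moment_mem[OF i2(2)] by auto
    have "Phi (n - i) \<in> Xset l (n - i + 1)" using True i2 by (intro Xset_Phi l l3) (auto simp: n_def)
    hence "of_nat (n choose i) * (G * (of_nat 2 * Phi (n - i))) \<in> Xset l (0 + (i + (0 + (n - i + 1))))"
      by (intro Xset_mult l Xset_of_nat G)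
    moreover have "0 + (i + (0 + (n - i + 1))) = l - 1" using i n by simp
    ultimately show ?thesis using True G by (intro bexI[of _ "of_nat (n choose i) * (G * (of_nat 2 * Phi (n - i)))"]) (auto simp: mult_ac)
  qed (auto intro!: bexI[of _ 0] Xset_0)
  then obtain H where H: "\<And>i. i \<in> {1..n} \<Longrightarrow> H i \<in> Xset l (l - 1)"
    "\<And>i. i \<in> {1..n} \<Longrightarrow> of_nat (n choose i) * (emom i crank_gf * (if odd (n - i) then 2 * Phi (n - i) else 0)) = Pser * H i"
    by metis
  have "{..n} = insert 0 {1..n}" by auto
  hence "emom (l - 1) crank_gf = Pser * (2 * Phi n) +
     (\<Sum>i\<in>{1..n}. of_nat (n choose i) * (emom i crank_gf * (if odd (n - i) then 2 * Phi (n - i) else 0)))"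
    unfolding n(1) crank_moment_rec using n(2) by (simp add: emom_crank_0)
  also have "(\<Sum>i\<in>{1..n}. of_nat (n choose i) * (emom i crank_gf * (if odd (n - i) then 2 * Phi (n - i) else 0))) = (\<Sum>i\<in>{1..n}. Pser * H i)"
    by (intro sum.cong refl H)
  finally have "emom (l - 1) crank_gf = Pser * (2 * Phi (l - 2) + (\<Sum>i\<in>{1..n}. H i))"
    by (simp add: n_def distrib_left sum_distrib_left)
  moreover have "(\<Sum>i\<in>{1..n}. H i) \<in> Xset l (l - 1)" by (intro Xset_sum H)
  ultimately show ?thesis by blast
qed

text \<open>\<open>r\<close> is the power of \<open>Pser\<close> and \<open>a\<close> the
  multiplicity of \<open>Phi (l - 2)\<close> in the moment of order \<open>l - 1\<close>; both are
  additive under products, which handles the cube.\<close>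

definition top_moments :: "nat \<Rightarrow> nat \<Rightarrow> rat fps fps \<Rightarrow> bool" where
  "top_moments r a F \<longleftrightarrow> emom 0 F = Pser ^ r \<and>
     (\<forall>j \<le> l - 2. \<exists>G\<in>Xset l j. emom j F = Pser ^ r * G) \<and>
     (\<exists>G\<in>Xset l (l - 1). emom (l - 1) F = Pser ^ r * (of_nat a * Phi (l - 2) + G))"

lemma top_moments_crank: "top_moments 1 2 crank_gf"
proof -
  have "\<exists>G\<in>Xset l j. emom j crank_gf = Pser ^ 1 * G" if "j \<le> l - 2" for j
  proof (cases "j \<le> l - 3")
    case False
    hence "j = l - 2" using that by simp
    hence "odd j" using l_odd l5 by simp
    thus ?thesis using Xset_0 by (auto simp: crank_moment_odd)
  qed (use crank_moment_mem in simp)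
  thus ?thesis using crank_moment_top unfolding top_moments_def by (simp add: emom_crank_0)
qed

text \<open>In the Leibniz expansion of the top moment only the two end terms carry
  \<open>Phi (l - 2)\<close> explicitly; all others pair orders between 1 and
  \<open>l - 2\<close>.\<close>

lemma top_moments_mult:
  assumes F: "top_moments r a F" and G: "top_moments s b G"
  shows "top_moments (r + s) (a + b) (F * G)"
  unfolding top_moments_def
proof (intro conjI allI impI)
  show "emom 0 (F * G) = Pser ^ (r + s)"
    using F G by (simp add: top_moments_def emom_mult power_add)
  obtain f where f: "\<And>j. j \<le> l - 2 \<Longrightarrow> f j \<in> Xset l j" "\<And>j. j \<le> l - 2 \<Longrightarrow> emom j F = Pser ^ r * f j"
    using F unfolding top_moments_def by metis
  obtain g where g: "\<And>j. j \<le> l - 2 \<Longrightarrow> g j \<in> Xset l j" "\<And>j. j \<le> l - 2 \<Longrightarrow> emom j G = Pser ^ s * g j"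
    using G unfolding top_moments_def by metis
  have mem: "of_nat (j choose i) * (f i * g (j - i)) \<in> Xset l j" if "i \<le> j" "i \<le> l - 2" "j - i \<le> l - 2" for i j
  proof -
    have "of_nat (j choose i) * (f i * g (j - i)) \<in> Xset l (0 + (i + (j - i)))"
      using that by (intro Xset_mult l Xset_of_nat f g)
    thus ?thesis using that by simp
  qed
  have eq: "of_nat (j choose i) * (emom i F * emom (j - i) G) = Pser ^ (r + s) * (of_nat (j choose i) * (f i * g (j - i)))"
    if "i \<le> l - 2" "j - i \<le> l - 2" for i j
    using that by (simp add: f g power_add mult_ac)
  fix j assume j: "j \<le> l - 2"
  have "emom j (F * G) = (\<Sum>i\<le>j. Pser ^ (r + s) * (of_nat (j choose i) * (f i * g (j - i))))"
    unfolding emom_mult using j by (intro sum.cong refl eq) auto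
  hence "emom j (F * G) = Pser ^ (r + s) * (\<Sum>i\<le>j. of_nat (j choose i) * (f i * g (j - i)))"
    by (simp add: sum_distrib_left)
  moreover have "(\<Sum>i\<le>j. of_nat (j choose i) * (f i * g (j - i))) \<in> Xset l j"
    using j by (intro Xset_sum mem) auto
  ultimately show "\<exists>H\<in>Xset l j. emom j (F * G) = Pser ^ (r + s) * H" by blast
next
  obtain f where f: "\<And>j. j \<le> l - 2 \<Longrightarrow> f j \<in> Xset l j" "\<And>j. j \<le> l - 2 \<Longrightarrow> emom j F = Pser ^ r * f j"
    using F unfolding top_moments_def by metis
  obtain g where g: "\<And>j. j \<le> l - 2 \<Longrightarrow> g j \<in> Xset l j" "\<And>j. j \<le> l - 2 \<Longrightarrow> emom j G = Pser ^ s * g j"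
    using G unfolding top_moments_def by metis
  obtain ft gt where t: "ft \<in> Xset l (l - 1)" "emom (l - 1) F = Pser ^ r * (of_nat a * Phi (l - 2) + ft)"
     "gt \<in> Xset l (l - 1)" "emom (l - 1) G = Pser ^ s * (of_nat b * Phi (l - 2) + gt)"
    using F G unfolding top_moments_def by blast
  define J where "J = {1..l - 2}"
  have split: "{..l - 1} = insert 0 (insert (l - 1) J)" using l5 by (auto simp: J_def)
  have nin: "0 \<notin> insert (l - 1) J" "l - 1 \<notin> J" "finite J" using l5 by (auto simp: J_def)
  define m where "m = (\<Sum>i\<in>J. of_nat (l - 1 choose i) * (f i * g (l - 1 - i)))"
  have "of_nat (l - 1 choose i) * (f i * g (l - 1 - i)) \<in> Xset l (l - 1)" if "i \<in> J" for i
  proof -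
    have "of_nat (l - 1 choose i) * (f i * g (l - 1 - i)) \<in> Xset l (0 + (i + (l - 1 - i)))"
      using that by (intro Xset_mult l Xset_of_nat f g) (auto simp: J_def)
    moreover have "0 + (i + (l - 1 - i)) = l - 1" using that by (auto simp: J_def)
    ultimately show ?thesis by simp
  qed
  hence mX: "m \<in> Xset l (l - 1)" unfolding m_def by (rule Xset_sum)
  have J: "(\<Sum>i\<in>J. of_nat (l - 1 choose i) * (emom i F * emom (l - 1 - i) G)) = Pser ^ (r + s) * m"
    unfolding m_def sum_distrib_left
  proof (rule sum.cong[OF refl])
    fix i assume i: "i \<in> J"
    hence "i \<le> l - 2" "l - 1 - i \<le> l - 2" by (auto simp: J_def)
    thus "of_nat (l - 1 choose i) * (emom i F * emom (l - 1 - i) G) = Pser ^ (r + s) * (of_nat (l - 1 choose i) * (f i * g (l - 1 - i)))"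
      by (simp add: f g power_add mult_ac)
  qed
  have "emom (l - 1) (F * G) = emom 0 F * emom (l - 1) G + (emom (l - 1) F * emom 0 G +
     (\<Sum>i\<in>J. of_nat (l - 1 choose i) * (emom i F * emom (l - 1 - i) G)))"
    unfolding emom_mult split using nin by simp
  also have "\<dots> = Pser ^ (r + s) * (of_nat (a + b) * Phi (l - 2) + (ft + gt + m))"
    unfolding J t(2,4) using F G by (simp add: top_moments_def power_add algebra_simps)
  finally show "\<exists>H\<in>Xset l (l - 1). emom (l - 1) (F * G) = Pser ^ (r + s) * (of_nat (a + b) * Phi (l - 2) + H)"
    using t mX by (blast intro: Xset_add)
qed

lemma top_moments_crank_cube: "top_moments 3 6 (crank_gf ^ 3)"
  using top_moments_mult[OF top_moments_crank top_moments_mult[OF top_moments_crank top_moments_crank]]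
  by (simp add: power3_eq_cube mult.assoc numeral_eq_Suc)

lemma cube_combination_mem:
  assumes "2 * k \<le> l - 3"
  shows "\<exists>Z\<in>Xset l (2 * k). (\<Sum>s\<le>k. of_nat (2 * k choose (2 * s)) * emom (2 * k - 2 * s) (crank_gf ^ 3)) = Pser ^ 3 * Z"
proof -
  have c: "\<forall>j \<le> l - 2. \<exists>G\<in>Xset l j. emom j (crank_gf ^ 3) = Pser ^ 3 * G"
    using top_moments_crank_cube by (auto simp: top_moments_def)
  obtain f where f: "\<And>j. j \<le> l - 2 \<Longrightarrow> f j \<in> Xset l j" "\<And>j. j \<le> l - 2 \<Longrightarrow> emom j (crank_gf ^ 3) = Pser ^ 3 * f j"
    using c by metis
  have "of_nat (2 * k choose (2 * s)) * f (2 * k - 2 * s) \<in> Xset l (2 * k)" if "s \<le> k" for s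
  proof -
    have "of_nat (2 * k choose (2 * s)) * f (2 * k - 2 * s) \<in> Xset l (0 + (2 * k - 2 * s))"
      using assms by (intro Xset_mult l Xset_of_nat f) auto
    thus ?thesis by (rule Xset_mono) auto
  qed
  hence "(\<Sum>s\<le>k. of_nat (2 * k choose (2 * s)) * f (2 * k - 2 * s)) \<in> Xset l (2 * k)" by (intro Xset_sum) auto
  moreover have "(\<Sum>s\<le>k. of_nat (2 * k choose (2 * s)) * emom (2 * k - 2 * s) (crank_gf ^ 3)) =
     Pser ^ 3 * (\<Sum>s\<le>k. of_nat (2 * k choose (2 * s)) * f (2 * k - 2 * s))"
    unfolding sum_distrib_left using assms by (intro sum.cong refl) (simp add: f mult_ac)
  ultimately show ?thesis by blast
qed

text \<open>Only the summand \<open>s = 0\<close> reaches order \<open>l - 1\<close>, and it brings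
  \<open>6 Phi (l - 2)\<close>.\<close>

lemma cube_combination_top:
  assumes "2 * k = l - 1"
  shows "\<exists>Z\<in>Xset l (l - 1). (\<Sum>s\<le>k. of_nat (2 * k choose (2 * s)) * emom (2 * k - 2 * s) (crank_gf ^ 3)) =
     Pser ^ 3 * (6 * Phi (l - 2) + Z)"
proof -
  have c: "\<forall>j \<le> l - 2. \<exists>G\<in>Xset l j. emom j (crank_gf ^ 3) = Pser ^ 3 * G"
    using top_moments_crank_cube by (auto simp: top_moments_def)
  obtain f where f: "\<And>j. j \<le> l - 2 \<Longrightarrow> f j \<in> Xset l j" "\<And>j. j \<le> l - 2 \<Longrightarrow> emom j (crank_gf ^ 3) = Pser ^ 3 * f j"
    using c by metis
  obtain G where G: "G \<in> Xset l (l - 1)" "emom (l - 1) (crank_gf ^ 3) = Pser ^ 3 * (6 * Phi (l - 2) + G)"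
    using top_moments_crank_cube by (auto simp: top_moments_def)
  have le: "2 * k - 2 * s \<le> l - 2" if "s \<in> {1..k}" for s using assms that by auto
  have "of_nat (2 * k choose (2 * s)) * f (2 * k - 2 * s) \<in> Xset l (l - 1)" if "s \<in> {1..k}" for s
  proof -
    have "of_nat (2 * k choose (2 * s)) * f (2 * k - 2 * s) \<in> Xset l (0 + (2 * k - 2 * s))"
      using le[OF that] by (intro Xset_mult l Xset_of_nat f)
    thus ?thesis by (rule Xset_mono) (use assms in auto)
  qed
  hence "(\<Sum>s\<in>{1..k}. of_nat (2 * k choose (2 * s)) * f (2 * k - 2 * s)) \<in> Xset l (l - 1)" by (rule Xset_sum)
  hence "G + (\<Sum>s\<in>{1..k}. of_nat (2 * k choose (2 * s)) * f (2 * k - 2 * s)) \<in> Xset l (l - 1)" by (intro Xset_add G)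
  moreover have "(\<Sum>s\<le>k. of_nat (2 * k choose (2 * s)) * emom (2 * k - 2 * s) (crank_gf ^ 3)) =
     Pser ^ 3 * (6 * Phi (l - 2) + (G + (\<Sum>s\<in>{1..k}. of_nat (2 * k choose (2 * s)) * f (2 * k - 2 * s))))"
  proof -
    have "{..k} = insert 0 {1..k}" by auto
    hence "(\<Sum>s\<le>k. of_nat (2 * k choose (2 * s)) * emom (2 * k - 2 * s) (crank_gf ^ 3)) =
      emom (l - 1) (crank_gf ^ 3) + (\<Sum>s\<in>{1..k}. of_nat (2 * k choose (2 * s)) * emom (2 * k - 2 * s) (crank_gf ^ 3))"
      using assms by simp
    also have "(\<Sum>s\<in>{1..k}. of_nat (2 * k choose (2 * s)) * emom (2 * k - 2 * s) (crank_gf ^ 3)) =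
       Pser ^ 3 * (\<Sum>s\<in>{1..k}. of_nat (2 * k choose (2 * s)) * f (2 * k - 2 * s))"
      unfolding sum_distrib_left
    proof (rule sum.cong[OF refl])
      fix s assume "s \<in> {1..k}"
      thus "of_nat (2 * k choose (2 * s)) * emom (2 * k - 2 * s) (crank_gf ^ 3) =
         Pser ^ 3 * (of_nat (2 * k choose (2 * s)) * f (2 * k - 2 * s))"
        unfolding f(2)[OF le] by (simp only: f(2)[OF le] mult.left_commute)
    qed
    finally show ?thesis unfolding G(2) by (simp only: distrib_left add.assoc)
  qed
  ultimately show ?thesis by blast
qed

lemma delta_Pser_mult_mem:
  assumes "G \<in> Xset l k"
  shows "\<exists>H\<in>Xset l (k + 2). delta_q (Pser * G) = Pser * H"
proof -
  have "Phi 1 * G \<in> Xset l (2 + k)" by (rule Xset_mult[OF l X_Phi_1 assms])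
  hence "Phi 1 * G + delta_q G \<in> Xset l (k + 2)"
    by (intro Xset_add Xset_delta_q[OF l l3 assms]) (simp add: add.commute)
  moreover have "delta_q (Pser * G) = Pser * (Phi 1 * G + delta_q G)"
    by (simp add: delta_q_mult delta_q_Pser algebra_simps)
  ultimately show ?thesis by blast
qed

abbreviation residual :: "nat \<Rightarrow> rat fps" where
  "residual k \<equiv> rmom (2 * k) - poly_delta (Ppoly k) (rmom 2)"

text \<open>\<open>delta_q\<close> raises the weight by 2, but \<open>i >= 1\<close> lowers the
  index \<open>2 (k - i)\<close> by at least as much.\<close>

lemma residual_sum_mem:
  assumes IH: "\<And>j. 1 \<le> j \<Longrightarrow> j < k \<Longrightarrow> \<exists>G\<in>Xset l (2 * j). residual j = Pser * G"
  shows "\<exists>G\<in>Xset l (2 * k). (\<Sum>i\<in>{1..k-1}. of_int (coefB k i) * residual (k - i) + of_int (coefA k i) * delta_q (residual (k - i))) = Pser * G"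
proof -
  have "\<exists>G\<in>Xset l (2 * k). of_int (coefB k i) * residual (k - i) + of_int (coefA k i) * delta_q (residual (k - i)) = Pser * G"
    if i: "i \<in> {1..k-1}" for i
  proof -
    have "1 \<le> i" "i \<le> k - 1" using i by auto
    hence "1 \<le> k - i" "k - i < k" by linarith+
    then obtain G where G: "G \<in> Xset l (2 * (k - i))" "residual (k - i) = Pser * G" using IH by blast
    obtain H where H: "H \<in> Xset l (2 * (k - i) + 2)" "delta_q (Pser * G) = Pser * H" using delta_Pser_mult_mem[OF G(1)] by blast
    have "of_int (coefB k i) * G \<in> Xset l (0 + 2 * (k - i))" "of_int (coefA k i) * H \<in> Xset l (0 + (2 * (k - i) + 2))"
      by (intro Xset_mult l Xset_of_int G H)+
    hence "of_int (coefB k i) * G \<in> Xset l (2 * k)" "of_int (coefA k i) * H \<in> Xset l (2 * k)"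
      using i by (auto elim!: Xset_mono)
    hence "of_int (coefB k i) * G + of_int (coefA k i) * H \<in> Xset l (2 * k)" by (rule Xset_add)
    thus ?thesis unfolding G(2) H(2) by (intro bexI[of _ "of_int (coefB k i) * G + of_int (coefA k i) * H"]) (auto simp: algebra_simps)
  qed
  then obtain f where f: "\<And>i. i \<in> {1..k-1} \<Longrightarrow> f i \<in> Xset l (2 * k)"
    "\<And>i. i \<in> {1..k-1} \<Longrightarrow> of_int (coefB k i) * residual (k - i) + of_int (coefA k i) * delta_q (residual (k - i)) = Pser * f i"
    by metis
  have "(\<Sum>i\<in>{1..k-1}. of_int (coefB k i) * residual (k - i) + of_int (coefA k i) * delta_q (residual (k - i))) = (\<Sum>i\<in>{1..k-1}. Pser * f i)"
    by (intro sum.cong refl f)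
  moreover have "sum f {1..k-1} \<in> Xset l (2 * k)" by (rule Xset_sum) (rule f(1))
  ultimately show ?thesis unfolding sum_distrib_left[symmetric] by blast
qed

text \<open>Both factors are positive and smaller than the prime \<open>l\<close>.\<close>

lemma leading_coeff_invertible:
  assumes "k \<ge> 2" "2 * k \<le> l - 1"
  shows "l_integral_rat l (1 / of_nat ((2 * k - 1) * (k - 1)))" "of_nat ((2 * k - 1) * (k - 1)) \<noteq> (0 :: rat)"
proof -
  have "\<not> l dvd 2 * k - 1" "\<not> l dvd k - 1" using assms by (auto dest!: dvd_imp_le)
  hence "\<not> l dvd (2 * k - 1) * (k - 1)" using l by (simp add: prime_dvd_mult_iff)
  thus "l_integral_rat l (1 / of_nat ((2 * k - 1) * (k - 1)))" by (rule l_integral_rat_inverse[OF l])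
  show "of_nat ((2 * k - 1) * (k - 1)) \<noteq> (0 :: rat)" using assms by (simp only: of_nat_eq_0_iff) simp
qed

lemma residual_1: "residual 1 = 0"
proof -
  have "Ppoly 1 = 1" by (subst Ppoly.simps) simp
  moreover have "poly_delta 1 F = F" for F by (simp add: poly_delta_def fps_eq_iff)
  ultimately show ?thesis by (simp only: mult_1_right diff_self)
qed

lemma residual_mem:
  "1 \<le> k \<Longrightarrow> 2 * k \<le> l - 3 \<Longrightarrow> \<exists>G\<in>Xset l (2 * k). residual k = Pser * G"
proof (induction k rule: less_induct)
  case (less k)
  show ?case
  proof (cases "k = 1")
    case True
    thus ?thesis using residual_1 Xset_0 by (intro bexI[of _ 0]) auto
  next
    case False
    hence k2: "k \<ge> 2" using less.prems by simp
    define D :: rat where "D = of_nat ((2 * k - 1) * (k - 1))"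
    have D: "l_integral_rat l (1 / D)" "D \<noteq> 0" unfolding D_def using leading_coeff_invertible[OF k2] less.prems by auto
    obtain Z where Z: "Z \<in> Xset l (2 * k)" "(\<Sum>s\<le>k. of_nat (2 * k choose (2 * s)) * emom (2 * k - 2 * s) (crank_gf ^ 3)) = Pser ^ 3 * Z"
      using cube_combination_mem[OF less.prems(2)] by blast
    obtain G where G: "G \<in> Xset l (2 * k)"
      "(\<Sum>i\<in>{1..k-1}. of_int (coefB k i) * residual (k - i) + of_int (coefA k i) * delta_q (residual (k - i))) = Pser * G"
      using residual_sum_mem[of k] less.IH less.prems by force
    have "of_int (coefA k k) * Phi 1 \<in> Xset l (0 + 2)" by (intro Xset_mult l Xset_of_int X_Phi_1)
    hence "of_int (coefA k k) * Phi 1 \<in> Xset l (2 * k)" using k2 by (auto elim!: Xset_mono)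
    moreover have "1 \<in> Xset l (2 * k)" using Xset_of_int[OF l, of 1] by simp
    ultimately have mem: "Z - 1 - of_int (coefA k k) * Phi 1 - G \<in> Xset l (2 * k)"
      by (intro Xset_diff l Z G)
    have "fps_const D * residual k = Pser * (Z - 1 - of_int (coefA k k) * Phi 1 - G)"
      using rank_residual_rec[OF k2 Z(2)] unfolding G(2) D_def fps_of_nat by (simp only: right_diff_distrib)
    hence "fps_const (1 / D) * (fps_const D * residual k) = Pser * (fps_const (1 / D) * (Z - 1 - of_int (coefA k k) * Phi 1 - G))"
      by (simp only: mult_ac)
    moreover have "fps_const (1 / D) * (fps_const D * residual k) = residual k" using D(2) by (simp add: mult.assoc[symmetric])
    ultimately show ?thesis using Xset_scale[OF l D(1) mem] by auto
  qed
qed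

text \<open>The inhomogeneous term now contains \<open>6 Phi (l - 2)\<close>, so dividing by the
  leading coefficient cannot be left to closure under scaling, as it was in lower weight.\<close>

lemma residual_top:
  "\<exists>G\<in>Xset l (l - 1). residual ((l - 1) div 2) = Pser * (2 * Phi (l - 2) + G)"
proof -
  define k where "k = (l - 1) div 2"
  have k: "2 * k = l - 1" "k \<ge> 2" using l_odd l5 by (auto simp: k_def)
  define D :: rat where "D = of_nat ((2 * k - 1) * (k - 1))"
  have D: "l_integral_rat l (1 / D)" "D \<noteq> 0" unfolding D_def using leading_coeff_invertible[OF k(2)] k by auto
  obtain Z where Z: "Z \<in> Xset l (l - 1)" "(\<Sum>s\<le>k. of_nat (2 * k choose (2 * s)) * emom (2 * k - 2 * s) (crank_gf ^ 3)) =
     Pser ^ 3 * (6 * Phi (l - 2) + Z)"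
    using cube_combination_top[OF k(1)] by blast
  have "\<exists>G\<in>Xset l (2 * j). residual j = Pser * G" if "1 \<le> j" "j < k" for j
    using that k by (intro residual_mem) auto
  then obtain G where G: "G \<in> Xset l (l - 1)"
    "(\<Sum>i\<in>{1..k-1}. of_int (coefB k i) * residual (k - i) + of_int (coefA k i) * delta_q (residual (k - i))) = Pser * G"
    using residual_sum_mem[of k] k(1) by fastforce
  have "of_int (coefA k k) * Phi 1 \<in> Xset l (0 + 2)" by (intro Xset_mult l Xset_of_int X_Phi_1)
  hence "of_int (coefA k k) * Phi 1 \<in> Xset l (l - 1)" using l5 by (auto elim!: Xset_mono)
  moreover have "1 \<in> Xset l (l - 1)" using Xset_of_int[OF l, of 1] by simp
  ultimately have mem: "Z - 1 - of_int (coefA k k) * Phi 1 - G \<in> Xset l (l - 1)"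
    by (intro Xset_diff l Z G)
  define Y where "Y = Z - 1 - of_int (coefA k k) * Phi 1 - G"
  have "fps_const D * residual k = Pser * (6 * Phi (l - 2) + Z - 1 - of_int (coefA k k) * Phi 1) - Pser * G"
    using rank_residual_rec[OF k(2) Z(2)] unfolding G(2) D_def fps_of_nat .
  hence DR: "fps_const D * residual k = Pser * (fps_const 6 * Phi (l - 2) + Y)"
    by (simp add: Y_def algebra_simps numeral_fps_const)
  text \<open>The leading coefficient is \<open>3\<close> modulo \<open>l\<close>, so dividing \<open>6\<close> by it leaves \<open>2\<close> up to a multiple of \<open>l\<close>.\<close>
  have six: "6 = 2 * D + (5 - of_nat l) * of_nat l"
  proof -
    \<comment> \<open>With \<open>2 k = l - 1\<close> this is
      \<open>(l - 2) (l - 3) = l\<^sup>2 - 5 l + 6\<close>, which yields the cofactor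
      \<open>5 - l\<close>.\<close>
    have "2 * D = of_nat (l - 2) * of_nat (2 * (k - 1))" using k by (simp add: D_def)
    also have "2 * (k - 1) = l - 3" using k by simp
    finally show ?thesis using l5 by (simp add: of_nat_diff algebra_simps)
  qed
  \<comment> \<open>The multiple of \<open>l\<close> that is left over; \<open>Xset_l_Phi\<close>
    places it in \<open>Xset\<close>.\<close>
  define E where "E = of_int (5 - int l) * (of_nat l * Phi (l - 2))"
  have E: "E \<in> Xset l (l - 1)"
    using Xset_mult[OF l Xset_of_int[OF l, of "5 - int l" 0] Xset_l_Phi[OF l l3]] by (simp add: E_def)
  have "fps_const 6 * Phi (l - 2) = fps_const D * (2 * Phi (l - 2)) + E"
  proof -
    have "fps_const 6 = fps_const D * 2 + (of_int (5 - int l) * of_nat l :: rat fps)"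
      by (subst six) (simp add: fps_of_int[symmetric] fps_of_nat[symmetric] numeral_fps_const mult.commute)
    thus ?thesis by (simp only: E_def distrib_right mult.assoc)
  qed
  hence "fps_const D * residual k = fps_const D * (Pser * (2 * Phi (l - 2))) + Pser * (E + Y)"
    using DR by (simp add: algebra_simps)
  note eq = this
  have dist: "c * (F + Pser * G) = c * F + Pser * (c * G)" for c F G :: "rat fps"
    by (simp only: distrib_left mult.left_commute)
  have "fps_const (1 / D) * (fps_const D * residual k) =
      fps_const (1 / D) * (fps_const D * (Pser * (2 * Phi (l - 2)))) + Pser * (fps_const (1 / D) * (E + Y))"
    unfolding eq by (rule dist)
  moreover have "fps_const (1 / D) * (fps_const D * F) = F" for F using D(2) by (simp add: mult.assoc[symmetric])
  ultimately have "residual k = Pser * (2 * Phi (l - 2) + fps_const (1 / D) * (E + Y))"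
    by (simp only: distrib_left)
  moreover have "fps_const (1 / D) * (E + Y) \<in> Xset l (l - 1)"
    using mem unfolding Y_def[symmetric] by (intro Xset_scale[OF l D(1)] Xset_add E)
  ultimately show ?thesis unfolding k_def[symmetric] by blast
qed

end

theorem theorem7p6:
  fixes l :: nat
  assumes "prime l" and "l > 3"
  shows "(\<forall>k. 1 \<le> k \<and> k \<le> (l - 3) div 2 \<longrightarrow> Cser (2 * k) \<in> PXset l (2 * k))
       \<and> (\<exists>G. G \<in> Xset l (l - 1) \<and> Cser (l - 1) = 2 * Pser * Phi (l - 2) + Pser * G)
       \<and> (\<forall>k. 2 \<le> k \<and> k \<le> (l - 3) div 2 \<longrightarrow>
            Rser (2 * k) - poly_delta (Ppoly k) (Rser 2) \<in> PXset l (2 * k))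
       \<and> (\<exists>G. G \<in> Xset l (l - 1) \<and>
            Rser (l - 1) - poly_delta (Ppoly ((l - 1) div 2)) (Rser 2) = 2 * Pser * Phi (l - 2) + Pser * G)"
proof (intro conjI allI impI)
  fix k assume k: "1 \<le> k \<and> k \<le> (l - 3) div 2"
  hence "2 * k \<le> l - 3" by linarith
  from crank_moment_mem[OF assms this] show "Cser (2 * k) \<in> PXset l (2 * k)"
    using k by (auto simp: Cser_eq_emom PXset_def)
next
  show "\<exists>G. G \<in> Xset l (l - 1) \<and> Cser (l - 1) = 2 * Pser * Phi (l - 2) + Pser * G"
    using crank_moment_top[OF assms] assms(2) by (auto simp: Cser_eq_emom algebra_simps)
next
  fix k assume k: "2 \<le> k \<and> k \<le> (l - 3) div 2"
  hence "2 * k \<le> l - 3" "1 \<le> k" by linarith+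
  from residual_mem[OF assms this(2,1)] show "Rser (2 * k) - poly_delta (Ppoly k) (Rser 2) \<in> PXset l (2 * k)"
    using k by (auto simp: Rser_eq_emom PXset_def)
next
  have "2 * ((l - 1) div 2) = l - 1" using l_odd[OF assms] by simp
  thus "\<exists>G. G \<in> Xset l (l - 1) \<and> Rser (l - 1) - poly_delta (Ppoly ((l - 1) div 2)) (Rser 2) = 2 * Pser * Phi (l - 2) + Pser * G"
    using residual_top[OF assms] assms(2) by (auto simp: Rser_eq_emom algebra_simps)
qed

end
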